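(* Let $S^1\times S^1=(\mathbb{R}/2\pi\mathbb{Z})^2$ be the flat torus and let $D^{-1}_{S^1\times S^1}:L^2_{\mathbb{C}}(S^1\times S^1)\to L^2_{\mathbb{C}}(S^1\times S^1)$ be its inverse Laplace operator. For every integer $n\ge 2$, the $n$-fold composition $D^{-n}_{S^1\times S^1}:=(D^{-1}_{S^1\times S^1})^n$ is trace class, and $$\mathrm{Tr}\left(D^{-n}_{S^1\times S^1}\right)=4(-1)^n\,\zeta(n)\,\beta(n),$$ where $\zeta(n)=\sum_{j=1}^\infty j^{-n}$ is the Riemann zeta function and $\beta(n)=\sum_{m=0}^\infty(-1)^m(2m+1)^{-n}$.
   Context: The torus $S^1\times S^1=(\mathbb{R}/2\pi\mathbb{Z})^2$ carries the flat metric descended from $\mathbb{R}^2$ (so $g_{ij}=\delta_{ij}$ in the angular coordinates $\theta_1,\theta_2$). Inverse Laplace operator. Let $(M,g)$ be a smooth, oriented, closed, connected Riemannian manifold. The Laplacian is $\Delta=\mathrm{div}\circ\mathrm{grad}$ on real-valued functions in $C^\infty(M)$; on the flat torus, $\Delta=\partial^2/\partial\theta_1^2+\partial^2/\partial\theta_2^2$. $H^1(M)$ is the real Sobolev space obtained by completing $C^\infty(M)$ with respect to $\langle u,v\rangle_{H^1}=\int_M uv+\int_M\langle \mathrm{grad}\,u,\mathrm{grad}\,v\rangle_g$, identified with a subspace of $L^2_{\mathbb{R}}(M)$. $B:H^1(M)\times H^1(M)\to\mathbb{R}$ is the continuous bilinear extension of $B(u,v)=\int_M \Delta u\cdot v$,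 $u,v\in C^\infty(M)$. Let $K=\{u\in H^1(M): B(u,v)=0 \text{ for all } v\in H^1(M)\}$ and let $K^\perp$ be its orthogonal complement in $H^1(M)$. For $h\in L^2_{\mathbb{R}}(M)$, $D^{-1}(h)$ is the unique element of $K^\perp$ satisfying $B(D^{-1}(h),v)=\int_M h\cdot v$ for all $v\in K^\perp$. The inverse Laplace operator $D^{-1}:L^2_{\mathbb{C}}(M)\to L^2_{\mathbb{C}}(M)$ is the $\mathbb{C}$-linear extension $D^{-1}(f_0+if_1)=D^{-1}(f_0)+iD^{-1}(f_1)$, a bounded operator. Trace class. A bounded operator $A$ on a separable complex Hilbert space is trace class if $\sum_j\langle\varphi_j,|A|\varphi_j\rangle<\infty$ for some orthonormal basis $\{\varphi_j\}$, where $|A|=\sqrt{A^*A}$; then $\mathrm{Tr}(A)=\sum_j\langle\varphi_j,A\varphi_j\rangle$ for any orthonormal basis. *)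

theory Defs
  imports "HOL-Analysis.Analysis"
begin

section \<open>The flat torus\<close>

quotient_type circle = real / "\<lambda>x y. \<exists>k::int. x - y = 2 * pi * of_int k"
  morphisms rep_circle to_circle
proof (rule equivpI)
  show "reflp (\<lambda>x y. \<exists>k::int. x - y = 2 * pi * of_int k)"
    by (auto intro!: reflpI exI[of _ 0])
  show "symp (\<lambda>x y. \<exists>k::int. x - y = 2 * pi * of_int k)"
  proof (rule sympI)
    fix x y :: real
    assume "\<exists>k::int. x - y = 2 * pi * of_int k"
    then obtain k :: int where "x - y = 2 * pi * of_int k" by blast
    then have "y - x = 2 * pi * of_int (- k)" by simp
    then show "\<exists>k::int. y - x = 2 * pi * of_int k" by blast
  qed
  show "transp (\<lambda>x y. \<exists>k::int. x - y = 2 * pi * of_int k)"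
  proof (rule transpI)
    fix x y z :: real
    assume "\<exists>k::int. x - y = 2 * pi * of_int k" "\<exists>k::int. y - z = 2 * pi * of_int k"
    then obtain k l :: int where "x - y = 2 * pi * of_int k" "y - z = 2 * pi * of_int l" by blast
    then have "x - z = 2 * pi * of_int (k + l)" by (simp add: algebra_simps)
    then show "\<exists>k::int. x - z = 2 * pi * of_int k" by blast
  qed
qed

type_synonym torus = "circle \<times> circle"

definition to_torus :: "real \<times> real \<Rightarrow> torus"
  where "to_torus = map_prod to_circle to_circle"

definition rep_torus :: "torus \<Rightarrow> real \<times> real"
  where "rep_torus = map_prod rep_circle rep_circle"

lemma to_circle_eq_iff: "to_circle x = to_circle y \<longleftrightarrow> (\<exists>k::int. x - y = 2 * pi * of_int k)"
  by (rule circle.abs_eq_iff)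

lemma to_torus_rep_torus [simp]: "to_torus (rep_torus p) = p"
  by (cases p) (simp add: to_torus_def rep_torus_def Quotient_abs_rep[OF Quotient_circle])

text \<open>The measurable sets of the circle are those whose preimage in the real line is Borel; the
  measure is arc length (total mass \<open>2 * pi\<close>), so that the product measure on the torus is the
  Riemannian volume of the flat metric.\<close>

definition circle_measure :: "circle measure"
  where "circle_measure =
    distr (restrict_space lborel {0..<2 * pi}) (sigma UNIV {A. to_circle -` A \<in> sets borel}) to_circle"

definition torus_measure :: "torus measure"
  where "torus_measure = circle_measure \<Otimes>\<^sub>M circle_measure"

lemma sets_circle_measure: "sets circle_measure = {A. to_circle -` A \<in> sets borel}"
proof -
  have "sigma_algebra UNIV {A. to_circle -` A \<in> sets borel}"
    by (rule sigma_algebra_iff2[THEN iffD2])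
       (auto simp: vimage_UN vimage_Compl Compl_eq_Diff_UNIV[symmetric] borel_comp)
  then show ?thesis
    by (simp add: circle_measure_def sigma_algebra.sigma_sets_eq)
qed

lemma space_circle_measure [simp]: "space circle_measure = UNIV"
  by (simp add: circle_measure_def space_measure_of_conv)

lemma emeasure_circle_measure:
  assumes "to_circle -` A \<in> sets borel"
  shows "emeasure circle_measure A = emeasure lborel (to_circle -` A \<inter> {0..<2 * pi})"
proof -
  have sets: "sets (sigma UNIV {A. to_circle -` A \<in> sets borel}) = {A. to_circle -` A \<in> sets borel}"
    using sets_circle_measure by (simp add: circle_measure_def)
  have "to_circle \<in> measurable (restrict_space lborel {0..<2 * pi})
                                (sigma UNIV {A. to_circle -` A \<in> sets borel})"
    by (rule measurableI) (auto simp: sets space_restrict_space sets_restrict_space space_measure_of_conv)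
  then show ?thesis
    unfolding circle_measure_def using assms
    by (subst emeasure_distr) (auto simp: sets emeasure_restrict_space space_restrict_space)
qed

section \<open>Calculus on the torus\<close>

text \<open>Functions on the torus are differentiated through their lifts to the plane. Periodicity of
  the lift makes the result independent of the representative, see \<open>torus_deriv_to_torus\<close>.\<close>

definition torus_deriv :: "real \<times> real \<Rightarrow> (torus \<Rightarrow> real) \<Rightarrow> torus \<Rightarrow> real"
  where "torus_deriv v f p = frechet_derivative (f \<circ> to_torus) (at (rep_torus p)) v"

lemma torus_deriv_to_torus:
  "torus_deriv v f (to_torus x) = frechet_derivative (f \<circ> to_torus) (at x) v"
proof -
  let ?F = "f \<circ> to_torus" and ?r = "rep_torus (to_torus x)"
  define c where "c = ?r - x"
  have "to_torus ?r = to_torus x" by simp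
  then obtain k l :: int where kl: "fst c = 2 * pi * of_int k" "snd c = 2 * pi * of_int l"
    by (cases x; cases ?r) (auto simp: to_torus_def to_circle_eq_iff c_def)
  have "to_torus (y + c) = to_torus y" for y
  proof -
    have "to_circle (fst y + fst c) = to_circle (fst y)" "to_circle (snd y + snd c) = to_circle (snd y)"
      unfolding to_circle_eq_iff using kl by auto
    then show ?thesis by (cases y; cases c) (simp add: to_torus_def)
  qed
  then have per: "?F (y + c) = ?F y" for y by simp
  have shift: "(?F has_derivative D) (at (x + c)) \<longleftrightarrow> (?F has_derivative D) (at x)" for D
  proof
    assume *: "(?F has_derivative D) (at (x + c))"
    have "((\<lambda>y. y + c) has_derivative (\<lambda>h. h)) (at x)"
      by (rule has_derivative_add_const[OF has_derivative_ident])
    from has_derivative_compose[OF this *] show "(?F has_derivative D) (at x)"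
      by (simp only: per)
  next
    assume *: "(?F has_derivative D) (at x)"
    have per': "?F (y - c) = ?F y" for y using per[of "y - c"] by simp
    have "((\<lambda>y. y - c) has_derivative (\<lambda>h. h)) (at (x + c))"
      using has_derivative_add_const[OF has_derivative_ident, of "- c"] by simp
    moreover have "(?F has_derivative D) (at ((x + c) - c))" using * by simp
    ultimately have "((\<lambda>y. ?F (y - c)) has_derivative D) (at (x + c))"
      by (rule has_derivative_compose)
    then show "(?F has_derivative D) (at (x + c))" by (simp only: per')
  qed
  have "?r = x + c" by (simp add: c_def)
  then show ?thesis
    unfolding torus_deriv_def frechet_derivative_def by (simp only: shift)
qed

fun torus_Ck :: "nat \<Rightarrow> (torus \<Rightarrow> real) \<Rightarrow> bool" where
  "torus_Ck 0 f \<longleftrightarrow> continuous_on UNIV (f \<circ> to_torus)"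
| "torus_Ck (Suc k) f \<longleftrightarrow> (f \<circ> to_torus) differentiable_on UNIV \<and>
     torus_Ck k (torus_deriv (1, 0) f) \<and> torus_Ck k (torus_deriv (0, 1) f)"

definition torus_smooth :: "(torus \<Rightarrow> real) \<Rightarrow> bool"
  where "torus_smooth f \<longleftrightarrow> (\<forall>k. torus_Ck k f)"

text \<open>Vector fields are given by their components in the frame of the angular coordinates, in
  which the metric is the identity.\<close>

definition torus_grad :: "(torus \<Rightarrow> real) \<Rightarrow> torus \<Rightarrow> real \<times> real"
  where "torus_grad f p = (torus_deriv (1, 0) f p, torus_deriv (0, 1) f p)"

definition torus_div :: "(torus \<Rightarrow> real \<times> real) \<Rightarrow> torus \<Rightarrow> real"
  where "torus_div X p = torus_deriv (1, 0) (\<lambda>q. fst (X q)) p + torus_deriv (0, 1) (\<lambda>q. snd (X q)) p"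

definition torus_laplacian :: "(torus \<Rightarrow> real) \<Rightarrow> torus \<Rightarrow> real"
  where "torus_laplacian f = torus_div (torus_grad f)"

section \<open>The spaces of square-integrable functions\<close>

definition square_integrable :: "(torus \<Rightarrow> 'a::euclidean_space) \<Rightarrow> bool"
  where "square_integrable f \<longleftrightarrow>
    f \<in> borel_measurable torus_measure \<and> integrable torus_measure (\<lambda>p. (norm (f p))\<^sup>2)"

lemma square_integrable_zero: "square_integrable (\<lambda>_. 0)"
  by (simp add: square_integrable_def)

lemma square_integrable_bounded_linear:
  fixes T :: "'a::euclidean_space \<Rightarrow> 'b::euclidean_space"
  assumes "square_integrable f" "bounded_linear T"
  shows "square_integrable (\<lambda>p. T (f p))"
proof -
  have [measurable]: "f \<in> borel_measurable torus_measure" and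
    int: "integrable torus_measure (\<lambda>p. (norm (f p))\<^sup>2)"
    using assms(1) by (auto simp: square_integrable_def)
  have "T \<in> borel_measurable borel"
    by (intro borel_measurable_continuous_onI linear_continuous_on assms(2))
  then have meas [measurable]: "(\<lambda>p. T (f p)) \<in> borel_measurable torus_measure"
    by measurable
  obtain K where K: "\<And>x. norm (T x) \<le> norm x * K"
    using bounded_linear.bounded[OF assms(2)] by blast
  have "integrable torus_measure (\<lambda>p. (norm (T (f p)))\<^sup>2)"
  proof (rule Bochner_Integration.integrable_bound)
    show "integrable torus_measure (\<lambda>p. K\<^sup>2 * (norm (f p))\<^sup>2)" using int by simp
    have "(norm (T (f p)))\<^sup>2 \<le> K\<^sup>2 * (norm (f p))\<^sup>2" for p
      using power_mono[OF K[of "f p"], of 2] by (simp add: power_mult_distrib mult.commute)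
    then show "AE p in torus_measure. norm ((norm (T (f p)))\<^sup>2) \<le> norm (K\<^sup>2 * (norm (f p))\<^sup>2)"
      by (simp add: abs_mult)
  qed measurable
  with meas show ?thesis by (simp add: square_integrable_def)
qed

lemma square_integrable_add:
  assumes "square_integrable f" "square_integrable g"
  shows "square_integrable (\<lambda>p. f p + g p)"
proof -
  have [measurable]: "f \<in> borel_measurable torus_measure" "g \<in> borel_measurable torus_measure"
    and int: "integrable torus_measure (\<lambda>p. (norm (f p))\<^sup>2)"
      "integrable torus_measure (\<lambda>p. (norm (g p))\<^sup>2)"
    using assms by (auto simp: square_integrable_def)
  have "integrable torus_measure (\<lambda>p. (norm (f p + g p))\<^sup>2)"
  proof (rule Bochner_Integration.integrable_bound)
    show "integrable torus_measure (\<lambda>p. 2 * (norm (f p))\<^sup>2 + 2 * (norm (g p))\<^sup>2)"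
      using int by simp
    have "(norm (f p + g p))\<^sup>2 \<le> 2 * (norm (f p))\<^sup>2 + 2 * (norm (g p))\<^sup>2" for p
    proof -
      have "(norm (f p + g p))\<^sup>2 \<le> (norm (f p) + norm (g p))\<^sup>2"
        by (intro power_mono norm_triangle_ineq) simp
      also have "\<dots> \<le> 2 * (norm (f p))\<^sup>2 + 2 * (norm (g p))\<^sup>2"
        using sum_squares_bound[of "norm (f p)" "norm (g p)"] by (simp add: power2_sum)
      finally show ?thesis .
    qed
    then show "AE p in torus_measure. norm ((norm (f p + g p))\<^sup>2)
        \<le> norm (2 * (norm (f p))\<^sup>2 + 2 * (norm (g p))\<^sup>2)"
      by simp
  qed measurable
  then show ?thesis by (simp add: square_integrable_def)
qed

lemma integrable_square_integrable_inner:
  assumes "square_integrable f" "square_integrable g"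
  shows "integrable torus_measure (\<lambda>p. f p \<bullet> g p)"
proof -
  have [measurable]: "f \<in> borel_measurable torus_measure" "g \<in> borel_measurable torus_measure"
    and int: "integrable torus_measure (\<lambda>p. (norm (f p))\<^sup>2)"
      "integrable torus_measure (\<lambda>p. (norm (g p))\<^sup>2)"
    using assms by (auto simp: square_integrable_def)
  show ?thesis
  proof (rule Bochner_Integration.integrable_bound)
    show "integrable torus_measure (\<lambda>p. (norm (f p))\<^sup>2 + (norm (g p))\<^sup>2)"
      using int by simp
    have "\<bar>f p \<bullet> g p\<bar> \<le> (norm (f p))\<^sup>2 + (norm (g p))\<^sup>2" for p
      using Cauchy_Schwarz_ineq2[of "f p" "g p"] sum_squares_bound[of "norm (f p)" "norm (g p)"]
        mult_nonneg_nonneg[OF norm_ge_zero[of "f p"] norm_ge_zero[of "g p"]]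
      by linarith
    then show "AE p in torus_measure. norm (f p \<bullet> g p) \<le> norm ((norm (f p))\<^sup>2 + (norm (g p))\<^sup>2)"
      by simp
  qed measurable
qed

quotient_type (overloaded) 'a torus_L2 = "torus \<Rightarrow> 'a::euclidean_space" /
  partial: "\<lambda>f g. square_integrable f \<and> square_integrable g \<and> (AE p in torus_measure. f p = g p)"
  morphisms rep_L2 to_L2
proof (rule part_equivpI)
  show "\<exists>f::torus \<Rightarrow> 'a. square_integrable f \<and> square_integrable f \<and> (AE p in torus_measure. f p = f p)"
    using square_integrable_zero by auto
  show "symp (\<lambda>f g::torus \<Rightarrow> 'a. square_integrable f \<and> square_integrable g \<and>
      (AE p in torus_measure. f p = g p))"
    by (rule sympI) auto
  show "transp (\<lambda>f g::torus \<Rightarrow> 'a. square_integrable f \<and> square_integrable g \<and>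
      (AE p in torus_measure. f p = g p))"
    by (rule transpI) auto
qed

instantiation torus_L2 :: (euclidean_space) real_inner
begin

lift_definition zero_torus_L2 :: "'a torus_L2" is "\<lambda>_. 0"
  by (simp add: square_integrable_zero)

lift_definition plus_torus_L2 :: "'a torus_L2 \<Rightarrow> 'a torus_L2 \<Rightarrow> 'a torus_L2"
  is "\<lambda>f g p. f p + g p"
  by (auto simp: square_integrable_add)

lift_definition scaleR_torus_L2 :: "real \<Rightarrow> 'a torus_L2 \<Rightarrow> 'a torus_L2"
  is "\<lambda>r f p. r *\<^sub>R f p"
  by (auto simp: square_integrable_bounded_linear bounded_linear_scaleR_right)

lift_definition uminus_torus_L2 :: "'a torus_L2 \<Rightarrow> 'a torus_L2" is "\<lambda>f p. - f p"
  by (auto simp: square_integrable_bounded_linear bounded_linear_minus[OF bounded_linear_ident])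

lift_definition minus_torus_L2 :: "'a torus_L2 \<Rightarrow> 'a torus_L2 \<Rightarrow> 'a torus_L2"
  is "\<lambda>f g p. f p - g p"
  using square_integrable_add[OF _ square_integrable_bounded_linear[OF _
      bounded_linear_minus[OF bounded_linear_ident]]]
  by auto

lift_definition inner_torus_L2 :: "'a torus_L2 \<Rightarrow> 'a torus_L2 \<Rightarrow> real"
  is "\<lambda>f g. integral\<^sup>L torus_measure (\<lambda>p. f p \<bullet> g p)"
  by (rule integral_cong_AE)
     (auto simp: square_integrable_def elim!: eventually_elim2)

definition norm_torus_L2 :: "'a torus_L2 \<Rightarrow> real"
  where "norm_torus_L2 u = sqrt (u \<bullet> u)"

definition dist_torus_L2 :: "'a torus_L2 \<Rightarrow> 'a torus_L2 \<Rightarrow> real"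
  where "dist_torus_L2 u v = norm (u - v)"

definition sgn_torus_L2 :: "'a torus_L2 \<Rightarrow> 'a torus_L2"
  where "sgn_torus_L2 u = inverse (norm u) *\<^sub>R u"

definition uniformity_torus_L2 :: "('a torus_L2 \<times> 'a torus_L2) filter"
  where "uniformity_torus_L2 = (INF e\<in>{0<..}. principal {(u, v). dist u v < e})"

definition open_torus_L2 :: "'a torus_L2 set \<Rightarrow> bool"
  where "open_torus_L2 U \<longleftrightarrow> (\<forall>u\<in>U. eventually (\<lambda>(u', v). u' = u \<longrightarrow> v \<in> U) uniformity)"

instance
proof
  fix u v w :: "'a torus_L2" and a b r :: real and U :: "'a torus_L2 set"
  show "u + v + w = u + (v + w)"
    by transfer (auto simp: square_integrable_add algebra_simps)
  show "u + v = v + u"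
    by transfer (auto simp: square_integrable_add algebra_simps)
  show "0 + u = u"
    by transfer simp
  show "- u + u = 0"
    by transfer (simp add: square_integrable_zero)
  show "u - v = u + - v"
    by transfer (auto intro!: square_integrable_add
        square_integrable_bounded_linear[OF _ bounded_linear_minus[OF bounded_linear_ident]]
        simp: diff_conv_add_uminus simp del: add_uminus_conv_diff)
  show "a *\<^sub>R (u + v) = a *\<^sub>R u + a *\<^sub>R v"
    by transfer (auto intro!: square_integrable_add
        square_integrable_bounded_linear[OF _ bounded_linear_scaleR_right] simp: scaleR_add_right[symmetric])
  show "(a + b) *\<^sub>R u = a *\<^sub>R u + b *\<^sub>R u"
    by transfer (auto intro!: square_integrable_add
        square_integrable_bounded_linear[OF _ bounded_linear_scaleR_right] simp: scaleR_add_left)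
  show "a *\<^sub>R b *\<^sub>R u = (a * b) *\<^sub>R u"
    by transfer (auto intro!: square_integrable_bounded_linear[OF _ bounded_linear_scaleR_right]
        simp del: scaleR_scaleR simp: scaleR_scaleR[symmetric])
  show "1 *\<^sub>R u = u"
    by transfer simp
  show "dist u v = norm (u - v)"
    by (rule dist_torus_L2_def)
  show "sgn u = inverse (norm u) *\<^sub>R u"
    by (rule sgn_torus_L2_def)
  show "(uniformity :: ('a torus_L2 \<times> 'a torus_L2) filter)
      = (INF e\<in>{0<..}. principal {(u, v). dist u v < e})"
    by (rule uniformity_torus_L2_def)
  show "open U \<longleftrightarrow> (\<forall>u\<in>U. eventually (\<lambda>(u', v). u' = u \<longrightarrow> v \<in> U) uniformity)"
    by (rule open_torus_L2_def)
  show "u \<bullet> v = v \<bullet> u"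
    by transfer (simp add: inner_commute)
  show "(u + v) \<bullet> w = u \<bullet> w + v \<bullet> w"
    by transfer (simp add: inner_add_left integrable_square_integrable_inner)
  show "(r *\<^sub>R u) \<bullet> v = r * (u \<bullet> v)"
    by transfer simp
  show "0 \<le> u \<bullet> u"
    by transfer simp
  show "u \<bullet> u = 0 \<longleftrightarrow> u = 0"
    by transfer
       (subst integral_nonneg_eq_0_iff_AE;
        auto simp: integrable_square_integrable_inner square_integrable_zero)
  show "norm u = sqrt (u \<bullet> u)"
    by (rule norm_torus_L2_def)
qed

end

lift_definition L2_Re :: "complex torus_L2 \<Rightarrow> real torus_L2" is "\<lambda>f p. Re (f p)"
  by (auto simp: square_integrable_bounded_linear bounded_linear_Re)

lift_definition L2_Im :: "complex torus_L2 \<Rightarrow> real torus_L2" is "\<lambda>f p. Im (f p)"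
  by (auto simp: square_integrable_bounded_linear bounded_linear_Im)

lift_definition L2_Complex :: "real torus_L2 \<Rightarrow> real torus_L2 \<Rightarrow> complex torus_L2"
  is "\<lambda>f g p. Complex (f p) (g p)"
proof -
  fix f f' g g' :: "torus \<Rightarrow> real"
  have *: "square_integrable (\<lambda>p. Complex (f p) (g p))"
    if "square_integrable f" "square_integrable g" for f g :: "torus \<Rightarrow> real"
    using square_integrable_add[OF square_integrable_bounded_linear[OF that(1) bounded_linear_of_real]
        square_integrable_bounded_linear[OF that(2)
          bounded_linear_compose[OF bounded_linear_mult_right[of \<i>] bounded_linear_of_real]]]
    by (simp add: Complex_eq)
  assume "square_integrable f \<and> square_integrable f' \<and> (AE p in torus_measure. f p = f' p)"
    "square_integrable g \<and> square_integrable g' \<and> (AE p in torus_measure. g p = g' p)"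
  then show "square_integrable (\<lambda>p. Complex (f p) (g p)) \<and> square_integrable (\<lambda>p. Complex (f' p) (g' p)) \<and>
      (AE p in torus_measure. Complex (f p) (g p) = Complex (f' p) (g' p))"
    using * by auto
qed

lift_definition L2_scaleC :: "complex \<Rightarrow> complex torus_L2 \<Rightarrow> complex torus_L2"
  is "\<lambda>c f p. c * f p"
  by (auto simp: square_integrable_bounded_linear bounded_linear_mult_right)

text \<open>Conjugate-linear in the first argument; the real inner product of the class instance is its
  real part.\<close>

lift_definition L2_cinner :: "complex torus_L2 \<Rightarrow> complex torus_L2 \<Rightarrow> complex"
  is "\<lambda>f g. integral\<^sup>L torus_measure (\<lambda>p. cnj (f p) * g p)"
proof -
  have [measurable]: "cnj \<in> borel_measurable borel"
    by (intro borel_measurable_continuous_onI linear_continuous_on bounded_linear_cnj)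
  fix f f' g g' :: "torus \<Rightarrow> complex"
  assume "square_integrable f \<and> square_integrable f' \<and> (AE p in torus_measure. f p = f' p)"
    "square_integrable g \<and> square_integrable g' \<and> (AE p in torus_measure. g p = g' p)"
  then have [measurable]: "f \<in> borel_measurable torus_measure" "f' \<in> borel_measurable torus_measure"
      "g \<in> borel_measurable torus_measure" "g' \<in> borel_measurable torus_measure"
    and eq: "AE p in torus_measure. f p = f' p" "AE p in torus_measure. g p = g' p"
    by (auto simp: square_integrable_def)
  show "integral\<^sup>L torus_measure (\<lambda>p. cnj (f p) * g p) = integral\<^sup>L torus_measure (\<lambda>p. cnj (f' p) * g' p)"
    using eq by (intro integral_cong_AE) (measurable, auto)
qed

section \<open>The Sobolev space and the inverse Laplace operator\<close>

definition smooth_H1_inner :: "(torus \<Rightarrow> real) \<Rightarrow> (torus \<Rightarrow> real) \<Rightarrow> real"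
  where "smooth_H1_inner f g =
    integral\<^sup>L torus_measure (\<lambda>p. f p * g p) +
    integral\<^sup>L torus_measure (\<lambda>p. torus_grad f p \<bullet> torus_grad g p)"

definition smooth_B :: "(torus \<Rightarrow> real) \<Rightarrow> (torus \<Rightarrow> real) \<Rightarrow> real"
  where "smooth_B f g = integral\<^sup>L torus_measure (\<lambda>p. torus_laplacian f p * g p)"

text \<open>The completion of the smooth functions, as a subspace of \<open>real torus_L2\<close>: \<open>u\<close> corresponds to
  the class of the Cauchy sequences of smooth functions (for the Sobolev norm) that tend to \<open>u\<close> in the
  weaker square norm. The inner product and the bilinear form extend by continuity along such
  sequences.\<close>

definition H1_represents :: "(nat \<Rightarrow> torus \<Rightarrow> real) \<Rightarrow> real torus_L2 \<Rightarrow> bool"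
  where "H1_represents F u \<longleftrightarrow>
    (\<forall>i. torus_smooth (F i)) \<and>
    (\<forall>e>0. \<exists>N. \<forall>i\<ge>N. \<forall>j\<ge>N.
       sqrt (smooth_H1_inner (\<lambda>p. F i p - F j p) (\<lambda>p. F i p - F j p)) < e) \<and>
    (\<lambda>i. to_L2 (F i)) \<longlonglongrightarrow> u"

definition H1 :: "real torus_L2 set"
  where "H1 = {u. \<exists>F. H1_represents F u}"

definition H1_inner :: "real torus_L2 \<Rightarrow> real torus_L2 \<Rightarrow> real"
  where "H1_inner u v = (THE c. \<forall>F G. H1_represents F u \<longrightarrow> H1_represents G v \<longrightarrow>
    (\<lambda>i. smooth_H1_inner (F i) (G i)) \<longlonglongrightarrow> c)"

definition H1_B :: "real torus_L2 \<Rightarrow> real torus_L2 \<Rightarrow> real"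
  where "H1_B u v = (THE c. \<forall>F G. H1_represents F u \<longrightarrow> H1_represents G v \<longrightarrow>
    (\<lambda>i. smooth_B (F i) (G i)) \<longlonglongrightarrow> c)"

definition H1_kernel :: "real torus_L2 set"
  where "H1_kernel = {u \<in> H1. \<forall>v\<in>H1. H1_B u v = 0}"

definition H1_kernel_perp :: "real torus_L2 set"
  where "H1_kernel_perp = {u \<in> H1. \<forall>v\<in>H1_kernel. H1_inner u v = 0}"

definition inverse_laplace_real :: "real torus_L2 \<Rightarrow> real torus_L2"
  where "inverse_laplace_real h =
    (THE w. w \<in> H1_kernel_perp \<and> (\<forall>v\<in>H1_kernel_perp. H1_B w v = h \<bullet> v))"

definition inverse_laplace :: "complex torus_L2 \<Rightarrow> complex torus_L2"
  where "inverse_laplace f =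
    L2_Complex (inverse_laplace_real (L2_Re f)) (inverse_laplace_real (L2_Im f))"

section \<open>Trace class operators\<close>

definition L2_bounded_operator :: "(complex torus_L2 \<Rightarrow> complex torus_L2) \<Rightarrow> bool"
  where "L2_bounded_operator A \<longleftrightarrow>
    bounded_linear A \<and> (\<forall>c u. A (L2_scaleC c u) = L2_scaleC c (A u))"

definition L2_positive_operator :: "(complex torus_L2 \<Rightarrow> complex torus_L2) \<Rightarrow> bool"
  where "L2_positive_operator A \<longleftrightarrow>
    L2_bounded_operator A \<and> (\<forall>u. L2_cinner u (A u) \<in> \<real>\<^sub>\<ge>\<^sub>0)"

definition L2_adjoint ::
    "(complex torus_L2 \<Rightarrow> complex torus_L2) \<Rightarrow> complex torus_L2 \<Rightarrow> complex torus_L2"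
  where "L2_adjoint A = (THE A'. L2_bounded_operator A' \<and>
    (\<forall>u v. L2_cinner (A' u) v = L2_cinner u (A v)))"

definition L2_sqrt ::
    "(complex torus_L2 \<Rightarrow> complex torus_L2) \<Rightarrow> complex torus_L2 \<Rightarrow> complex torus_L2"
  where "L2_sqrt A = (THE P. L2_positive_operator P \<and> P \<circ> P = A)"

definition L2_abs ::
    "(complex torus_L2 \<Rightarrow> complex torus_L2) \<Rightarrow> complex torus_L2 \<Rightarrow> complex torus_L2"
  where "L2_abs A = L2_sqrt (L2_adjoint A \<circ> A)"

definition L2_orthonormal_basis :: "complex torus_L2 set \<Rightarrow> bool"
  where "L2_orthonormal_basis S \<longleftrightarrow>
    (\<forall>u\<in>S. \<forall>v\<in>S. L2_cinner u v = (if u = v then 1 else 0)) \<and>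
    closure (module.span L2_scaleC S) = UNIV"

definition L2_trace_class :: "(complex torus_L2 \<Rightarrow> complex torus_L2) \<Rightarrow> bool"
  where "L2_trace_class A \<longleftrightarrow> L2_bounded_operator A \<and>
    (\<exists>S. L2_orthonormal_basis S \<and> (\<lambda>u. L2_cinner u (L2_abs A u)) summable_on S)"

definition L2_trace :: "(complex torus_L2 \<Rightarrow> complex torus_L2) \<Rightarrow> complex"
  where "L2_trace A = (THE t. \<forall>S. L2_orthonormal_basis S \<longrightarrow>
    ((\<lambda>u. L2_cinner u (A u)) has_sum t) S)"

lemma vector_space_L2_scaleC: "vector_space L2_scaleC"
proof
  fix a b :: complex and u v :: "complex torus_L2"
  show "L2_scaleC a (u + v) = L2_scaleC a u + L2_scaleC a v"
    by transfer (auto intro!: square_integrable_add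
        square_integrable_bounded_linear[OF _ bounded_linear_mult_right] simp: distrib_left[symmetric])
  show "L2_scaleC (a + b) u = L2_scaleC a u + L2_scaleC b u"
    by transfer (auto intro!: square_integrable_add
        square_integrable_bounded_linear[OF _ bounded_linear_mult_right] simp: distrib_right)
  show "L2_scaleC a (L2_scaleC b u) = L2_scaleC (a * b) u"
    by transfer (auto intro!: square_integrable_bounded_linear[OF _ bounded_linear_mult_right]
        simp del: mult.assoc simp: mult.assoc[symmetric])
  show "L2_scaleC 1 u = u"
    by transfer simp
qed

section \<open>Special functions at positive integers\<close>

definition zeta_nat :: "nat \<Rightarrow> real"
  where "zeta_nat n = (\<Sum>j. 1 / real (Suc j) ^ n)"

definition beta_nat :: "nat \<Rightarrow> real"
  where "beta_nat n = (\<Sum>m. (- 1) ^ m / real (2 * m + 1) ^ n)"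

end

theory Submission
  imports Defs
begin

text \<open>
  In Fourier coordinates the inverse Laplace operator is diagonal: the exponential of frequency
  \<open>k \<in> \<int>\<^sup>2\<close> is an eigenvector with eigenvalue \<open>- 1 / \<bar>k\<bar>\<^sup>2\<close> for \<open>k \<noteq> 0\<close> and \<open>0\<close> for \<open>k = 0\<close>
  (\<open>cinner_fourier_inverse_laplace\<close>).  Its \<open>n\<close>-th power has the eigenvalues \<open>(- 1)\<^sup>n / \<bar>k\<bar>\<^sup>2\<^sup>n\<close>, so its
  absolute value is \<open>(- 1)\<^sup>n\<close> times the power itself, and by Parseval both the trace norm and, up to
  sign, the trace are equal to the sum of \<open>1 / \<bar>k\<bar>\<^sup>2\<^sup>n\<close> over the nonzero lattice points, whatever
  orthonormal basis is used (\<open>fourier_multiplier_trace_sum\<close>).  Grouping the lattice points by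
  \<open>m = \<bar>k\<bar>\<^sup>2\<close> and inserting Jacobi's formula for the number of representations of \<open>m\<close> as a sum of two
  squares, \<open>4 * (\<Sum>d | d dvd m. chi4 d)\<close>, factors this sum as \<open>4 * \<zeta>(n) * \<beta>(n)\<close>
  (\<open>square_lattice_zeta\<close>).

  Jacobi's formula (\<open>Jacobi_two_squares\<close>) has an elementary proof by induction.  In the only
  interesting class, \<open>m = 1\<close> modulo 4, the number of representations satisfies a recurrence, because
  exactly one of \<open>i\<close>, \<open>a\<close>, \<open>b\<close> is odd if \<open>i\<^sup>2 + a\<^sup>2 + b\<^sup>2 = m\<close>.  The divisor sums satisfy the same
  recurrence, by Liouville's method of reflecting the solutions of an indefinite quadratic equation
  (\<open>Liouville_reflection\<close>).

  That the Fourier system is an orthonormal basis (\<open>fourier_orthonormal_basis\<close>) follows from the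
  Stone-Weierstrass theorem on the image of the torus in \<open>\<complex>\<^sup>2\<close>.

  The operator itself is defined through the Sobolev space, whose inner product and bilinear form
  are limits along sequences of smooth functions.  They are well defined because the gradient is
  closable (\<open>H1_embed_closable\<close>).  Testing the defining equation against waves determines all
  Fourier coefficients of the solution; conversely, the Fourier series with these coefficients
  converges absolutely, because the sum of \<open>1 / \<bar>k\<bar>\<^sup>4\<close> is finite, and it solves the equation
  (\<open>inverse_laplace_real_exists\<close>).
\<close>

section \<open>Sums of two squares\<close>

text \<open>The nontrivial Dirichlet character modulo 4.\<close>
definition chi4 :: "int \<Rightarrow> int"
  where "chi4 x = (if x mod 4 = 1 then 1 else if x mod 4 = 3 then - 1 else 0)"

lemma chi4_add_4: "4 dvd d \<Longrightarrow> chi4 (d + x) = chi4 x"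
  by (auto simp: chi4_def elim!: dvdE)

lemma mod_4_cases:
  obtains q :: int where "x = 4 * q \<or> x = 4 * q + 1 \<or> x = 4 * q + 2 \<or> x = 4 * q + 3"
proof -
  have "x mod 4 \<in> {0, 1, 2, 3}" by auto
  moreover have "x = 4 * (x div 4) + x mod 4" by simp
  ultimately show ?thesis using that[of "x div 4"] by (metis insert_iff empty_iff add.right_neutral)
qed

lemma chi4_add_4' [simp]: "chi4 (4 * q + x) = chi4 x" "chi4 (4 * q) = 0"
  "chi4 (x - 4 * q) = chi4 x" "chi4 (- (4 * q)) = 0"
  using chi4_add_4[of "4 * q" x] chi4_add_4[of "4 * q" 0] chi4_add_4[of "- (4 * q)" x]
    chi4_add_4[of "- (4 * q)" 0] by (simp_all add: chi4_def)

lemma chi4_minus: "chi4 (- x) = - chi4 x"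
proof -
  obtain q where "x = 4 * q \<or> x = 4 * q + 1 \<or> x = 4 * q + 2 \<or> x = 4 * q + 3" by (rule mod_4_cases)
  moreover have "- (4 * q + r) = - r - 4 * q" for r by simp
  ultimately show ?thesis
    by (elim disjE) (simp_all only: chi4_add_4', simp_all add: chi4_def)
qed

lemma chi4_even [simp]: "even x \<Longrightarrow> chi4 x = 0"
  by (rule mod_4_cases[of x]) (auto simp: chi4_def)

lemma chi4_diff_2: "chi4 (x - 2) = - chi4 x"
proof -
  obtain q where "x = 4 * q \<or> x = 4 * q + 1 \<or> x = 4 * q + 2 \<or> x = 4 * q + 3" by (rule mod_4_cases)
  moreover have "4 * q + r - 2 = 4 * q + (r - 2)" "4 * q - 2 = 4 * q + (- 2)" for r by simp_all
  ultimately show ?thesis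
    by (elim disjE) (simp_all only: chi4_add_4', simp_all add: chi4_def)
qed

lemma chi4_shift_even: "even i \<Longrightarrow> chi4 (x - 2 * i) = chi4 x"
  by (auto elim!: evenE)

lemma chi4_shift_odd: "odd i \<Longrightarrow> chi4 (x - 2 * i) = - chi4 x"
  using chi4_shift_even[of "i - 1" "x - 2"] chi4_diff_2[of x] by (simp add: algebra_simps)

lemma chi4_mult_3_mod_4:
  assumes "(d * e) mod 4 = 3" shows "chi4 d + chi4 e = 0"
proof -
  have "(d mod 4) * (e mod 4) mod 4 = 3" using assms by (simp add: mod_mult_eq)
  moreover have "d mod 4 \<in> {0,1,2,3}" "e mod 4 \<in> {0,1,2,3}" by auto
  ultimately have "d mod 4 = 1 \<and> e mod 4 = 3 \<or> d mod 4 = 3 \<and> e mod 4 = 1" by auto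
  then show ?thesis by (auto simp: chi4_def)
qed

definition chi4_divisor_sum :: "int \<Rightarrow> int"
  where "chi4_divisor_sum m = (\<Sum>d | 0 < d \<and> d dvd m. chi4 d)"

definition two_square_reps :: "int \<Rightarrow> (int \<times> int) set"
  where "two_square_reps m = {(a, b). a\<^sup>2 + b\<^sup>2 = m}"

lemma abs_le_of_square_le:
  assumes "(a::int)\<^sup>2 \<le> m" shows "\<bar>a\<bar> \<le> m"
proof (cases "a = 0")
  case False
  then have "\<bar>a\<bar> * 1 \<le> \<bar>a\<bar> * \<bar>a\<bar>" by (intro mult_left_mono) auto
  then show ?thesis using assms by (simp add: power2_eq_square)
qed (use assms in simp)

lemma finite_square_le: "finite {i::int. i\<^sup>2 \<le> m}"
  by (rule finite_subset[of _ "{-m..m}"]) (use abs_le_of_square_le in fastforce)+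

lemma finite_two_square_reps: "finite (two_square_reps m)"
proof (rule finite_subset)
  show "two_square_reps m \<subseteq> {i. i\<^sup>2 \<le> m} \<times> {i. i\<^sup>2 \<le> m}"
    by (auto simp: two_square_reps_def)
qed (simp add: finite_square_le)

lemma finite_divisors_pos: "m > 0 \<Longrightarrow> finite {d::int. 0 < d \<and> d dvd m}"
  by (rule finite_subset[of _ "{0..m}"]) (auto dest: zdvd_imp_le)

definition factored_solutions :: "int \<Rightarrow> (int \<times> int \<times> int) set"
  where "factored_solutions n = {(i, e, d). e > 0 \<and> d > 0 \<and> i\<^sup>2 + e * d = n}"

lemma finite_factored_solutions: "finite (factored_solutions n)"
proof (rule finite_subset)
  show "factored_solutions n \<subseteq> {i. i\<^sup>2 \<le> n} \<times> {0..n} \<times> {0..n}"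
  proof
    fix p assume "p \<in> factored_solutions n"
    then obtain i e d where p: "p = (i, e, d)" "e > 0" "d > 0" "i\<^sup>2 + e * d = n"
      by (auto simp: factored_solutions_def)
    then have "e * d > 0" "d \<le> e * d" "e \<le> e * d" "i\<^sup>2 \<ge> 0" by auto
    then have "i\<^sup>2 \<le> n" "d \<le> n" "e \<le> n" using p by linarith+
    then show "p \<in> {i. i\<^sup>2 \<le> n} \<times> {0..n} \<times> {0..n}" using p by auto
  qed
qed (simp add: finite_square_le)

text \<open>Both substitutions of the reflection argument below are inverted by halving \<open>x + z\<close>, which the
  equation forces to be even.\<close>

lemma indefinite_solution:
  fixes x y z n :: int
  assumes "x\<^sup>2 + 4 * y\<^sup>2 - z\<^sup>2 = 4 * n"
  obtains e where "x + z = 2 * e" "(y - e)\<^sup>2 + e * (2 * y - z) = n" "y\<^sup>2 + e * (x - e) = n"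
proof -
  from assms have "even (x\<^sup>2 + 4 * y\<^sup>2 - z\<^sup>2)" by presburger
  then have "even (x + z)" by simp
  then obtain e where e: "x + z = 2 * e" by blast
  then have z: "z = 2 * e - x" by simp
  have "(y - e)\<^sup>2 + e * (2 * y - z) = n" "y\<^sup>2 + e * (x - e) = n"
    using assms unfolding z by (simp_all add: power2_eq_square algebra_simps)
  then show ?thesis by (rule that[OF e])
qed

text \<open>Four consecutive terms cancel, which leaves \<open>chi4 1\<close>.\<close>

lemma sum_chi4_odd_below:
  fixes a :: int
  assumes "odd a" "a > 0"
  shows "(\<Sum>x | 0 < x \<and> x < 2 * a. chi4 x) = 1"
proof -
  obtain b where b: "a = 2 * b + 1" using assms(1) by (rule oddE)
  have "(\<Sum>x | 0 < x \<and> x < 2 * (2 * int k + 1). chi4 x) = 1" for k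
  proof (induction k)
    case 0
    have "{x::int. 0 < x \<and> x < 2} = {1}" by auto
    then show ?case by (simp add: chi4_def)
  next
    case (Suc k)
    let ?S = "\<lambda>k. {x::int. 0 < x \<and> x < 2 * (2 * int k + 1)}"
    let ?m = "4 * int k"
    have "?S (Suc k) = ?S k \<union> {?m + 2, ?m + 3, ?m + 4, ?m + 5}" by auto
    moreover have "finite (?S k)" by (rule finite_subset[of _ "{0..2 * (2 * int k + 1)}"]) auto
    ultimately have "(\<Sum>x\<in>?S (Suc k). chi4 x) = (\<Sum>x\<in>?S k. chi4 x) + (\<Sum>x\<in>{?m + 2, ?m + 3, ?m + 4, ?m + 5}. chi4 x)"
      by (simp only:) (rule sum.union_disjoint, auto)
    also have "(\<Sum>x\<in>{?m + 2, ?m + 3, ?m + 4, ?m + 5}. chi4 x) = 0"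
      by (simp add: chi4_def)
    finally show ?case using Suc by simp
  qed
  from this[of "nat b"] b assms(2) show ?thesis by simp
qed

text \<open>The heart of the matter is a reflection argument in the style of Liouville.  The substitution
  \<open>(x, y, z) = (d - 2 * i, e + i, 2 * e + 2 * i - d)\<close> turns the equation \<open>i\<^sup>2 + e * d = n\<close> into
  \<open>x\<^sup>2 + 4 * y\<^sup>2 - z\<^sup>2 = 4 * n\<close>, whose symmetries \<open>x \<mapsto> -x\<close> and \<open>(y, z) \<mapsto> (-y, -z)\<close> were invisible
  before.  On the part \<open>z > \<bar>x\<bar>\<close> of the solution set the first symmetry cancels the odd function
  \<open>chi4 x\<close>; the part \<open>\<bar>z\<bar> < x\<close> is half of a set \<open>W\<close> closed under the second symmetry, which another
  substitution, \<open>(x, y, z) = (e + d, i, e - d)\<close>, maps back to the original equation; the part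
  \<open>z = x\<close> is explicit, and empty unless \<open>n\<close> is a square.\<close>

lemma Liouville_reflection:
  fixes n :: int
  assumes "n mod 4 = 1" "n > 0"
  shows "(\<Sum>(i, e, d) | (i, e, d) \<in> factored_solutions n \<and> odd d. chi4 (d - 2 * i)) =
    (\<Sum>(i, e, d) | (i, e, d) \<in> factored_solutions n \<and> odd d \<and> even e. chi4 (e + d))
    + (if \<exists>a. n = a\<^sup>2 then 1 else 0)" (is "?L = ?R + ?q")
proof -
  define U where "U = {(x, y, z). x\<^sup>2 + 4 * y\<^sup>2 - z\<^sup>2 = 4 * n \<and> x + z > 0 \<and> 2 * y - z > 0 \<and> odd x \<and> odd (z::int)}"
  define W where "W = {(x, y, z). x\<^sup>2 + 4 * y\<^sup>2 - z\<^sup>2 = 4 * n \<and> - x < z \<and> z < x \<and> odd x \<and> odd (z::int)}"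
  define f where "f = (\<lambda>(x, y::int, z::int). chi4 x)"
  let ?S = "factored_solutions n"
  let ?T0 = "{p. case p of (i, e, d) \<Rightarrow> (i, e, d) \<in> ?S \<and> odd d}"
  let ?T1 = "{p. case p of (i, e, d) \<Rightarrow> (i, e, d) \<in> ?S \<and> odd (e + d)}"
  let ?\<phi> = "\<lambda>(i::int, e::int, d::int). (d - 2 * i, e + i, 2 * e + 2 * i - d)" and ?\<psi> = "\<lambda>(i::int, e::int, d::int). (e + d, i, e - d)"
  have inj: "inj ?\<phi>" "inj ?\<psi>" by (auto simp: inj_on_def; linarith)+
  have U_eq: "U = ?\<phi> ` ?T0"
  proof (intro equalityI subsetI)
    fix p assume "p \<in> U"
    then obtain x y z where p: "p = (x, y, z)" "x\<^sup>2 + 4 * y\<^sup>2 - z\<^sup>2 = 4 * n" "x + z > 0" "2 * y - z > 0" "odd z"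
      by (auto simp: U_def)
    obtain e where e: "x + z = 2 * e" "(y - e)\<^sup>2 + e * (2 * y - z) = n" by (rule indefinite_solution[OF p(2)])
    show "p \<in> ?\<phi> ` ?T0"
      by (rule image_eqI[where x = "(y - e, e, 2 * y - z)"]) (use p e in \<open>auto simp: factored_solutions_def\<close>)
  next
    have "(d - 2 * i)\<^sup>2 + 4 * (e + i)\<^sup>2 - (2 * e + 2 * i - d)\<^sup>2 = 4 * (i\<^sup>2 + e * d)" for i e d :: int
      by (simp add: power2_eq_square algebra_simps)
    then show "p \<in> U" if "p \<in> ?\<phi> ` ?T0" for p using that by (auto simp: U_def factored_solutions_def)
  qed
  have W_eq: "W = ?\<psi> ` ?T1"
  proof (intro equalityI subsetI)
    fix p assume "p \<in> W"
    then obtain x y z where p: "p = (x, y, z)" "x\<^sup>2 + 4 * y\<^sup>2 - z\<^sup>2 = 4 * n" "- x < z" "z < x" "odd x"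
      by (auto simp: W_def)
    obtain e where e: "x + z = 2 * e" "y\<^sup>2 + e * (x - e) = n" by (rule indefinite_solution[OF p(2)])
    show "p \<in> ?\<psi> ` ?T1"
      by (rule image_eqI[where x = "(y, e, x - e)"]) (use p e in \<open>auto simp: factored_solutions_def\<close>)
  next
    have "(e + d)\<^sup>2 + 4 * i\<^sup>2 - (e - d)\<^sup>2 = 4 * (i\<^sup>2 + e * d)" for i e d :: int
      by (simp add: power2_eq_square algebra_simps)
    then show "p \<in> W" if "p \<in> ?\<psi> ` ?T1" for p using that by (auto simp: W_def factored_solutions_def)
  qed
  have fin: "finite ?T0" "finite ?T1"
    by (rule finite_subset[OF _ finite_factored_solutions[of n]], auto)+
  then have finU: "finite U" and finW: "finite W" unfolding U_eq W_eq by (simp_all only: finite_imageI)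
  have LU: "?L = sum f U"
    unfolding U_eq by (subst sum.reindex[OF inj_on_subset[OF inj(1) subset_UNIV]]) (auto simp: f_def intro!: sum.cong)
  let ?U1 = "{p \<in> U. case p of (x, y, z) \<Rightarrow> z > x}"
  let ?U2 = "{p \<in> U. case p of (x, y, z) \<Rightarrow> z < x}"
  let ?U3 = "{p \<in> U. case p of (x, y, z) \<Rightarrow> z = x}"
  have "U = ?U1 \<union> (?U2 \<union> ?U3)" by auto
  then have "sum f U = sum f (?U1 \<union> (?U2 \<union> ?U3))" by simp
  also have "\<dots> = sum f ?U1 + sum f (?U2 \<union> ?U3)"
    by (rule sum.union_disjoint) (use finU in auto)
  also have "sum f (?U2 \<union> ?U3) = sum f ?U2 + sum f ?U3"
    by (rule sum.union_disjoint) (use finU in auto)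
  finally have U: "sum f U = sum f ?U1 + (sum f ?U2 + sum f ?U3)" .
  have "sum f ?U1 = (\<Sum>p\<in>?U1. - f p)"
    by (rule sum.reindex_bij_witness[where i = "\<lambda>(x, y, z). (- x, y, z)" and j = "\<lambda>(x, y, z). (- x, y, z)"])
       (auto simp: f_def U_def chi4_minus)
  then have U1: "sum f ?U1 = 0" by (simp add: sum_negf)
  have W: "sum f W = 2 * sum f ?U2"
  proof -
    let ?V = "{p \<in> W. case p of (x, y, z) \<Rightarrow> 2 * y - z < 0}"
    have "W = ?U2 \<union> ?V"
      by (auto simp: W_def U_def) (metis even_mult_iff even_numeral not_less_iff_gr_or_eq)
    then have "sum f W = sum f (?U2 \<union> ?V)" by simp
    also have "\<dots> = sum f ?U2 + sum f ?V"
      by (rule sum.union_disjoint) (use finU finW in \<open>auto simp: U_def\<close>)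
    also have "sum f ?V = sum f ?U2"
      by (rule sum.reindex_bij_witness[where i = "\<lambda>(x, y, z). (x, - y, - z)" and j = "\<lambda>(x, y, z). (x, - y, - z)"])
       (auto simp: f_def U_def W_def)
    finally show ?thesis by simp
  qed
  have U3: "sum f ?U3 = ?q"
  proof (cases "\<exists>a. n = a\<^sup>2")
    case False
    then have "?U3 = {}" by (auto simp: U_def)
    then show ?thesis using False by (simp only: sum.empty if_False)
  next
    case True
    then obtain a0 where "n = a0\<^sup>2" by blast
    then have "n = \<bar>a0\<bar>\<^sup>2" "\<bar>a0\<bar> > 0" using assms by auto
    then obtain a where a: "n = a\<^sup>2" "a > 0" by blast
    have "odd a"
    proof
      assume "even a"
      then have "4 dvd a\<^sup>2" by (auto elim!: evenE simp: power2_eq_square)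
      then show False using a(1) assms(1) by presburger
    qed
    have "?U3 = (\<lambda>x. (x, a, x)) ` {x. 0 < x \<and> x < 2 * a \<and> odd x}"
      using a by (force simp: U_def power2_eq_iff)
    then have "sum f ?U3 = (\<Sum>x | 0 < x \<and> x < 2 * a \<and> odd x. chi4 x)"
      by (simp add: sum.reindex inj_on_def f_def)
    also have "\<dots> = (\<Sum>x | 0 < x \<and> x < 2 * a. chi4 x)"
      by (rule sum.mono_neutral_cong_left) (auto intro: finite_subset[of _ "{0..2*a}"])
    finally have "sum f ?U3 = (\<Sum>x | 0 < x \<and> x < 2 * a. chi4 x)" .
    then show ?thesis using sum_chi4_odd_below[OF \<open>odd a\<close> a(2)] True by simp
  qed
  have WR: "sum f W = 2 * ?R"
  proof -
    let ?Te = "{p. case p of (i, e, d) \<Rightarrow> (i, e, d) \<in> ?S \<and> odd d \<and> even e}"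
    let ?To = "{p. case p of (i, e, d) \<Rightarrow> (i, e, d) \<in> ?S \<and> even d \<and> odd e}"
    have "sum f W = (\<Sum>(i, e, d)\<in>?T1. chi4 (e + d))"
      unfolding W_eq by (subst sum.reindex[OF inj_on_subset[OF inj(2) subset_UNIV]]) (auto simp: f_def intro!: sum.cong)
    also have "?T1 = ?Te \<union> ?To" by auto
    also have "(\<Sum>(i, e, d)\<in>?Te \<union> ?To. chi4 (e + d)) =
        (\<Sum>(i, e, d)\<in>?Te. chi4 (e + d)) + (\<Sum>(i, e, d)\<in>?To. chi4 (e + d))"
      by (rule sum.union_disjoint) (auto intro: finite_subset[OF _ finite_factored_solutions[of n]])
    also have "(\<Sum>(i, e, d)\<in>?To. chi4 (e + d)) = (\<Sum>(i, e, d)\<in>?Te. chi4 (e + d))"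
      by (rule sum.reindex_bij_witness[where i = "\<lambda>(i, e, d). (i, d, e)" and j = "\<lambda>(i, e, d). (i, d, e)"])
         (auto simp: factored_solutions_def algebra_simps)
    finally show ?thesis by simp
  qed
  show ?thesis using LU U U1 W U3 WR by simp
qed

text \<open>For \<open>n\<close> congruent to 1 modulo 4, the equation \<open>i\<^sup>2 + e * d = n\<close> with odd \<open>d\<close> forces \<open>4 dvd e\<close> when
  \<open>i\<close> is odd, so that every character value in the reflection identity is \<open>\<plusminus> chi4 d\<close>.\<close>

lemma chi4_divisor_sum_recurrence:
  fixes n :: int
  assumes "n mod 4 = 1" "n > 0"
  shows "(\<Sum>i | even i \<and> i\<^sup>2 < n. chi4_divisor_sum (n - i\<^sup>2)) =
    2 * (\<Sum>i | odd i \<and> i\<^sup>2 < n. chi4_divisor_sum (n - i\<^sup>2)) + (if \<exists>a. n = a\<^sup>2 then 1 else 0)"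
proof -
  define T where "T P = {(i, e, d). (i, e, d) \<in> factored_solutions n \<and> odd d \<and> P i}" for P
  have fini: "finite {i. P i \<and> i\<^sup>2 < n}" for P
    by (rule finite_subset[OF _ finite_square_le[of n]]) auto
  have eq: "(\<Sum>(i, e, d)\<in>T P. chi4 d) = (\<Sum>i | P i \<and> i\<^sup>2 < n. chi4_divisor_sum (n - i\<^sup>2))" for P
  proof -
    have "(\<Sum>i | P i \<and> i\<^sup>2 < n. chi4_divisor_sum (n - i\<^sup>2)) =
        (\<Sum>i | P i \<and> i\<^sup>2 < n. \<Sum>d | 0 < d \<and> d dvd n - i\<^sup>2 \<and> odd d. chi4 d)"
      unfolding chi4_divisor_sum_def
      by (intro sum.cong refl sum.mono_neutral_right) (auto simp: finite_divisors_pos)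
    also have "\<dots> = (\<Sum>(i, d)\<in>(SIGMA i:{i. P i \<and> i\<^sup>2 < n}. {d. 0 < d \<and> d dvd n - i\<^sup>2 \<and> odd d}). chi4 d)"
      by (rule sum.Sigma) (auto simp: fini intro!: finite_subset[OF _ finite_divisors_pos])
    also have "\<dots> = (\<Sum>(i, e, d)\<in>T P. chi4 d)"
    proof (rule sum.reindex_bij_witness[where j = "\<lambda>(i, d). (i, (n - i\<^sup>2) div d, d)" and i = "\<lambda>(i, e, d). (i, d)"], goal_cases)
      case (2 p)
      then obtain i d where p: "p = (i, d)" "0 < d" "d dvd n - i\<^sup>2" "odd d" "P i" "i\<^sup>2 < n" by (cases p) auto
      have "(n - i\<^sup>2) div d > 0" using p by (simp add: pos_imp_zdiv_pos_iff zdvd_imp_le)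
      then show ?case using p by (simp add: T_def factored_solutions_def)
    next
      case (4 p)
      then show ?case by (auto simp: T_def factored_solutions_def)
    qed (auto simp: T_def factored_solutions_def)
    finally show ?thesis by simp
  qed
  have finT: "finite (T P)" for P
    by (rule finite_subset[OF _ finite_factored_solutions[of n]]) (auto simp: T_def)
  have four: "even e \<longleftrightarrow> odd i" "odd i \<Longrightarrow> 4 dvd e" if "i\<^sup>2 + e * d = n" "odd d" for i e d
  proof -
    have "odd n" using assms(1) by presburger
    then show "even e \<longleftrightarrow> odd i" using that by (metis even_add even_mult_iff even_power pos2)
    assume "odd i"
    then obtain j where "i = 2 * j + 1" by (rule oddE)
    then have "e * d = n - 1 - 4 * (j\<^sup>2 + j)" using that by (simp add: power2_eq_square algebra_simps)
    moreover have "4 dvd n - 1" using assms(1) by presburger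
    ultimately have "4 dvd e * d" by (metis dvd_diff dvd_triv_left)
    moreover have "coprime 4 d" using \<open>odd d\<close> coprime_power_left_iff[of 2 2 d] by simp
    ultimately show "4 dvd e" by (simp add: coprime_dvd_mult_left_iff)
  qed
  have "(\<Sum>(i, e, d)\<in>T even. chi4 d) - (\<Sum>(i, e, d)\<in>T odd. chi4 d) =
      (\<Sum>(i, e, d)\<in>T even. chi4 (d - 2 * i)) + (\<Sum>(i, e, d)\<in>T odd. chi4 (d - 2 * i))"
    by (simp add: sum_negf[symmetric] diff_conv_add_uminus del: add_uminus_conv_diff)
       (intro arg_cong2[where f = "(+)"] sum.cong; auto simp: T_def factored_solutions_def chi4_shift_even chi4_shift_odd)
  also have "\<dots> = (\<Sum>(i, e, d)\<in>T even \<union> T odd. chi4 (d - 2 * i))"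
    by (rule sum.union_disjoint[symmetric]) (use finT in \<open>auto simp: T_def factored_solutions_def\<close>)
  also have "T even \<union> T odd = {(i, e, d). (i, e, d) \<in> factored_solutions n \<and> odd d}"
    by (auto simp: T_def)
  also note Liouville_reflection[OF assms]
  also have "{(i, e, d). (i, e, d) \<in> factored_solutions n \<and> odd d \<and> even e} = T odd"
    using four by (auto simp: T_def factored_solutions_def)
  also have "(\<Sum>(i, e, d)\<in>T odd. chi4 (e + d)) = (\<Sum>(i, e, d)\<in>T odd. chi4 d)"
    by (rule sum.cong) (use four(2) in \<open>auto simp: T_def factored_solutions_def chi4_add_4\<close>)
  finally show ?thesis unfolding eq by linarith
qed

lemma square_mod_4: "(x::int)\<^sup>2 mod 4 = (if even x then 0 else 1)"
proof (cases "even x")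
  case True
  then show ?thesis by (auto elim!: evenE simp: power2_eq_square)
next
  case False
  then obtain b where "x = 2 * b + 1" by (rule oddE)
  then have "x\<^sup>2 = 1 + 4 * (b\<^sup>2 + b)" by (simp add: power2_eq_square algebra_simps)
  then have "x\<^sup>2 mod 4 = 1 mod 4" by (simp only: mod_mult_self2)
  then show ?thesis using False by simp
qed

text \<open>The same recurrence holds for a quarter of the number of representations: both sides count
  solutions of \<open>i\<^sup>2 + a\<^sup>2 + b\<^sup>2 = n\<close>, in which exactly one of the three numbers is odd.\<close>

lemma two_square_reps_recurrence:
  fixes n :: int
  assumes "n mod 4 = 1" "n > 0"
  shows "(\<Sum>i | even i \<and> i\<^sup>2 \<le> n. int (card (two_square_reps (n - i\<^sup>2)))) =
    2 * (\<Sum>i | odd i \<and> i\<^sup>2 \<le> n. int (card (two_square_reps (n - i\<^sup>2))))"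
proof -
  define N where "N P = {(i, a, b::int). i\<^sup>2 + a\<^sup>2 + b\<^sup>2 = n \<and> P i a b}" for P
  have fini: "finite {i. P i \<and> i\<^sup>2 \<le> n}" for P
    by (rule finite_subset[OF _ finite_square_le[of n]]) auto
  have eq: "(\<Sum>i | P i \<and> i\<^sup>2 \<le> n. int (card (two_square_reps (n - i\<^sup>2)))) = int (card (N (\<lambda>i a b. P i)))" for P
  proof -
    have "N (\<lambda>i a b. P i) = (SIGMA i:{i. P i \<and> i\<^sup>2 \<le> n}. two_square_reps (n - i\<^sup>2))"
    proof (intro set_eqI iffI)
      fix p assume "p \<in> N (\<lambda>i a b. P i)"
      then obtain i a b where p: "p = (i, a, b)" "P i" "i\<^sup>2 + a\<^sup>2 + b\<^sup>2 = n" by (auto simp: N_def)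
      have "a\<^sup>2 \<ge> 0" "b\<^sup>2 \<ge> 0" by simp_all
      then have "i\<^sup>2 \<le> n" "a\<^sup>2 + b\<^sup>2 = n - i\<^sup>2" using p(3) by linarith+
      then show "p \<in> (SIGMA i:{i. P i \<and> i\<^sup>2 \<le> n}. two_square_reps (n - i\<^sup>2))"
        using p by (simp add: two_square_reps_def)
    qed (auto simp: N_def two_square_reps_def)
    then show ?thesis by (simp add: fini finite_two_square_reps)
  qed
  have finN: "finite (N P)" for P
  proof (rule finite_subset)
    show "N P \<subseteq> {i. i\<^sup>2 \<le> n} \<times> {i. i\<^sup>2 \<le> n} \<times> {i. i\<^sup>2 \<le> n}"
      by (auto simp: N_def)
  qed (simp add: finite_square_le)
  have one: "odd i \<and> even a \<and> even b \<or> even i \<and> odd a \<and> even b \<or> even i \<and> even a \<and> odd b"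
    if "i\<^sup>2 + a\<^sup>2 + b\<^sup>2 = n" for i a b :: int
  proof -
    have "(i\<^sup>2 mod 4 + a\<^sup>2 mod 4 + b\<^sup>2 mod 4) mod 4 = (i\<^sup>2 + a\<^sup>2 + b\<^sup>2) mod 4"
      by (metis mod_add_eq mod_add_left_eq mod_add_right_eq)
    also have "\<dots> = 1" unfolding that by (rule assms(1))
    finally show ?thesis unfolding square_mod_4
      by (cases "even i"; cases "even a"; cases "even b") simp_all
  qed
  have "N (\<lambda>i a b. even i) = N (\<lambda>i a b. odd a) \<union> N (\<lambda>i a b. odd b)" using one by (auto simp: N_def)
  moreover have "card (N (\<lambda>i a b. odd a) \<union> N (\<lambda>i a b. odd b)) = card (N (\<lambda>i a b. odd a)) + card (N (\<lambda>i a b. odd b))"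
    by (rule card_Un_disjoint[OF finN finN]) (use one in \<open>auto simp: N_def\<close>)
  moreover have "card (N (\<lambda>i a b. odd a)) = card (N (\<lambda>i a b. odd i))"
    by (rule bij_betw_same_card[where f = "\<lambda>(i, a, b). (a, i, b)"],
        rule bij_betw_byWitness[where f' = "\<lambda>(i, a, b). (a, i, b)"]) (auto simp: N_def)
  moreover have "card (N (\<lambda>i a b. odd b)) = card (N (\<lambda>i a b. odd i))"
    by (rule bij_betw_same_card[where f = "\<lambda>(i, a, b). (b, a, i)"],
        rule bij_betw_byWitness[where f' = "\<lambda>(i, a, b). (b, a, i)"]) (auto simp: N_def)
  ultimately show ?thesis unfolding eq by simp
qed

text \<open>Up to signs, \<open>(a, b) \<mapsto> (a + b, a - b)\<close> is multiplication by \<open>1 + \<i>\<close>, which doubles the norm of a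
  Gaussian integer; it is onto because a sum of two squares is even only if \<open>a + b\<close> is.\<close>

lemma two_square_reps_double: "card (two_square_reps (2 * m)) = card (two_square_reps m)"
proof -
  let ?f = "\<lambda>(a::int, b::int). (a + b, a - b)"
  have "two_square_reps (2 * m) = ?f ` two_square_reps m"
  proof (intro equalityI subsetI)
    fix p assume "p \<in> two_square_reps (2 * m)"
    then obtain a b where p: "p = (a, b)" "a\<^sup>2 + b\<^sup>2 = 2 * m" by (auto simp: two_square_reps_def)
    have "even (a\<^sup>2 + b\<^sup>2)" unfolding p(2) by simp
    then have "even (a + b)" by simp
    then obtain c where "a + b = 2 * c" by blast
    then have b: "b = 2 * c - a" by simp
    have "2 * (c\<^sup>2 + (a - c)\<^sup>2) = 2 * m"
      unfolding p(2)[symmetric] b by (simp add: power2_eq_square algebra_simps)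
    then have "c\<^sup>2 + (a - c)\<^sup>2 = m" by (rule mult_left_cancel[OF zero_neq_numeral[symmetric], THEN iffD1])
    then have "(c, a - c) \<in> two_square_reps m" unfolding two_square_reps_def by blast
    moreover have "p = ?f (c, a - c)" unfolding p(1) b prod.case by simp
    ultimately show "p \<in> ?f ` two_square_reps m" by (rule rev_image_eqI)
  next
    have "(a + b)\<^sup>2 + (a - b)\<^sup>2 = 2 * (a\<^sup>2 + b\<^sup>2)" for a b :: int
      by (simp add: power2_eq_square algebra_simps)
    then show "p \<in> two_square_reps (2 * m)" if "p \<in> ?f ` two_square_reps m" for p
      using that by (auto simp only: two_square_reps_def prod.case mem_Collect_eq)
  qed
  moreover have inj: "inj ?f" by (auto simp: inj_on_def; linarith)
  ultimately show ?thesis by (simp only: card_image[OF inj_on_subset[OF inj subset_UNIV]])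
qed

lemma chi4_divisor_sum_double: "m > 0 \<Longrightarrow> chi4_divisor_sum (2 * m) = chi4_divisor_sum m"
proof -
  assume m: "m > 0"
  have "chi4_divisor_sum (2 * m) = (\<Sum>d | 0 < d \<and> d dvd m \<and> odd d. chi4 d)"
    unfolding chi4_divisor_sum_def
  proof (rule sum.mono_neutral_right)
    have "d dvd m" if "odd d" "d dvd 2 * m" for d
      using that by (metis coprime_dvd_mult_right_iff coprime_right_2_iff_odd)
    then show "\<forall>d\<in>{d. 0 < d \<and> d dvd 2 * m} - {d. 0 < d \<and> d dvd m \<and> odd d}. chi4 d = 0"
      by (blast intro: chi4_even)
  qed (use m in \<open>auto simp: finite_divisors_pos\<close>)
  also have "\<dots> = chi4_divisor_sum m"
    unfolding chi4_divisor_sum_def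
    by (rule sum.mono_neutral_left) (use m in \<open>auto simp: finite_divisors_pos\<close>)
  finally show ?thesis .
qed

text \<open>Complementary divisors \<open>d\<close> and \<open>m div d\<close> lie in different odd classes modulo 4, so that their
  contributions cancel.\<close>

lemma chi4_divisor_sum_3_mod_4:
  assumes "m mod 4 = 3" "m > 0" shows "chi4_divisor_sum m = 0"
proof -
  let ?D = "{d. 0 < d \<and> d dvd m}"
  have D: "m div d \<in> ?D" "m div (m div d) = d" "chi4 (m div d) = - chi4 d" if "d \<in> ?D" for d
  proof -
    from that obtain e where e: "m = d * e" "d > 0" by (auto elim: dvdE)
    then have "e > 0" using assms(2) by (simp add: zero_less_mult_iff)
    then show "m div d \<in> ?D" "m div (m div d) = d" using e by simp_all
    have "chi4 d + chi4 e = 0" using assms(1) unfolding e(1) by (rule chi4_mult_3_mod_4)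
    then show "chi4 (m div d) = - chi4 d" using e by simp
  qed
  have "(\<Sum>d\<in>?D. chi4 d) = (\<Sum>d\<in>?D. - chi4 d)"
    by (rule sum.reindex_bij_witness[where i = "\<lambda>d. m div d" and j = "\<lambda>d. m div d"])
       (simp_all only: D minus_minus)
  then show ?thesis by (simp add: sum_negf chi4_divisor_sum_def)
qed

lemma two_square_reps_3_mod_4:
  assumes "m mod 4 = 3" shows "two_square_reps m = {}"
proof -
  have "a\<^sup>2 + b\<^sup>2 \<noteq> m" for a b
  proof
    assume "a\<^sup>2 + b\<^sup>2 = m"
    then have "(a\<^sup>2 mod 4 + b\<^sup>2 mod 4) mod 4 = 3" using assms by (simp only: mod_add_eq)
    then show False unfolding square_mod_4 by (cases "even a"; cases "even b") simp_all
  qed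
  then show ?thesis by (auto simp: two_square_reps_def)
qed

text \<open>Even numbers are halved, both sides vanish for numbers congruent to 3 modulo 4, and in the remaining class the common recurrence expresses the value at \<open>n\<close>, its
  term for \<open>i = 0\<close>, through values at smaller numbers.\<close>

theorem Jacobi_two_squares:
  fixes n :: int
  assumes "n > 0"
  shows "int (card (two_square_reps n)) = 4 * chi4_divisor_sum n"
  using assms
proof (induction "nat n" arbitrary: n rule: less_induct)
  case less
  have IH: "int (card (two_square_reps m)) = 4 * chi4_divisor_sum m" if "0 < m" "m < n" for m
    using less.hyps[of m] that by simp
  obtain q where "n = 4 * q \<or> n = 4 * q + 1 \<or> n = 4 * q + 2 \<or> n = 4 * q + 3" by (rule mod_4_cases)
  then have "even n \<or> n mod 4 = 1 \<or> n mod 4 = 3" by (elim disjE) simp_all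
  then consider m where "n = 2 * m" | "n mod 4 = 1" | "n mod 4 = 3" by blast
  then show ?case
  proof cases
    case (1 m)
    then have m: "0 < m" "m < n" using less.prems by linarith+
    show ?thesis
      unfolding 1 two_square_reps_double chi4_divisor_sum_double[OF m(1)] by (rule IH[OF m])
  next
    case 3
    show ?thesis
      unfolding two_square_reps_3_mod_4[OF 3] chi4_divisor_sum_3_mod_4[OF 3 less.prems] by simp
  next
    case 2
    let ?r = "\<lambda>m. int (card (two_square_reps m))" and ?\<rho> = chi4_divisor_sum
    let ?E = "\<lambda>f :: int \<Rightarrow> int. \<Sum>i | (even i \<and> i \<noteq> 0) \<and> i\<^sup>2 < n. f (n - i\<^sup>2)"
      and ?O = "\<lambda>f :: int \<Rightarrow> int. \<Sum>i | odd i \<and> i\<^sup>2 < n. f (n - i\<^sup>2)"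
    \<comment> \<open>If \<open>n = a\<^sup>2\<close>, the terms \<open>i = \<plusminus>a\<close> of the recurrence for the representations are 1; twice their
      sum is 4 times the extra summand of the recurrence for the divisor sums.\<close>
    define s :: int where "s = (if \<exists>a. n = a\<^sup>2 then 1 else 0)"
    have fini: "finite {i. P i \<and> i\<^sup>2 < n}" for P
      by (rule finite_subset[OF _ finite_square_le[of n]]) auto
    have odd_n: "odd n" using 2 by presburger
    have split0: "(\<Sum>i | even i \<and> i\<^sup>2 < n. f (n - i\<^sup>2)) = f n + ?E f"
      for f :: "int \<Rightarrow> int"
    proof -
      have "{i. even i \<and> i\<^sup>2 < n} = insert 0 {i. (even i \<and> i \<noteq> 0) \<and> i\<^sup>2 < n}"
        using less.prems by auto
      then show ?thesis using fini[of "\<lambda>i. even i \<and> i \<noteq> 0"] by simp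
    qed
    have IHsum: "(\<Sum>i | P i \<and> i\<^sup>2 < n. ?r (n - i\<^sup>2)) = 4 * (\<Sum>i | P i \<and> i\<^sup>2 < n. ?\<rho> (n - i\<^sup>2))"
      if "\<And>i. P i \<Longrightarrow> i \<noteq> 0" for P
      unfolding sum_distrib_left by (rule sum.cong) (use that in \<open>auto intro!: IH\<close>)
    have sq: "(\<Sum>i | odd i \<and> i\<^sup>2 \<le> n. ?r (n - i\<^sup>2)) = ?O ?r + 2 * s"
    proof -
      have "{i. odd i \<and> i\<^sup>2 \<le> n} = {i. odd i \<and> i\<^sup>2 < n} \<union> {i. n = i\<^sup>2}"
        using odd_n by auto
      then have "(\<Sum>i | odd i \<and> i\<^sup>2 \<le> n. ?r (n - i\<^sup>2)) = ?O ?r + (\<Sum>i | n = i\<^sup>2. ?r (n - i\<^sup>2))"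
        by (simp only:) (rule sum.union_disjoint,
            auto simp: fini intro!: finite_subset[OF _ finite_square_le[of n]])
      also have "(\<Sum>i | n = i\<^sup>2. ?r (n - i\<^sup>2)) = (\<Sum>i | n = i\<^sup>2. 1)"
      proof (rule sum.cong)
        have "two_square_reps 0 = {(0, 0)}" by (auto simp: two_square_reps_def)
        then show "?r (n - i\<^sup>2) = 1" if "i \<in> {i. n = i\<^sup>2}" for i using that by simp
      qed simp
      also have "\<dots> = 2 * s"
      proof (cases "\<exists>a. n = a\<^sup>2")
        case True
        then obtain a where a: "n = a\<^sup>2" by blast
        then have "a \<noteq> 0" using less.prems by auto
        have "{i. n = i\<^sup>2} = {a, - a}" using a by (auto simp: power2_eq_iff)
        then show ?thesis using True \<open>a \<noteq> 0\<close> by (simp add: s_def)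
      qed (simp add: s_def)
      finally show ?thesis .
    qed
    have E: "{i. even i \<and> i\<^sup>2 \<le> n} = {i. even i \<and> i\<^sup>2 < n}" using odd_n by (auto simp: order_le_less)
    have "?r n + ?E ?r = 2 * ?O ?r + 4 * s"
    proof -
      have "r + e = 2 * y + 4 * s" if "x = 2 * (y + 2 * s)" "x = r + e" for x y r e :: int
        using that by simp
      from this[OF two_square_reps_recurrence[OF 2 less.prems, unfolded sq E] split0[of ?r]] show ?thesis .
    qed
    moreover have "?\<rho> n + ?E ?\<rho> = 2 * ?O ?\<rho> + s"
      using chi4_divisor_sum_recurrence[OF 2 less.prems] split0[of ?\<rho>]
      unfolding s_def[symmetric] by linarith
    moreover have "?O ?r = 4 * ?O ?\<rho>" by (rule IHsum) auto
    moreover have "?E ?r = 4 * ?E ?\<rho>" by (rule IHsum) auto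
    ultimately show ?thesis by linarith
  qed
qed

section \<open>The zeta function of the square lattice\<close>

lemma has_sum_product:
  fixes f :: "'i \<Rightarrow> real" and g :: "'j \<Rightarrow> real"
  assumes "(f has_sum a) A" "(g has_sum b) B" "(\<lambda>x. norm (f x)) summable_on A" "(\<lambda>y. norm (g y)) summable_on B"
  shows "((\<lambda>(x, y). f x * g y) has_sum (a * b)) (A \<times> B)"
proof (rule has_sum_SigmaI)
  show "((\<lambda>y. case (x, y) of (x, y) \<Rightarrow> f x * g y) has_sum (f x * b)) B" for x
    using has_sum_cmult_right[OF assms(2)] by simp
  show "((\<lambda>x. f x * b) has_sum a * b) A"
    by (rule has_sum_cmult_left[OF assms(1)])
  have "(\<lambda>p. norm (case p of (x, y) \<Rightarrow> f x * g y)) summable_on (A \<times> B)"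
  proof (rule summable_on_SigmaI)
    show "((\<lambda>y. norm (case (x, y) of (x, y) \<Rightarrow> f x * g y)) has_sum (norm (f x) * (\<Sum>\<^sub>\<infinity>y\<in>B. norm (g y)))) B" for x
      using has_sum_cmult_right[OF has_sum_infsum[OF assms(4)]] by (simp add: abs_mult)
    show "(\<lambda>x. norm (f x) * (\<Sum>\<^sub>\<infinity>y\<in>B. norm (g y))) summable_on A"
      by (rule summable_on_cmult_left[OF assms(3)])
  qed simp
  then show "(\<lambda>(x, y). f x * g y) summable_on (A \<times> B)"
    by (rule abs_summable_summable)
qed

lemma summable_inverse_power_Suc:
  assumes "n \<ge> 2" shows "summable (\<lambda>j. 1 / real (Suc j) ^ n)"
  using inverse_power_summable[OF assms, where ?'a = real] summable_Suc_iff[of "\<lambda>j. inverse (real j ^ n)"]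
  by (simp add: inverse_eq_divide)

lemma zeta_nat_has_sum:
  assumes "n \<ge> 2"
  shows "((\<lambda>j. 1 / real (Suc j) ^ n) has_sum zeta_nat n) UNIV" "(\<lambda>j. norm (1 / real (Suc j) ^ n)) summable_on UNIV"
proof -
  note s = summable_inverse_power_Suc[OF assms]
  show "((\<lambda>j. 1 / real (Suc j) ^ n) has_sum zeta_nat n) UNIV"
    unfolding zeta_nat_def using s by (intro norm_summable_imp_has_sum) (auto simp: summable_sums)
  show "(\<lambda>j. norm (1 / real (Suc j) ^ n)) summable_on UNIV"
    using s by (intro norm_summable_imp_summable_on) auto
qed

lemma beta_nat_has_sum:
  assumes "n \<ge> 2"
  shows "((\<lambda>m. (- 1) ^ m / real (2 * m + 1) ^ n) has_sum beta_nat n) UNIV"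
    "(\<lambda>m. norm ((- 1) ^ m / real (2 * m + 1) ^ n)) summable_on UNIV"
proof -
  have s: "summable (\<lambda>m. norm ((- 1) ^ m / real (2 * m + 1) ^ n))"
  proof (rule summable_comparison_test'[OF summable_inverse_power_Suc[OF assms], of 0])
    fix m :: nat
    have "real (Suc m) ^ n \<le> real (2 * m + 1) ^ n" by (rule power_mono) auto
    then show "norm (norm ((- 1) ^ m / real (2 * m + 1) ^ n)) \<le> 1 / real (Suc m) ^ n"
      by (simp add: power_abs frac_le)
  qed
  show "((\<lambda>m. (- 1) ^ m / real (2 * m + 1) ^ n) has_sum beta_nat n) UNIV"
    unfolding beta_nat_def using s
    by (intro norm_summable_imp_has_sum) (auto simp: summable_norm_cancel summable_sums)
  show "(\<lambda>m. norm ((- 1) ^ m / real (2 * m + 1) ^ n)) summable_on UNIV"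
    using s by (intro norm_summable_imp_summable_on) auto
qed

lemma chi4_odd_nat: "chi4 (2 * int m + 1) = (- 1) ^ m"
proof (induction m)
  case 0
  then show ?case by (simp add: chi4_def)
next
  case (Suc m)
  have "chi4 (2 * int (Suc m) + 1) = - chi4 (2 * int (Suc m) + 1 - 2)" by (simp only: chi4_diff_2 minus_minus)
  also have "2 * int (Suc m) + 1 - 2 = 2 * int m + 1" by simp
  finally show ?case using Suc by simp
qed

text \<open>Sorting the terms of \<open>zeta_nat n * beta_nat n\<close>, a double series over pairs \<open>(d, e)\<close>, by the product
  \<open>d * e\<close> gives the Dirichlet series of the divisor sum.\<close>

lemma chi4_divisor_sum_Dirichlet_series:
  assumes "n \<ge> 2"
  shows "((\<lambda>m. chi4_divisor_sum m / of_int m ^ n) has_sum zeta_nat n * beta_nat n) {0<..}"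
proof -
  let ?h = "\<lambda>(d, e). of_int (chi4 d) / (of_int d * of_int e) ^ n :: real"
  let ?D = "SIGMA m:{0<..}. {d. 0 < d \<and> d dvd m}"
  have "((\<lambda>(m, j). ((- 1) ^ m / real (2 * m + 1) ^ n) * (1 / real (Suc j) ^ n)) has_sum
      (beta_nat n * zeta_nat n)) (UNIV \<times> UNIV)"
    by (rule has_sum_product[OF beta_nat_has_sum(1)[OF assms] zeta_nat_has_sum(1)[OF assms]
          beta_nat_has_sum(2)[OF assms] zeta_nat_has_sum(2)[OF assms]])
  also have "?this \<longleftrightarrow> (?h has_sum (beta_nat n * zeta_nat n)) {(d, e). odd d \<and> d > 0 \<and> e > 0}"
  proof (rule has_sum_reindex_bij_witness[where j = "\<lambda>(m, j). (2 * int m + 1, int j + 1)"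
        and i = "\<lambda>(d, e). (nat ((d - 1) div 2), nat (e - 1))"], goal_cases)
    case (3 p)
    then show ?case by (auto elim!: oddE)
  next
    case (5 p)
    have "real_of_int (chi4 (2 * int m + 1)) = (- 1) ^ m" for m by (simp add: chi4_odd_nat)
    then show ?case by (cases p) (simp add: power_mult_distrib add.commute)
  qed auto
  also have "\<dots> \<longleftrightarrow> (?h has_sum (beta_nat n * zeta_nat n)) {(d, e). d > 0 \<and> e > 0}"
    by (rule has_sum_cong_neutral) auto
  also have "\<dots> \<longleftrightarrow> ((\<lambda>(m, d). of_int (chi4 d) / of_int m ^ n) has_sum (beta_nat n * zeta_nat n)) ?D"
    by (rule has_sum_reindex_bij_witness[where j = "\<lambda>(d, e). (d * e, d)" and i = "\<lambda>(m, d). (d, m div d)"])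
       (auto simp: pos_imp_zdiv_pos_iff zdvd_imp_le)
  finally have "((\<lambda>(m, d). of_int (chi4 d) / of_int m ^ n :: real) has_sum (beta_nat n * zeta_nat n)) ?D" .
  then have "((\<lambda>m. chi4_divisor_sum m / of_int m ^ n) has_sum (beta_nat n * zeta_nat n)) {0<..}"
  proof (rule has_sum_SigmaD)
    fix m :: int assume "m \<in> {0<..}"
    then show "((\<lambda>d. case (m, d) of (m, d) \<Rightarrow> of_int (chi4 d) / of_int m ^ n) has_sum
        chi4_divisor_sum m / of_int m ^ n) {d. 0 < d \<and> d dvd m}"
      by (intro has_sum_finiteI) (auto simp: finite_divisors_pos chi4_divisor_sum_def sum_divide_distrib)
  qed
  then show ?thesis by (simp add: mult.commute)
qed

text \<open>Jacobi's theorem turns the Dirichlet series of the divisor sum into the sum over lattice points,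
  grouped by the value of \<open>a\<^sup>2 + b\<^sup>2\<close>.  All terms being nonnegative, the grouping can be undone.\<close>

theorem square_lattice_zeta:
  assumes "n \<ge> 2"
  shows "((\<lambda>(a, b). 1 / real_of_int (a\<^sup>2 + b\<^sup>2) ^ n) has_sum 4 * zeta_nat n * beta_nat n) (- {(0, 0)})"
proof -
  let ?S = "SIGMA m:{0<..}. two_square_reps m"
  have "((\<lambda>m. 4 * (chi4_divisor_sum m / of_int m ^ n)) has_sum (4 * (zeta_nat n * beta_nat n))) {0<..}"
    by (intro has_sum_cmult_right chi4_divisor_sum_Dirichlet_series assms)
  also have "?this \<longleftrightarrow> ((\<lambda>m. real (card (two_square_reps m)) / of_int m ^ n) has_sum (4 * (zeta_nat n * beta_nat n))) {0<..}"
  proof (rule has_sum_cong)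
    fix m :: int assume "m \<in> {0<..}"
    then have "real_of_int (int (card (two_square_reps m))) = real_of_int (4 * chi4_divisor_sum m)"
      using Jacobi_two_squares[of m] by simp
    then show "4 * (chi4_divisor_sum m / of_int m ^ n) = real (card (two_square_reps m)) / of_int m ^ n"
      by simp
  qed
  finally have outer: "((\<lambda>m. real (card (two_square_reps m)) / of_int m ^ n) has_sum (4 * (zeta_nat n * beta_nat n))) {0<..}" .
  have inner: "((\<lambda>p. case (m, p) of (m, p) \<Rightarrow> 1 / real_of_int m ^ n) has_sum
      real (card (two_square_reps m)) / of_int m ^ n) (two_square_reps m)" for m
    by (intro has_sum_finiteI) (auto simp: finite_two_square_reps)
  have "(\<lambda>(m, p). 1 / real_of_int m ^ n) summable_on ?S"
    by (rule summable_on_SigmaI[OF inner has_sum_imp_summable[OF outer]]) auto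
  with inner outer have "((\<lambda>(m, p). 1 / real_of_int m ^ n) has_sum (4 * (zeta_nat n * beta_nat n))) ?S"
    by (intro has_sum_SigmaI)
  also have "?this \<longleftrightarrow> ((\<lambda>(a, b). 1 / real_of_int (a\<^sup>2 + b\<^sup>2) ^ n) has_sum (4 * zeta_nat n * beta_nat n)) (- {(0, 0)})"
    by (rule has_sum_reindex_bij_witness[where j = "\<lambda>(m, p). p" and i = "\<lambda>(a, b). (a\<^sup>2 + b\<^sup>2, a, b)"])
       (auto simp: two_square_reps_def sum_power2_gt_zero_iff)
  finally show ?thesis .
qed

section \<open>Integration over the torus\<close>

text \<open>The representative in \<open>[0, 2\<pi>)\<close>.  The quotient map's own choice of representatives,
  \<open>rep_circle\<close>, is arbitrary and might fail to be measurable.\<close>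
definition circle_coord :: "circle \<Rightarrow> real"
  where "circle_coord c = rep_circle c - 2 * pi * of_int \<lfloor>rep_circle c / (2 * pi)\<rfloor>"

definition torus_coord :: "torus \<Rightarrow> real \<times> real"
  where "torus_coord = map_prod circle_coord circle_coord"

abbreviation period_interval :: "real measure"
  where "period_interval \<equiv> restrict_space lborel {0..<2 * pi}"

abbreviation period_square :: "(real \<times> real) measure"
  where "period_square \<equiv> period_interval \<Otimes>\<^sub>M period_interval"

lemma circle_coord_to_circle: "circle_coord (to_circle x) = x - 2 * pi * of_int \<lfloor>x / (2 * pi)\<rfloor>"
proof -
  let ?r = "rep_circle (to_circle x)"
  have "to_circle ?r = to_circle x" by (simp add: Quotient_abs_rep[OF Quotient_circle])
  then obtain k :: int where k: "?r = x + 2 * pi * of_int k" by (auto simp: to_circle_eq_iff algebra_simps)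
  have "?r / (2 * pi) = x / (2 * pi) + of_int k" unfolding k by (simp add: field_simps)
  then have "\<lfloor>?r / (2 * pi)\<rfloor> = \<lfloor>x / (2 * pi)\<rfloor> + k" by simp
  then show ?thesis unfolding circle_coord_def by (simp add: k algebra_simps)
qed

lemma to_circle_circle_coord [simp]: "to_circle (circle_coord c) = c"
proof -
  have "to_circle (circle_coord c) = to_circle (rep_circle c)"
    unfolding to_circle_eq_iff circle_coord_def by (rule exI[of _ "- \<lfloor>rep_circle c / (2 * pi)\<rfloor>"]) simp
  then show ?thesis by (simp add: Quotient_abs_rep[OF Quotient_circle])
qed

lemma circle_coord_bounds: "0 \<le> circle_coord c" "circle_coord c < 2 * pi"
proof -
  let ?t = "rep_circle c / (2 * pi)"
  have "circle_coord c = 2 * pi * (?t - of_int \<lfloor>?t\<rfloor>)" by (simp add: circle_coord_def field_simps)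
  moreover have "0 \<le> ?t - of_int \<lfloor>?t\<rfloor>" "?t - of_int \<lfloor>?t\<rfloor> < 1" by linarith+
  ultimately show "0 \<le> circle_coord c" "circle_coord c < 2 * pi"
    using mult_strict_left_mono[of "?t - of_int \<lfloor>?t\<rfloor>" 1 "2 * pi"] by simp_all
qed

lemma to_torus_torus_coord [simp]: "to_torus (torus_coord p) = p"
  by (cases p) (simp add: to_torus_def torus_coord_def)

lemma space_torus_measure [simp]: "space torus_measure = UNIV"
  by (simp add: torus_measure_def space_pair_measure)

lemma measurable_to_circle [measurable]: "to_circle \<in> measurable period_interval circle_measure"
proof (rule measurableI)
  fix A assume "A \<in> sets circle_measure"
  then have "to_circle -` A \<in> sets borel" by (simp add: sets_circle_measure)
  then show "to_circle -` A \<inter> space period_interval \<in> sets period_interval"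
    by (auto simp: space_restrict_space sets_restrict_space)
qed simp

lemma measurable_circle_coord [measurable]: "circle_coord \<in> borel_measurable circle_measure"
proof (rule measurableI)
  fix A :: "real set" assume A: "A \<in> sets borel"
  have "to_circle -` (circle_coord -` A) = (\<lambda>x. x - 2 * pi * of_int \<lfloor>x / (2 * pi)\<rfloor>) -` A"
    by (auto simp: circle_coord_to_circle)
  also have "\<dots> \<in> sets borel"
    using A by (auto intro!: measurable_sets_borel[of _ borel])
  finally show "circle_coord -` A \<inter> space circle_measure \<in> sets circle_measure"
    by (simp add: sets_circle_measure)
qed simp

lemma measurable_torus_coord [measurable]: "torus_coord \<in> measurable torus_measure borel"
proof -
  have eq: "torus_coord = (\<lambda>p. (circle_coord (fst p), circle_coord (snd p)))"
    by (auto simp: torus_coord_def map_prod_def split_beta)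
  show ?thesis
    unfolding eq torus_measure_def borel_prod[symmetric] by measurable
qed

text \<open>The coordinates are a measurable section of the covering map, so measurability can be tested on the
  lift to the plane.\<close>

lemma borel_measurable_torusI:
  fixes f :: "torus \<Rightarrow> 'b::topological_space"
  assumes "f \<circ> to_torus \<in> borel_measurable borel"
  shows "f \<in> borel_measurable torus_measure"
proof -
  have "(f \<circ> to_torus) \<circ> torus_coord \<in> borel_measurable torus_measure"
    by (rule measurable_comp[OF measurable_torus_coord assms])
  then show ?thesis by (simp add: comp_def)
qed

lemma circle_measure_distr: "circle_measure = distr period_interval circle_measure to_circle"
  by (subst circle_measure_def, rule distr_cong) (simp_all add: circle_measure_def)

lemma finite_measure_period_interval: "finite_measure period_interval"
  by (rule finite_measureI) (simp add: space_restrict_space emeasure_restrict_space)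

lemma finite_measure_circle_measure: "finite_measure circle_measure"
  using finite_measure.finite_measure_distr[OF finite_measure_period_interval measurable_to_circle]
  by (simp add: circle_measure_distr[symmetric])

lemma torus_measure_distr:
  "torus_measure = distr period_square torus_measure to_torus"
proof -
  have "sigma_finite_measure (distr period_interval circle_measure to_circle)"
    using finite_measure.axioms(1)[OF finite_measure_circle_measure] by (simp add: circle_measure_distr[symmetric])
  from pair_measure_distr[OF measurable_to_circle measurable_to_circle this]
  show ?thesis
    by (simp add: circle_measure_distr[symmetric] torus_measure_def to_torus_def map_prod_def)
qed

lemma measurable_to_torus [measurable]:
  "to_torus \<in> measurable period_square torus_measure"
proof -
  have eq: "to_torus = (\<lambda>z. (to_circle (fst z), to_circle (snd z)))"
    by (auto simp: to_torus_def map_prod_def split_beta)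
  show ?thesis unfolding eq torus_measure_def by measurable
qed

lemma integral_torus:
  fixes f :: "torus \<Rightarrow> 'b::{banach, second_countable_topology}"
  assumes "f \<in> borel_measurable torus_measure"
  shows "integral\<^sup>L torus_measure f = integral\<^sup>L period_square (\<lambda>z. f (to_torus z))"
  by (subst torus_measure_distr, rule integral_distr) (use assms in simp_all)

interpretation torus: finite_measure torus_measure
proof -
  interpret C: finite_measure circle_measure by (rule finite_measure_circle_measure)
  show "finite_measure torus_measure" unfolding torus_measure_def by (rule finite_measure_pair_measure) unfold_locales
qed

interpretation period_pair: pair_sigma_finite period_interval period_interval
proof -
  interpret P: finite_measure period_interval by (rule finite_measure_period_interval)
  show "pair_sigma_finite period_interval period_interval" by unfold_locales
qed

lemma measure_torus: "measure torus_measure UNIV = (2 * pi)\<^sup>2"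
proof -
  have "emeasure circle_measure UNIV = ennreal (2 * pi)"
    by (subst emeasure_circle_measure) auto
  moreover interpret C: finite_measure circle_measure by (rule finite_measure_circle_measure)
  have "emeasure torus_measure (UNIV \<times> UNIV) = emeasure circle_measure UNIV * emeasure circle_measure UNIV"
    unfolding torus_measure_def
    by (rule C.emeasure_pair_measure_Times) (simp_all add: sets_circle_measure)
  ultimately show ?thesis
    by (simp add: measure_def power2_eq_square ennreal_mult[symmetric])
qed

lemma to_torus_shift:
  "to_torus (x + 2 * pi * of_int k, y + 2 * pi * of_int l) = to_torus (x, y)"
  unfolding to_torus_def by (auto simp: to_circle_eq_iff)

text \<open>Every value is attained over a compact square.  This plays the role of the compactness of the torus.\<close>

lemma range_lift_torus: "range f = (\<lambda>z. f (to_torus z)) ` ({0..2 * pi} \<times> {0..2 * pi})"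
proof
  show "range f \<subseteq> (\<lambda>z. f (to_torus z)) ` ({0..2 * pi} \<times> {0..2 * pi})"
  proof
    fix y assume "y \<in> range f"
    then obtain p where y: "y = f p" by (rule rangeE)
    have "torus_coord p \<in> {0..2 * pi} \<times> {0..2 * pi}"
      using circle_coord_bounds(1) circle_coord_bounds(2)[THEN less_imp_le] by (cases p) (simp add: torus_coord_def)
    then show "y \<in> (\<lambda>z. f (to_torus z)) ` ({0..2 * pi} \<times> {0..2 * pi})"
      by (rule rev_image_eqI) (simp add: y)
  qed
qed auto

lemma continuous_torus_bounded:
  fixes f :: "torus \<Rightarrow> 'a::real_normed_vector"
  assumes "continuous_on UNIV (f \<circ> to_torus)"
  obtains B where "\<And>p. norm (f p) \<le> B"
proof -
  have "continuous_on ({0..2 * pi} \<times> {0..2 * pi}) (\<lambda>z. f (to_torus z))"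
    using continuous_on_subset[OF assms subset_UNIV] by (simp add: comp_def)
  moreover have "compact ({0..2 * pi} \<times> {0..2 * pi})" by (intro compact_Times compact_Icc)
  ultimately have "compact (range f)"
    unfolding range_lift_torus by (rule compact_continuous_image)
  then obtain B where "\<forall>y\<in>range f. norm y \<le> B"
    using compact_imp_bounded[of "range f"] unfolding bounded_iff by blast
  then show ?thesis using that[of B] by blast
qed

lemma continuous_torus_measurable:
  fixes f :: "torus \<Rightarrow> 'a::topological_space"
  assumes "continuous_on UNIV (f \<circ> to_torus)"
  shows "f \<in> borel_measurable torus_measure"
  by (intro borel_measurable_torusI borel_measurable_continuous_onI assms)

lemma bounded_square_integrable:
  fixes f :: "torus \<Rightarrow> 'a::euclidean_space"
  assumes "f \<in> borel_measurable torus_measure" "\<And>p. norm (f p) \<le> B"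
  shows "square_integrable f"
  unfolding square_integrable_def
proof (intro conjI assms(1) torus.integrable_const_bound[where B = "B\<^sup>2"] AE_I2)
  fix p show "norm ((norm (f p))\<^sup>2) \<le> B\<^sup>2" using power_mono[OF assms(2), of p 2] by simp
qed (use assms(1) in measurable)

lemma continuous_square_integrable:
  fixes f :: "torus \<Rightarrow> 'a::euclidean_space"
  assumes "continuous_on UNIV (f \<circ> to_torus)"
  shows "square_integrable f"
  using continuous_torus_bounded[OF assms] bounded_square_integrable[OF continuous_torus_measurable[OF assms]]
  by metis

lemma continuous_torus_integrable:
  fixes f :: "torus \<Rightarrow> 'a::euclidean_space"
  assumes "continuous_on UNIV (f \<circ> to_torus)"
  shows "integrable torus_measure f"
proof -
  obtain B where "\<And>p. norm (f p) \<le> B" using continuous_torus_bounded[OF assms] by blast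
  then show ?thesis
    by (intro torus.integrable_const_bound[where B = B] AE_I2 continuous_torus_measurable assms)
qed

section \<open>Differential calculus on the torus\<close>

lemma lift_has_derivative:
  assumes "(f \<circ> to_torus) differentiable_on UNIV"
  shows "(f \<circ> to_torus has_derivative (\<lambda>v. torus_deriv v f (to_torus x))) (at x)"
proof -
  have "(f \<circ> to_torus has_derivative frechet_derivative (f \<circ> to_torus) (at x)) (at x)"
    using assms unfolding differentiable_on_def frechet_derivative_works[symmetric] by blast
  then show ?thesis by (simp add: torus_deriv_to_torus)
qed

lemma torus_derivI:
  assumes "(f \<circ> to_torus has_derivative D) (at x)"
  shows "torus_deriv v f (to_torus x) = D v"
  unfolding torus_deriv_to_torus frechet_derivative_at[OF assms, symmetric] by simp

lemma torus_deriv_eqI: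
  assumes "\<And>x. (f \<circ> to_torus has_derivative (\<lambda>v. D v (to_torus x))) (at x)"
  shows "torus_deriv v f = D v"
proof
  fix p
  show "torus_deriv v f p = D v p" using torus_derivI[OF assms, of v "torus_coord p"] by simp
qed

lemma torus_deriv_linear:
  assumes "(f \<circ> to_torus) differentiable_on UNIV" "(g \<circ> to_torus) differentiable_on UNIV"
  shows "torus_deriv v (\<lambda>p. a * f p + b * g p) = (\<lambda>p. a * torus_deriv v f p + b * torus_deriv v g p)"
proof (rule torus_deriv_eqI[where D = "\<lambda>v p. a * torus_deriv v f p + b * torus_deriv v g p"])
  fix x
  show "((\<lambda>p. a * f p + b * g p) \<circ> to_torus has_derivative
      (\<lambda>v. a * torus_deriv v f (to_torus x) + b * torus_deriv v g (to_torus x))) (at x)"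
    using lift_has_derivative[OF assms(1), of x] lift_has_derivative[OF assms(2), of x]
    unfolding comp_def by (intro has_derivative_add has_derivative_mult_right)
qed

lemma torus_deriv_mult:
  assumes "(f \<circ> to_torus) differentiable_on UNIV" "(g \<circ> to_torus) differentiable_on UNIV"
  shows "torus_deriv v (\<lambda>p. f p * g p) = (\<lambda>p. f p * torus_deriv v g p + torus_deriv v f p * g p)"
proof (rule torus_deriv_eqI[where D = "\<lambda>v p. f p * torus_deriv v g p + torus_deriv v f p * g p"])
  fix x
  show "((\<lambda>p. f p * g p) \<circ> to_torus has_derivative
      (\<lambda>v. f (to_torus x) * torus_deriv v g (to_torus x) + torus_deriv v f (to_torus x) * g (to_torus x))) (at x)"
    using has_derivative_mult[OF lift_has_derivative[OF assms(1), of x] lift_has_derivative[OF assms(2), of x]]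
    unfolding comp_def .
qed

lemma torus_deriv_const: "torus_deriv v (\<lambda>p. c) = (\<lambda>p. 0)"
  by (rule torus_deriv_eqI[where D = "\<lambda>v p. 0"]) (simp add: comp_def)

lemma torus_Ck_linear:
  "torus_Ck k f \<Longrightarrow> torus_Ck k g \<Longrightarrow> torus_Ck k (\<lambda>p. a * f p + b * g p)"
proof (induction k arbitrary: f g)
  case 0
  then show ?case by (simp add: comp_def) (intro continuous_intros)
next
  case (Suc k)
  then show ?case
    by (simp add: torus_deriv_linear) (auto simp: comp_def intro!: derivative_intros)
qed

lemma torus_Ck_const: "torus_Ck k (\<lambda>p. c)"
  by (induction k arbitrary: c) (simp_all add: comp_def torus_deriv_const)

lemma torus_smooth_linear:
  "torus_smooth f \<Longrightarrow> torus_smooth g \<Longrightarrow> torus_smooth (\<lambda>p. a * f p + b * g p)"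
  by (simp add: torus_smooth_def torus_Ck_linear)

lemma torus_smooth_const: "torus_smooth (\<lambda>p. c)"
  by (simp add: torus_smooth_def torus_Ck_const)

lemma torus_smooth_diff: "torus_smooth f \<Longrightarrow> torus_smooth g \<Longrightarrow> torus_smooth (\<lambda>p. f p - g p)"
  using torus_smooth_linear[of f g 1 "- 1"] by simp

lemma torus_smooth_sum:
  "finite A \<Longrightarrow> (\<And>i. i \<in> A \<Longrightarrow> torus_smooth (f i)) \<Longrightarrow> torus_smooth (\<lambda>p. \<Sum>i\<in>A. f i p)"
proof (induction A rule: finite_induct)
  case (insert x A)
  then show ?case using torus_smooth_linear[of "f x" "\<lambda>p. \<Sum>i\<in>A. f i p" 1 1] by simp
qed (simp add: torus_smooth_const)

lemma
  assumes "torus_smooth f"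
  shows torus_smooth_continuous: "continuous_on UNIV (f \<circ> to_torus)"
    and torus_smooth_differentiable: "(f \<circ> to_torus) differentiable_on UNIV"
    and torus_smooth_deriv: "torus_smooth (torus_deriv (1, 0) f)" "torus_smooth (torus_deriv (0, 1) f)"
  using assms torus_Ck.simps(1)[of f] torus_Ck.simps(2)[of _ f] unfolding torus_smooth_def by blast+

lemma integral_periodic_derivative:
  fixes F f :: "real \<Rightarrow> real"
  assumes "\<And>x. (F has_real_derivative f x) (at x)" "continuous_on UNIV f" "F (2 * pi) = F 0"
  shows "integral\<^sup>L period_interval f = 0"
proof -
  have "integral\<^sup>L period_interval f = (\<integral>x. indicator {0..<2 * pi} x *\<^sub>R f x \<partial>lborel)"
    by (subst integral_restrict_space) auto
  also have "\<dots> = (\<integral>x. indicator {0..2 * pi} x *\<^sub>R f x \<partial>lborel)"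
  proof (rule integral_cong_AE)
    have [measurable]: "f \<in> borel_measurable borel" by (intro borel_measurable_continuous_onI assms)
    show "(\<lambda>x. indicator {0..<2 * pi} x *\<^sub>R f x) \<in> borel_measurable lborel"
      "(\<lambda>x. indicator {0..2 * pi} x *\<^sub>R f x) \<in> borel_measurable lborel"
      by measurable
    show "AE x in lborel. indicator {0..<2 * pi} x *\<^sub>R f x = indicator {0..2 * pi} x *\<^sub>R f x"
      using AE_lborel_singleton[of "2 * pi"] by eventually_elim (auto simp: indicator_def)
  qed
  also have "\<dots> = F (2 * pi) - F 0"
    by (rule integral_FTC_atLeastAtMost)
       (use assms in \<open>auto intro: has_real_derivative_iff_has_vector_derivative[THEN iffD1] DERIV_subset
          continuous_on_subset\<close>)
  finally show ?thesis using assms(3) by simp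
qed

text \<open>The integral of a derivative along a closed line is the difference of two equal values.\<close>

lemma integral_torus_deriv_line:
  assumes h: "(h \<circ> to_torus) differentiable_on UNIV"
    and c: "continuous_on UNIV (torus_deriv v h \<circ> to_torus)"
    and per: "to_torus (z + (2 * pi) *\<^sub>R v) = to_torus z"
  shows "(\<integral>t. torus_deriv v h (to_torus (z + t *\<^sub>R v)) \<partial>period_interval) = 0"
proof (rule integral_periodic_derivative[where F = "\<lambda>t. h (to_torus (z + t *\<^sub>R v))"])
  fix t :: real
  let ?D = "\<lambda>w. torus_deriv w h (to_torus (z + t *\<^sub>R v))"
  have "((\<lambda>t. z + t *\<^sub>R v) has_derivative (\<lambda>s. s *\<^sub>R v)) (at t)"
    by (auto intro!: derivative_eq_intros)
  from has_derivative_compose[OF this lift_has_derivative[OF h]]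
  have d: "((\<lambda>t. h (to_torus (z + t *\<^sub>R v))) has_derivative (\<lambda>s. ?D (s *\<^sub>R v))) (at t)"
    by (simp add: comp_def)
  have "(\<lambda>s. ?D (s *\<^sub>R v)) = (*) (?D v)"
  proof
    fix s
    show "?D (s *\<^sub>R v) = ?D v * s"
      using linear_cmul[OF has_derivative_linear[OF lift_has_derivative[OF h]], of s v] by (simp add: mult.commute)
  qed
  with d show "((\<lambda>t. h (to_torus (z + t *\<^sub>R v))) has_real_derivative ?D v) (at t)"
    unfolding has_field_derivative_def by (simp only:)
next
  show "continuous_on UNIV (\<lambda>t. torus_deriv v h (to_torus (z + t *\<^sub>R v)))"
    by (rule continuous_on_compose2[OF c[unfolded comp_def]]; auto intro!: continuous_intros)
qed (simp add: per)

text \<open>By Fubini, integrate in the direction of the derivative first.\<close>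

lemma integral_torus_deriv:
  assumes h: "(h \<circ> to_torus) differentiable_on UNIV"
    and v: "v = (1, 0) \<or> v = (0, 1)"
    and c: "continuous_on UNIV (torus_deriv v h \<circ> to_torus)"
  shows "integral\<^sup>L torus_measure (torus_deriv v h) = 0"
proof -
  let ?g = "torus_deriv v h"
  have "integrable (distr period_square torus_measure to_torus) ?g"
    using continuous_torus_integrable[OF c] by (simp only: torus_measure_distr[symmetric])
  from integrable_distr[OF measurable_to_torus this]
  have int: "integrable period_square (\<lambda>(x, y). ?g (to_torus (x, y)))"
    by (simp add: split_beta')
  have eq: "integral\<^sup>L torus_measure ?g = (\<integral>(x, y). ?g (to_torus (x, y)) \<partial>period_square)"
    unfolding integral_torus[OF continuous_torus_measurable[OF c]] by (rule Bochner_Integration.integral_cong) auto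
  from v show ?thesis
  proof
    assume v: "v = (1, 0)"
    have "(\<integral>x. ?g (to_torus (x, y)) \<partial>period_interval) = 0" for y
      using integral_torus_deriv_line[OF h c, of "(0, y)"] to_torus_shift[of 0 1 y 0] by (simp add: v)
    then show ?thesis unfolding eq period_pair.integral_snd[OF int, symmetric] by simp
  next
    assume v: "v = (0, 1)"
    have "(\<integral>y. ?g (to_torus (x, y)) \<partial>period_interval) = 0" for x
      using integral_torus_deriv_line[OF h c, of "(x, 0)"] to_torus_shift[of x 0 0 1] by (simp add: v)
    then show ?thesis unfolding eq period_pair.integral_fst[OF int, symmetric] by simp
  qed
qed

lemma integration_by_parts:
  assumes "torus_smooth f" "torus_smooth g" "v = (1, 0) \<or> v = (0, 1)"
  shows "(\<integral>p. torus_deriv v f p * g p \<partial>torus_measure) = - (\<integral>p. f p * torus_deriv v g p \<partial>torus_measure)"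
proof -
  have diff: "((\<lambda>p. f p * g p) \<circ> to_torus) differentiable_on UNIV"
    using differentiable_on_mult[OF assms(1,2)[THEN torus_smooth_differentiable]] unfolding comp_def .
  have smooth: "torus_smooth (torus_deriv v f)" "torus_smooth (torus_deriv v g)"
    using assms torus_smooth_deriv by blast+
  have cont: "continuous_on UNIV ((\<lambda>p. torus_deriv v f p * g p) \<circ> to_torus)"
    "continuous_on UNIV ((\<lambda>p. f p * torus_deriv v g p) \<circ> to_torus)"
    using smooth[THEN torus_smooth_continuous] assms(1,2)[THEN torus_smooth_continuous]
    unfolding comp_def by (simp_all add: continuous_on_mult)
  have eq: "torus_deriv v (\<lambda>p. f p * g p) = (\<lambda>p. f p * torus_deriv v g p + torus_deriv v f p * g p)"
    using assms(1,2) by (intro torus_deriv_mult torus_smooth_differentiable)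
  have "continuous_on UNIV (torus_deriv v (\<lambda>p. f p * g p) \<circ> to_torus)"
    using continuous_on_add[OF cont(2) cont(1)] unfolding eq comp_def .
  then have "integral\<^sup>L torus_measure (torus_deriv v (\<lambda>p. f p * g p)) = 0"
    by (rule integral_torus_deriv[OF diff assms(3)])
  moreover have "integral\<^sup>L torus_measure (torus_deriv v (\<lambda>p. f p * g p)) =
      (\<integral>p. f p * torus_deriv v g p \<partial>torus_measure) + (\<integral>p. torus_deriv v f p * g p \<partial>torus_measure)"
    unfolding eq by (intro Bochner_Integration.integral_add cont[THEN continuous_torus_integrable])
  ultimately show ?thesis by linarith
qed

section \<open>The complex Hilbert space of the torus\<close>

interpretation L2: vector_space L2_scaleC
  by (rule vector_space_L2_scaleC)

lemma L2_cases:
  obtains f where "square_integrable f" "u = to_L2 f"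
proof -
  have "u = to_L2 (rep_L2 u)" using Quotient_abs_rep[OF Quotient_torus_L2] by metis
  moreover have "square_integrable (rep_L2 u)" using Quotient_rep_reflp[OF Quotient_torus_L2] by blast
  ultimately show ?thesis by (rule that[rotated])
qed

lemma
  assumes "square_integrable f" "square_integrable g"
  shows to_L2_add: "to_L2 f + to_L2 g = to_L2 (\<lambda>p. f p + g p)"
    and to_L2_diff: "to_L2 f - to_L2 g = to_L2 (\<lambda>p. f p - g p)"
    and inner_to_L2: "to_L2 f \<bullet> to_L2 g = (\<integral>p. f p \<bullet> g p \<partial>torus_measure)"
  using assms by (simp_all add: plus_torus_L2.abs_eq minus_torus_L2.abs_eq inner_torus_L2.abs_eq)

lemma to_L2_scaleR: "square_integrable f \<Longrightarrow> r *\<^sub>R to_L2 f = to_L2 (\<lambda>p. r *\<^sub>R f p)"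
  by (simp add: scaleR_torus_L2.abs_eq)

lemma to_L2_scaleC: "square_integrable f \<Longrightarrow> L2_scaleC c (to_L2 f) = to_L2 (\<lambda>p. c * f p)"
  by (simp add: L2_scaleC.abs_eq)

lemma L2_Re_to_L2: "square_integrable f \<Longrightarrow> L2_Re (to_L2 f) = to_L2 (\<lambda>p. Re (f p))"
  and L2_Im_to_L2: "square_integrable f \<Longrightarrow> L2_Im (to_L2 f) = to_L2 (\<lambda>p. Im (f p))"
  by (simp_all add: L2_Re.abs_eq L2_Im.abs_eq)

lemma cinner_to_L2:
  "square_integrable f \<Longrightarrow> square_integrable g \<Longrightarrow>
    L2_cinner (to_L2 f) (to_L2 g) = (\<integral>p. cnj (f p) * g p \<partial>torus_measure)"
  by (simp add: L2_cinner.abs_eq)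

lemma square_integrable_diff:
  "square_integrable f \<Longrightarrow> square_integrable g \<Longrightarrow> square_integrable (\<lambda>p. f p - g p)"
  using square_integrable_add[of f "\<lambda>p. - g p"]
    square_integrable_bounded_linear[of g, OF _ bounded_linear_minus[OF bounded_linear_ident]] by simp

lemma square_integrable_mult_left:
  fixes f :: "torus \<Rightarrow> complex"
  shows "square_integrable f \<Longrightarrow> square_integrable (\<lambda>p. c * f p)"
  by (rule square_integrable_bounded_linear[OF _ bounded_linear_mult_right])

lemma norm_to_L2: "square_integrable f \<Longrightarrow> (norm (to_L2 f))\<^sup>2 = (\<integral>p. (norm (f p))\<^sup>2 \<partial>torus_measure)"
  by (simp add: dot_square_norm[symmetric] inner_to_L2)

lemma L2_scaleC_eq: "L2_scaleC c u = Re c *\<^sub>R u + Im c *\<^sub>R L2_scaleC \<i> u"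
proof -
  obtain f where f: "square_integrable f" "u = to_L2 f" by (rule L2_cases)
  have i: "square_integrable (\<lambda>p. \<i> * f p)" "square_integrable (\<lambda>p. c * f p)"
    using f(1) by (rule square_integrable_mult_left)+
  have s: "square_integrable (\<lambda>p. Re c *\<^sub>R f p)" "square_integrable (\<lambda>p. Im c *\<^sub>R (\<i> * f p))"
    using f(1) i(1) by (auto intro: square_integrable_bounded_linear bounded_linear_scaleR_right)
  have "(\<lambda>p. c * f p) = (\<lambda>p. Re c *\<^sub>R f p + Im c *\<^sub>R (\<i> * f p))"
    by (rule ext) (simp add: complex_eq_iff algebra_simps)
  then show ?thesis unfolding f(2) using f(1) i s by (simp add: to_L2_scaleC to_L2_scaleR to_L2_add)
qed

lemma L2_scaleC_ii_inner: "L2_scaleC \<i> u \<bullet> L2_scaleC \<i> v = u \<bullet> v"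
  and L2_scaleC_ii_skew: "L2_scaleC \<i> u \<bullet> v = - (u \<bullet> L2_scaleC \<i> v)"
proof -
  obtain f g where f: "square_integrable f" "u = to_L2 f" and g: "square_integrable g" "v = to_L2 g"
    by (metis L2_cases)
  show "L2_scaleC \<i> u \<bullet> L2_scaleC \<i> v = u \<bullet> v" "L2_scaleC \<i> u \<bullet> v = - (u \<bullet> L2_scaleC \<i> v)"
    unfolding f(2) g(2)
    using f(1) g(1) square_integrable_mult_left[OF f(1)] square_integrable_mult_left[OF g(1)]
    by (simp_all add: to_L2_scaleC inner_to_L2 inner_complex_def add.commute
        Bochner_Integration.integral_minus[symmetric] del: Bochner_Integration.integral_minus)
qed

text \<open>All algebraic rules for the complex inner product follow from those of the real one.\<close>

lemma L2_cinner_eq: "L2_cinner u v = Complex (u \<bullet> v) (L2_scaleC \<i> u \<bullet> v)"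
proof -
  obtain f g where f: "square_integrable f" "u = to_L2 f" and g: "square_integrable g" "v = to_L2 g"
    by (metis L2_cases)
  have i: "square_integrable (\<lambda>p. \<i> * f p)" by (rule square_integrable_mult_left[OF f(1)])
  have "(\<lambda>p. cnj (f p) * g p) = (\<lambda>p. complex_of_real (f p \<bullet> g p) + \<i> * complex_of_real ((\<i> * f p) \<bullet> g p))"
    by (rule ext) (simp add: complex_eq_iff inner_complex_def)
  then have "(\<integral>p. cnj (f p) * g p \<partial>torus_measure) =
      complex_of_real (\<integral>p. f p \<bullet> g p \<partial>torus_measure) + \<i> * complex_of_real (\<integral>p. (\<i> * f p) \<bullet> g p \<partial>torus_measure)"
    using integrable_square_integrable_inner[OF f(1) g(1)] integrable_square_integrable_inner[OF i g(1)]
    by (simp add: integral_complex_of_real)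
  then show ?thesis unfolding f(2) g(2)
    using f(1) g(1) i by (simp add: cinner_to_L2 to_L2_scaleC inner_to_L2 Complex_eq)
qed

lemma Re_L2_cinner: "Re (L2_cinner u v) = u \<bullet> v"
  by (simp add: L2_cinner_eq)

lemma L2_cinner_add_right: "L2_cinner u (v + w) = L2_cinner u v + L2_cinner u w"
  and L2_cinner_add_left: "L2_cinner (u + v) w = L2_cinner u w + L2_cinner v w"
  and L2_cinner_diff_right: "L2_cinner u (v - w) = L2_cinner u v - L2_cinner u w"
  and L2_cinner_diff_left: "L2_cinner (u - v) w = L2_cinner u w - L2_cinner v w"
  by (simp_all add: L2_cinner_eq complex_eq_iff inner_simps L2.scale_right_distrib L2.scale_right_diff_distrib)

lemma L2_cinner_scaleC_right: "L2_cinner u (L2_scaleC c v) = c * L2_cinner u v"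
  unfolding L2_cinner_eq L2_scaleC_eq[of c v]
  by (simp add: complex_eq_iff inner_simps L2_scaleC_ii_inner L2_scaleC_ii_skew[of u v])

lemma L2_cinner_commute: "L2_cinner u v = cnj (L2_cinner v u)"
  using L2_scaleC_ii_skew[of u v]
  by (simp add: L2_cinner_eq complex_eq_iff inner_commute[of u v] inner_commute[of u "L2_scaleC \<i> v"])

lemma L2_cinner_scaleC_left: "L2_cinner (L2_scaleC c u) v = cnj c * L2_cinner u v"
  by (subst (1 2) L2_cinner_commute) (simp add: L2_cinner_scaleC_right)

lemma L2_cinner_self: "L2_cinner u u = complex_of_real ((norm u)\<^sup>2)"
  using L2_scaleC_ii_skew[of u u] by (simp add: L2_cinner_eq complex_eq_iff dot_square_norm inner_commute)

lemma L2_cinner_zero [simp]: "L2_cinner 0 u = 0" "L2_cinner u 0 = 0"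
  using L2_cinner_add_left[of 0 0 u] L2_cinner_add_right[of u 0 0] by simp_all

lemma L2_cinner_sum_right: "L2_cinner u (\<Sum>i\<in>A. f i) = (\<Sum>i\<in>A. L2_cinner u (f i))"
  by (induction A rule: infinite_finite_induct) (simp_all add: L2_cinner_add_right)

lemma norm_L2_scaleC: "norm (L2_scaleC c u) = cmod c * norm u"
proof -
  have "complex_of_real ((norm (L2_scaleC c u))\<^sup>2) = complex_of_real ((cmod c * norm u)\<^sup>2)"
    unfolding L2_cinner_self[symmetric] L2_cinner_scaleC_left L2_cinner_scaleC_right
    by (simp only: L2_cinner_self power_mult_distrib of_real_mult complex_norm_square mult_ac)
  then have "(norm (L2_scaleC c u))\<^sup>2 = (cmod c * norm u)\<^sup>2" using of_real_eq_iff by blast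
  then show ?thesis by (simp add: power2_eq_iff_nonneg)
qed

lemma norm_L2_cinner_le: "cmod (L2_cinner u v) \<le> norm u * norm v"
proof (cases "L2_cinner u v = 0")
  case False
  define z where "z = L2_cinner u v"
  define c where "c = cnj z / cmod z"
  have c: "cmod c = 1" "c * z = cmod z" using False
    by (simp_all add: c_def z_def norm_divide complex_norm_square[symmetric] power2_eq_square mult.commute[of "cnj _"])
  have "cmod z = Re (c * z)" using c by simp
  also have "\<dots> = u \<bullet> L2_scaleC c v" by (simp add: z_def L2_cinner_scaleC_right[symmetric] Re_L2_cinner)
  also have "\<dots> \<le> norm u * norm (L2_scaleC c v)" by (rule norm_cauchy_schwarz)
  finally show ?thesis using c by (simp add: norm_L2_scaleC z_def)
qed simp

lemma bounded_linear_L2_cinner_right: "bounded_linear (L2_cinner u)"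
proof (rule bounded_linear_intro[where K = "norm u"])
  show "L2_cinner u (r *\<^sub>R v) = r *\<^sub>R L2_cinner u v" for r v
    by (simp add: L2_cinner_eq complex_eq_iff)
  show "norm (L2_cinner u v) \<le> norm v * norm u" for v
    using norm_L2_cinner_le[of u v] by (simp add: mult.commute)
qed (rule L2_cinner_add_right)

lemma bounded_linear_L2_cinner_left: "bounded_linear (\<lambda>v. L2_cinner v u)"
proof -
  have "bounded_linear (\<lambda>v. cnj (L2_cinner u v))"
    by (rule bounded_linear_compose[OF bounded_linear_cnj bounded_linear_L2_cinner_right])
  then show ?thesis by (simp add: L2_cinner_commute[symmetric])
qed

lemma bounded_linear_L2_scaleC: "bounded_linear (L2_scaleC c)"
proof (rule bounded_linear_intro[where K = "cmod c"])
  show "L2_scaleC c (r *\<^sub>R u) = r *\<^sub>R L2_scaleC c u" for r u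
  proof -
    have "r *\<^sub>R v = L2_scaleC (complex_of_real r) v" for v by (subst L2_scaleC_eq) simp
    then show ?thesis by (simp add: mult.commute)
  qed
qed (simp_all add: L2.scale_right_distrib norm_L2_scaleC mult.commute)

section \<open>Expansion in orthonormal bases\<close>

text \<open>The residue \<open>x - P x\<close> of the orthogonal projection is orthogonal to the span of \<open>F\<close>, so the
  difference of \<open>x\<close> and any other combination \<open>y\<close> splits by Pythagoras into \<open>x - P x\<close> and \<open>P x - y\<close>.\<close>

lemma orthonormal_best_approximation:
  assumes "finite F" and on: "\<And>u v. u \<in> F \<Longrightarrow> v \<in> F \<Longrightarrow> L2_cinner u v = (if u = v then 1 else 0)"
  shows "norm (x - (\<Sum>u\<in>F. L2_scaleC (L2_cinner u x) u)) \<le> norm (x - (\<Sum>u\<in>F. L2_scaleC (c u) u))"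
proof -
  let ?P = "\<Sum>u\<in>F. L2_scaleC (L2_cinner u x) u" and ?y = "\<Sum>u\<in>F. L2_scaleC (c u) u"
  have coeff: "L2_cinner v (\<Sum>u\<in>F. L2_scaleC (d u) u) = d v" if "v \<in> F" for v d
  proof -
    have "L2_cinner v (\<Sum>u\<in>F. L2_scaleC (d u) u) = (\<Sum>u\<in>F. if u = v then d v else 0)"
      unfolding L2_cinner_sum_right L2_cinner_scaleC_right using on[OF that] by (intro sum.cong) auto
    then show ?thesis using assms(1) that by simp
  qed
  have "L2_cinner v (x - ?P) = 0" if "v \<in> F" for v
    using coeff[OF that] by (simp add: L2_cinner_diff_right)
  then have "L2_cinner (x - ?P) v = 0" if "v \<in> F" for v
    using that by (subst L2_cinner_commute) simp
  moreover have "?P - ?y = (\<Sum>u\<in>F. L2_scaleC (L2_cinner u x - c u) u)"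
    by (simp add: sum_subtractf L2.scale_left_diff_distrib)
  ultimately have "L2_cinner (x - ?P) (?P - ?y) = 0"
    by (simp only: L2_cinner_sum_right L2_cinner_scaleC_right) simp
  then have "(x - ?P) \<bullet> (?P - ?y) = 0" using Re_L2_cinner[of "x - ?P" "?P - ?y"] by simp
  then have "(norm (x - ?P + (?P - ?y)))\<^sup>2 = (norm (x - ?P))\<^sup>2 + (norm (?P - ?y))\<^sup>2"
    by (intro norm_add_Pythagorean) (simp add: orthogonal_def)
  then have "(norm (x - ?P))\<^sup>2 \<le> (norm (x - ?y))\<^sup>2" by simp
  then show ?thesis by (rule power2_le_imp_le) simp
qed

text \<open>By density some finite combination of basis vectors is close to \<open>x\<close>.  The projections onto all
  larger finite subsets of the basis are at least as close.\<close>

lemma orthonormal_basis_expansion: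
  assumes "L2_orthonormal_basis S"
  shows "((\<lambda>u. L2_scaleC (L2_cinner u x) u) has_sum x) S"
  unfolding has_sum_def
proof (rule tendstoI)
  fix e :: real assume "e > 0"
  have on: "L2_cinner u v = (if u = v then 1 else 0)" if "u \<in> S" "v \<in> S" for u v
    using assms that unfolding L2_orthonormal_basis_def by blast
  have "x \<in> closure (L2.span S)" using assms unfolding L2_orthonormal_basis_def by blast
  then obtain y where "y \<in> L2.span S" and y: "dist y x < e"
    using \<open>e > 0\<close> unfolding closure_approachable by blast
  then obtain t r where t: "finite t" "t \<subseteq> S" "y = (\<Sum>u\<in>t. L2_scaleC (r u) u)"
    unfolding L2.span_explicit by blast
  show "\<forall>\<^sub>F F in finite_subsets_at_top S. dist (\<Sum>u\<in>F. L2_scaleC (L2_cinner u x) u) x < e"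
    unfolding eventually_finite_subsets_at_top
  proof (intro exI conjI allI impI)
    fix F assume F: "finite F \<and> t \<subseteq> F \<and> F \<subseteq> S"
    have "y = (\<Sum>u\<in>F. L2_scaleC (if u \<in> t then r u else 0) u)"
      unfolding t(3) using F by (intro sum.mono_neutral_cong_left) auto
    then have "norm (x - (\<Sum>u\<in>F. L2_scaleC (L2_cinner u x) u)) \<le> norm (x - y)"
      using orthonormal_best_approximation[of F x "\<lambda>u. if u \<in> t then r u else 0"] F on by (simp add: subset_iff)
    also have "\<dots> < e" using y by (simp add: dist_norm norm_minus_commute)
    finally show "dist (\<Sum>u\<in>F. L2_scaleC (L2_cinner u x) u) x < e"
      by (simp add: dist_norm norm_minus_commute)
  qed (use t in auto)
qed

lemma Parseval_identity:
  assumes "L2_orthonormal_basis S"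
  shows "((\<lambda>u. cnj (L2_cinner u x) * L2_cinner u y) has_sum L2_cinner x y) S"
  using has_sum_bounded_linear[OF bounded_linear_L2_cinner_left orthonormal_basis_expansion[OF assms, of x], of y]
  by (simp add: L2_cinner_scaleC_left comp_def)

lemma Parseval_norm:
  assumes "L2_orthonormal_basis S"
  shows "((\<lambda>u. (cmod (L2_cinner u x))\<^sup>2) has_sum (norm x)\<^sup>2) S"
proof -
  have "((\<lambda>u. Re (cnj (L2_cinner u x) * L2_cinner u x)) has_sum Re (L2_cinner x x)) S"
    using has_sum_bounded_linear[OF bounded_linear_Re Parseval_identity[OF assms, of x x]]
    by (simp add: comp_def)
  moreover have "Re (cnj z * z) = (cmod z)\<^sup>2" for z by (simp add: cmod_power2 power2_eq_square[of "Re z"] power2_eq_square[of "Im z"])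
  ultimately show ?thesis by (simp only: L2_cinner_self Re_complex_of_real)
qed

lemma orthonormal_basis_eqI:
  assumes "L2_orthonormal_basis S" "\<And>s. s \<in> S \<Longrightarrow> L2_cinner s u = L2_cinner s v"
  shows "u = v"
proof -
  have "((\<lambda>s. L2_scaleC (L2_cinner s u) s) has_sum v) S"
    using orthonormal_basis_expansion[OF assms(1), of v] assms(2) by (simp cong: has_sum_cong)
  with orthonormal_basis_expansion[OF assms(1), of u] show ?thesis by (rule has_sum_unique)
qed

section \<open>The Fourier basis\<close>

definition angle :: "int \<times> int \<Rightarrow> real \<times> real \<Rightarrow> real"
  where "angle k z = of_int (fst k) * fst z + of_int (snd k) * snd z"

text \<open>The real waves of a fixed frequency form a two-dimensional space that is stable under
  differentiation.\<close>
definition real_wave :: "real \<Rightarrow> real \<Rightarrow> int \<times> int \<Rightarrow> torus \<Rightarrow> real"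
  where "real_wave A B k p = A * cos (angle k (torus_coord p)) + B * sin (angle k (torus_coord p))"

definition fourier :: "int \<times> int \<Rightarrow> torus \<Rightarrow> complex"
  where "fourier k p = cis (angle k (torus_coord p)) / (2 * pi)"

lemma cis_angle_torus_coord: "cis (angle k (torus_coord (to_torus z))) = cis (angle k z)"
proof -
  obtain x y where z: "z = (x, y)" by (cases z)
  define m n where "m = \<lfloor>x / (2 * pi)\<rfloor>" and "n = \<lfloor>y / (2 * pi)\<rfloor>"
  have "angle k (torus_coord (to_torus z)) = angle k z + 2 * pi * of_int (- (fst k * m + snd k * n))"
    by (simp add: z angle_def torus_coord_def to_torus_def circle_coord_to_circle m_def n_def algebra_simps)
  then have "cis (angle k (torus_coord (to_torus z))) = cis (angle k z) * cis (2 * pi * of_int (- (fst k * m + snd k * n)))"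
    by (simp only: cis_mult)
  then show ?thesis by (simp only: cis_multiple_2pi[OF Ints_of_int] mult_1_right)
qed

lemma real_wave_to_torus: "real_wave A B k (to_torus z) = A * cos (angle k z) + B * sin (angle k z)"
  using cis_angle_torus_coord[of k z] by (simp add: real_wave_def complex_eq_iff)

lemma angle_linear: "bounded_linear (angle k)"
  unfolding angle_def
  by (intro bounded_linear_add bounded_linear_const_mult bounded_linear_fst bounded_linear_snd)

lemma lift_real_wave_has_derivative:
  "(real_wave A B k \<circ> to_torus has_derivative
    (\<lambda>v. real_wave (B * angle k v) (- A * angle k v) k (to_torus z))) (at z)"
proof -
  have [derivative_intros]: "(angle k has_derivative angle k) (at z)"
    by (rule bounded_linear_imp_has_derivative[OF angle_linear])
  show ?thesis
    unfolding comp_def real_wave_to_torus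
    by (auto intro!: derivative_eq_intros simp: algebra_simps)
qed

lemma torus_deriv_real_wave:
  "torus_deriv v (real_wave A B k) = real_wave (B * angle k v) (- A * angle k v) k"
  by (rule torus_deriv_eqI[where D = "\<lambda>v. real_wave (B * angle k v) (- A * angle k v) k"])
     (rule lift_real_wave_has_derivative)

lemma torus_smooth_real_wave: "torus_smooth (real_wave A B k)"
proof -
  have diff: "(real_wave A B k \<circ> to_torus) differentiable_on UNIV" for A B
    using lift_real_wave_has_derivative unfolding differentiable_on_def differentiable_def by blast
  have "torus_Ck n (real_wave A B k)" for n
  proof (induction n arbitrary: A B)
    case 0
    then show ?case using differentiable_imp_continuous_on[OF diff] by simp
  next
    case (Suc n)
    then show ?case using diff by (simp only: torus_Ck.simps torus_deriv_real_wave simp_thms)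
  qed
  then show ?thesis by (simp add: torus_smooth_def)
qed

lemma fourier_eq: "fourier k p = (complex_of_real (real_wave 1 0 k p) + \<i> * complex_of_real (real_wave 0 1 k p)) / (2 * pi)"
proof -
  have "cis x = complex_of_real (cos x) + \<i> * complex_of_real (sin x)" for x
    by (simp add: complex_eq_iff)
  then show ?thesis by (simp only: fourier_def real_wave_def mult_1_left mult_zero_left add_0_right add_0_left)
qed

lemma continuous_fourier: "continuous_on UNIV (fourier k \<circ> to_torus)"
  using torus_smooth_continuous[OF torus_smooth_real_wave, of 1 0 k] torus_smooth_continuous[OF torus_smooth_real_wave, of 0 1 k]
  unfolding comp_def fourier_eq by (intro continuous_intros) auto

lemma square_integrable_fourier: "square_integrable (fourier k)"
  by (rule continuous_square_integrable[OF continuous_fourier])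

text \<open>A wave of nonzero frequency is a derivative of another one.\<close>

lemma integral_real_wave: "k \<noteq> 0 \<Longrightarrow> integral\<^sup>L torus_measure (real_wave A B k) = 0"
proof -
  assume "k \<noteq> 0"
  then consider "fst k \<noteq> 0" | "snd k \<noteq> 0" by (auto simp: prod_eq_iff)
  then obtain v :: "real \<times> real" where v: "v = (1, 0) \<or> v = (0, 1)" "angle k v \<noteq> 0"
  proof cases
    case 1
    then show ?thesis by (intro that[of "(1, 0)"]) (simp_all add: angle_def)
  next
    case 2
    then show ?thesis by (intro that[of "(0, 1)"]) (simp_all add: angle_def)
  qed
  let ?h = "real_wave (- B / angle k v) (A / angle k v) k"
  have "real_wave A B k = torus_deriv v ?h" using v(2) by (simp add: torus_deriv_real_wave)
  moreover have "integral\<^sup>L torus_measure (torus_deriv v ?h) = 0"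
    by (rule integral_torus_deriv[OF torus_smooth_differentiable[OF torus_smooth_real_wave] v(1)])
       (simp only: torus_deriv_real_wave torus_smooth_continuous[OF torus_smooth_real_wave])
  ultimately show ?thesis by simp
qed

lemma integral_fourier: "integral\<^sup>L torus_measure (fourier k) = (if k = 0 then 2 * pi else 0)"
proof (cases "k = 0")
  case True
  then have "fourier k = (\<lambda>p. 1 / (2 * pi))" by (auto simp: fourier_def angle_def)
  then show ?thesis using True
    by (simp add: measure_torus power2_eq_square scaleR_conv_of_real field_simps)
next
  case False
  have "integrable torus_measure (real_wave A B k)" for A B
    by (rule continuous_torus_integrable[OF torus_smooth_continuous[OF torus_smooth_real_wave]])
  then show ?thesis using False
    unfolding fourier_eq by (simp add: integral_complex_of_real integral_real_wave)
qed

definition fourier_L2 :: "int \<times> int \<Rightarrow> complex torus_L2"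
  where "fourier_L2 k = to_L2 (fourier k)"

lemma cnj_fourier_mult: "cnj (fourier k p) * fourier l p = fourier (l - k) p / (2 * pi)"
proof -
  have "cnj (cis a) * cis b = cis (b - a)" for a b by (simp add: cis_cnj cis_mult)
  moreover have "angle (l - k) z = angle l z - angle k z" for z
    by (simp add: angle_def algebra_simps)
  moreover have "cnj (u / complex_of_real c) * (v / complex_of_real c) = (cnj u * v) / complex_of_real c / complex_of_real c" for u v c
    by simp
  ultimately show ?thesis by (simp only: fourier_def)
qed

lemma fourier_mult: "fourier k p * fourier l p = fourier (k + l) p / (2 * pi)"
proof -
  have "angle (k + l) z = angle k z + angle l z" for z
    by (simp add: angle_def algebra_simps)
  then show ?thesis by (simp only: fourier_def cis_mult[symmetric]) simp
qed

lemma cinner_fourier_L2: "L2_cinner (fourier_L2 k) (fourier_L2 l) = (if k = l then 1 else 0)"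
  unfolding fourier_L2_def cinner_to_L2[OF square_integrable_fourier square_integrable_fourier] cnj_fourier_mult
  by (simp add: integral_fourier)

text \<open>Trigonometric polynomials are the polynomials in the coordinates of the embedding of the torus
  into \<open>\<complex>\<^sup>2\<close>; this brings the Stone-Weierstrass theorem on the compact image to bear.\<close>

inductive trig_poly :: "(torus \<Rightarrow> complex) \<Rightarrow> bool" where
  fourier: "trig_poly (\<lambda>p. c * fourier k p)"
| add: "trig_poly f \<Longrightarrow> trig_poly g \<Longrightarrow> trig_poly (\<lambda>p. f p + g p)"

lemma trig_poly_continuous: "trig_poly f \<Longrightarrow> continuous_on UNIV (f \<circ> to_torus)"
proof (induction rule: trig_poly.induct)
  case (fourier c k)
  then show ?case using continuous_fourier[of k] unfolding comp_def by (intro continuous_intros)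
next
  case (add f g)
  then show ?case unfolding comp_def by (intro continuous_intros)
qed

lemma trig_poly_square_integrable: "trig_poly f \<Longrightarrow> square_integrable f"
  by (rule continuous_square_integrable[OF trig_poly_continuous])

lemma trig_poly_in_span: "trig_poly f \<Longrightarrow> to_L2 f \<in> L2.span (range fourier_L2)"
proof (induction rule: trig_poly.induct)
  case (fourier c k)
  have "to_L2 (\<lambda>p. c * fourier k p) = L2_scaleC c (fourier_L2 k)"
    by (simp add: fourier_L2_def to_L2_scaleC square_integrable_fourier)
  then show ?case by (simp add: L2.span_scale L2.span_base)
next
  case (add f g)
  then show ?case
    by (simp add: to_L2_add[OF trig_poly_square_integrable trig_poly_square_integrable, symmetric] L2.span_add)
qed

lemma trig_poly_const: "trig_poly (\<lambda>p. c)"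
proof -
  have "(\<lambda>p. c) = (\<lambda>p. (c * (2 * pi)) * fourier 0 p)" by (simp add: fourier_def angle_def)
  then show ?thesis using trig_poly.fourier by metis
qed

lemma trig_poly_mult: "trig_poly f \<Longrightarrow> trig_poly g \<Longrightarrow> trig_poly (\<lambda>p. f p * g p)"
proof (induction rule: trig_poly.induct)
  case (fourier c k)
  from \<open>trig_poly g\<close> show ?case
  proof (induction rule: trig_poly.induct)
    case (fourier d l)
    have "(\<lambda>p. c * fourier k p * (d * fourier l p)) = (\<lambda>p. (c * d / (2 * pi)) * fourier (k + l) p)"
    proof
      fix p
      have "c * fourier k p * (d * fourier l p) = c * d * (fourier k p * fourier l p)" by (simp add: mult_ac)
      then show "c * fourier k p * (d * fourier l p) = (c * d / (2 * pi)) * fourier (k + l) p"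
        unfolding fourier_mult by simp
    qed
    then show ?case using trig_poly.fourier by metis
  next
    case (add f g)
    then show ?case
      using trig_poly.add[of "\<lambda>p. c * fourier k p * f p" "\<lambda>p. c * fourier k p * g p"] by (simp add: distrib_left)
  qed
next
  case (add f g')
  then show ?case
    using trig_poly.add[of "\<lambda>p. f p * g p" "\<lambda>p. g' p * g p"] by (simp add: distrib_right)
qed

definition torus_embedding :: "torus \<Rightarrow> complex \<times> complex"
  where "torus_embedding p = (cis (fst (torus_coord p)), cis (snd (torus_coord p)))"

lemma trig_poly_polynomial_function:
  "real_polynomial_function P \<Longrightarrow> trig_poly (\<lambda>p. complex_of_real (P (torus_embedding p)))"
proof (induction rule: real_polynomial_function.induct)
  case (linear h)
  interpret h: bounded_linear h by fact
  have wave: "trig_poly (\<lambda>p. complex_of_real (A * cos (angle k (torus_coord p)) + B * sin (angle k (torus_coord p))))" for A B k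
  proof -
    have *: "complex_of_real (A * cos t + B * sin t) =
        (pi * Complex A (- B)) * (cis t / (2 * pi)) + (pi * Complex A B) * (cis (- t) / (2 * pi))" for t
    proof -
      have "(pi * u) * (v / (2 * pi)) = u * v / 2" for u v :: complex by simp
      then show ?thesis by (simp only:) (simp add: complex_eq_iff field_simps)
    qed
    have "- angle k z = angle (- k) z" for z by (simp add: angle_def)
    then have "(\<lambda>p. complex_of_real (A * cos (angle k (torus_coord p)) + B * sin (angle k (torus_coord p)))) =
        (\<lambda>p. (pi * Complex A (- B)) * fourier k p + (pi * Complex A B) * fourier (- k) p)"
      unfolding fourier_def * by simp
    moreover have "trig_poly (\<lambda>p. (pi * Complex A (- B)) * fourier k p + (pi * Complex A B) * fourier (- k) p)"
      by (intro trig_poly.intros)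
    ultimately show ?thesis by (simp only:)
  qed
  have split: "h (z, w) = (h (1, 0) * Re z + h (\<i>, 0) * Im z) + (h (0, 1) * Re w + h (0, \<i>) * Im w)" for z w
  proof -
    have "(z, w) = (Re z *\<^sub>R (1, 0) + Im z *\<^sub>R (\<i>, 0)) + (Re w *\<^sub>R (0, 1) + Im w *\<^sub>R (0, \<i>))"
      by (simp add: complex_eq_iff)
    then have "h (z, w) = h ((Re z *\<^sub>R (1, 0) + Im z *\<^sub>R (\<i>, 0)) + (Re w *\<^sub>R (0, 1) + Im w *\<^sub>R (0, \<i>)))"
      by (rule arg_cong)
    then show ?thesis by (simp only: h.add h.scaleR real_scaleR_def mult.commute)
  qed
  have eq: "complex_of_real (h (torus_embedding p)) =
      complex_of_real (h (1, 0) * cos (angle (1, 0) (torus_coord p)) + h (\<i>, 0) * sin (angle (1, 0) (torus_coord p))) +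
      complex_of_real (h (0, 1) * cos (angle (0, 1) (torus_coord p)) + h (0, \<i>) * sin (angle (0, 1) (torus_coord p)))" for p
    using split[of "cis (fst (torus_coord p))" "cis (snd (torus_coord p))"]
    by (simp add: torus_embedding_def angle_def)
  show ?case unfolding eq by (intro trig_poly.add wave)
next
  case (const c)
  then show ?case by (rule trig_poly_const)
next
  case (add f g)
  show ?case unfolding of_real_add by (rule trig_poly.add) (rule add)+
next
  case (mult f g)
  show ?case unfolding of_real_mult by (rule trig_poly_mult) (rule mult)+
qed

lemma L2_dominated_convergence:
  fixes f :: "torus \<Rightarrow> 'a::euclidean_space" and g :: "torus \<Rightarrow> real"
  assumes f: "f \<in> borel_measurable torus_measure" "\<And>n. s n \<in> borel_measurable torus_measure"
    and g: "square_integrable g" "\<And>n p. norm (s n p) \<le> g p"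
    and lim: "\<And>p. (\<lambda>n. s n p) \<longlonglongrightarrow> f p"
  shows "square_integrable f" "(\<lambda>n. to_L2 (s n)) \<longlonglongrightarrow> to_L2 f"
proof -
  have [measurable]: "f \<in> borel_measurable torus_measure" "\<And>n. s n \<in> borel_measurable torus_measure"
    "g \<in> borel_measurable torus_measure"
    using f g(1) by (auto simp: square_integrable_def)
  have int_g: "integrable torus_measure (\<lambda>p. (norm (g p))\<^sup>2)" using g(1) by (simp add: square_integrable_def)
  have f_le: "norm (f p) \<le> g p" for p
    by (rule LIMSEQ_le_const2[OF tendsto_norm[OF lim]]) (use g(2) in blast)
  have sq: "square_integrable h" if h [measurable]: "h \<in> borel_measurable torus_measure" and le: "\<And>p. norm (h p) \<le> g p"
    for h :: "torus \<Rightarrow> 'a"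
  proof -
    have "norm ((norm (h p))\<^sup>2) \<le> norm ((norm (g p))\<^sup>2)" for p
      using power_mono[OF le[of p] norm_ge_zero, where n = 2] by simp
    then have "AE p in torus_measure. norm ((norm (h p))\<^sup>2) \<le> norm ((norm (g p))\<^sup>2)" by (intro AE_I2)
    moreover have "(\<lambda>p. (norm (h p))\<^sup>2) \<in> borel_measurable torus_measure" by measurable
    ultimately have "integrable torus_measure (\<lambda>p. (norm (h p))\<^sup>2)"
      by (intro Bochner_Integration.integrable_bound[OF int_g])
    then show ?thesis using h by (simp add: square_integrable_def)
  qed
  show sf: "square_integrable f" by (rule sq[OF f(1) f_le])
  have ss: "square_integrable (s n)" for n by (rule sq[OF f(2) g(2)])
  have "(\<lambda>n. \<integral>p. (norm (s n p - f p))\<^sup>2 \<partial>torus_measure) \<longlonglongrightarrow> (\<integral>p. 0 \<partial>torus_measure)"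
  proof (rule integral_dominated_convergence[where w = "\<lambda>p. 4 * (norm (g p))\<^sup>2"])
    show "integrable torus_measure (\<lambda>p. 4 * (norm (g p))\<^sup>2)" using int_g by simp
    show "AE p in torus_measure. (\<lambda>n. (norm (s n p - f p))\<^sup>2) \<longlonglongrightarrow> 0"
    proof (rule AE_I2)
      fix p
      have "(\<lambda>n. (norm (s n p - f p))\<^sup>2) \<longlonglongrightarrow> (norm (f p - f p))\<^sup>2"
        by (rule tendsto_power[OF tendsto_norm[OF tendsto_diff[OF lim tendsto_const]]])
      then show "(\<lambda>n. (norm (s n p - f p))\<^sup>2) \<longlonglongrightarrow> 0" by simp
    qed
    show "AE p in torus_measure. norm ((norm (s n p - f p))\<^sup>2) \<le> 4 * (norm (g p))\<^sup>2" for n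
    proof (rule AE_I2)
      fix p
      have "norm (s n p - f p) \<le> norm (s n p) + norm (f p)" by (rule norm_triangle_ineq4)
      also have "\<dots> \<le> 2 * norm (g p)" using g(2)[of n p] f_le[of p] unfolding real_norm_def by linarith
      finally have "norm (s n p - f p) \<le> 2 * norm (g p)" .
      from power_mono[OF this norm_ge_zero, where n = 2] show "norm ((norm (s n p - f p))\<^sup>2) \<le> 4 * (norm (g p))\<^sup>2"
        by (simp add: power_mult_distrib)
    qed
  qed measurable
  moreover have "(norm (to_L2 (s n) - to_L2 f))\<^sup>2 = (\<integral>p. (norm (s n p - f p))\<^sup>2 \<partial>torus_measure)" for n
    unfolding to_L2_diff[OF ss sf] by (rule norm_to_L2[OF square_integrable_diff[OF ss sf]])
  ultimately have "(\<lambda>n. (norm (to_L2 (s n) - to_L2 f))\<^sup>2) \<longlonglongrightarrow> 0" by simp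
  from tendsto_real_sqrt[OF this] have "(\<lambda>n. norm (to_L2 (s n) - to_L2 f)) \<longlonglongrightarrow> 0" by simp
  then show "(\<lambda>n. to_L2 (s n)) \<longlonglongrightarrow> to_L2 f"
    by (rule LIM_zero_cancel[OF tendsto_norm_zero_cancel])
qed

lemma norm_to_L2_le:
  fixes f :: "torus \<Rightarrow> 'a::euclidean_space"
  assumes "f \<in> borel_measurable torus_measure" "\<And>p. norm (f p) \<le> B" "B \<ge> 0"
  shows "norm (to_L2 f) \<le> 2 * pi * B"
proof -
  have sq: "square_integrable f" by (rule bounded_square_integrable[OF assms(1,2)])
  have "(norm (to_L2 f))\<^sup>2 = (\<integral>p. (norm (f p))\<^sup>2 \<partial>torus_measure)" by (rule norm_to_L2[OF sq])
  also have "\<dots> \<le> (\<integral>p. B\<^sup>2 \<partial>torus_measure)"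
  proof (rule integral_mono)
    show "integrable torus_measure (\<lambda>p. (norm (f p))\<^sup>2)" using sq by (simp add: square_integrable_def)
    show "(norm (f p))\<^sup>2 \<le> B\<^sup>2" for p by (rule power_mono[OF assms(2) norm_ge_zero])
  qed simp
  also have "\<dots> = (2 * pi * B)\<^sup>2" by (simp add: measure_torus power_mult_distrib)
  finally show ?thesis by (rule power2_le_imp_le) (use assms(3) in simp)
qed

definition fourier_closure :: "complex torus_L2 set"
  where "fourier_closure = closure (L2.span (range fourier_L2))"

lemma fourier_closure_add:
  assumes "u \<in> fourier_closure" "v \<in> fourier_closure" shows "u + v \<in> fourier_closure"
proof -
  obtain x y where "\<And>n. x n \<in> L2.span (range fourier_L2)" "x \<longlonglongrightarrow> u"
    "\<And>n. y n \<in> L2.span (range fourier_L2)" "y \<longlonglongrightarrow> v"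
    using assms unfolding fourier_closure_def closure_sequential by blast
  then show ?thesis
    unfolding fourier_closure_def closure_sequential
    by (intro exI[of _ "\<lambda>n. x n + y n"]) (auto intro: L2.span_add tendsto_add)
qed

lemma fourier_closure_scaleC:
  assumes "u \<in> fourier_closure" shows "L2_scaleC c u \<in> fourier_closure"
proof -
  obtain x where "\<And>n. x n \<in> L2.span (range fourier_L2)" "x \<longlonglongrightarrow> u"
    using assms unfolding fourier_closure_def closure_sequential by blast
  then show ?thesis
    unfolding fourier_closure_def closure_sequential
    by (intro exI[of _ "\<lambda>n. L2_scaleC c (x n)"])
       (auto intro: L2.span_scale bounded_linear.tendsto[OF bounded_linear_L2_scaleC])
qed

lemma fourier_closure_limit:
  assumes "\<And>n::nat. x n \<in> fourier_closure" "x \<longlonglongrightarrow> u" shows "u \<in> fourier_closure"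
  using assms closed_sequentially[of fourier_closure] unfolding fourier_closure_def by auto

lemma borel_measurable_Arg2pi [measurable]: "Arg2pi \<in> borel_measurable borel"
proof -
  have "continuous_on (- \<real>\<^sub>\<ge>\<^sub>0) Arg2pi"
    by (intro continuous_at_imp_continuous_on ballI continuous_at_Arg2pi) simp
  then have "(\<lambda>z. indicator (- \<real>\<^sub>\<ge>\<^sub>0) z *\<^sub>R Arg2pi z) \<in> borel_measurable borel"
    by (intro borel_measurable_continuous_on_indicator) (simp_all add: borel_comp borel_closed)
  moreover have "(\<lambda>z. indicator (- \<real>\<^sub>\<ge>\<^sub>0) z *\<^sub>R Arg2pi z) = Arg2pi"
    by (rule ext) (simp add: indicator_def complex_nonneg_Reals_iff Arg2pi_eq_0 complex_is_Real_iff)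
  ultimately show ?thesis by (simp only:)
qed

lemma torus_embedding_measurable [measurable]: "torus_embedding \<in> borel_measurable torus_measure"
proof -
  have "continuous_on UNIV (torus_embedding \<circ> to_torus)"
  proof -
    have "cis (fst (torus_coord (to_torus z))) = cis (fst z)" "cis (snd (torus_coord (to_torus z))) = cis (snd z)" for z
      using cis_angle_torus_coord[of "(1, 0)" z] cis_angle_torus_coord[of "(0, 1)" z] by (simp_all add: angle_def)
    then show ?thesis unfolding comp_def torus_embedding_def by (simp only:) (intro continuous_intros)
  qed
  then show ?thesis by (rule continuous_torus_measurable)
qed

lemma torus_embedding_range: "torus_embedding p \<in> sphere 0 1 \<times> sphere 0 1"
  by (simp add: torus_embedding_def)

lemma measurable_to_circle_borel [measurable]: "to_circle \<in> measurable borel circle_measure"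
  by (rule measurableI) (auto simp: sets_circle_measure)

text \<open>The embedding has a Borel measurable left inverse, so that it pulls the Borel sets of \<open>\<complex>\<^sup>2\<close> back to
  all measurable sets of the torus.\<close>

lemma torus_set_eq_vimage:
  assumes "A \<in> sets torus_measure"
  obtains B where "B \<in> sets borel" "A = torus_embedding -` B"
proof
  let ?\<psi> = "\<lambda>w. (to_circle (Arg2pi (fst w)), to_circle (Arg2pi (snd w)))"
  have "?\<psi> \<in> measurable (borel \<Otimes>\<^sub>M borel) torus_measure"
    unfolding torus_measure_def
    by (intro measurable_Pair measurable_compose[OF _ measurable_to_circle_borel]
        measurable_compose[OF _ borel_measurable_Arg2pi] measurable_fst measurable_snd)
  then have "?\<psi> \<in> measurable borel torus_measure" unfolding borel_prod .
  from measurable_sets[OF this assms] show "?\<psi> -` A \<in> sets borel" by simp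
  have "Arg2pi (cis (circle_coord c)) = circle_coord c" for c
    by (rule Arg2pi_unique[where r = 1]) (simp_all add: circle_coord_bounds cis_conv_exp)
  then have inv: "?\<psi> (torus_embedding p) = p" for p
    by (cases p) (simp add: torus_embedding_def torus_coord_def)
  show "A = torus_embedding -` (?\<psi> -` A)"
    by (rule set_eqI) (simp only: vimage_eq inv)
qed

text \<open>By Stone-Weierstrass, \<open>g\<close> is a uniform limit of polynomials on the product of two circles, and a
  polynomial composed with the embedding is a trigonometric polynomial.\<close>

lemma continuous_embedding_fourier_closure:
  assumes "continuous_on (sphere 0 1 \<times> sphere 0 1) g"
    "(\<lambda>p. complex_of_real (g (torus_embedding p))) \<in> borel_measurable torus_measure"
  shows "to_L2 (\<lambda>p. complex_of_real (g (torus_embedding p))) \<in> fourier_closure"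
proof -
  let ?f = "\<lambda>p. complex_of_real (g (torus_embedding p))"
  have K: "compact (sphere (0::complex) 1 \<times> sphere (0::complex) 1)"
    by (intro compact_Times compact_sphere)
  obtain B where B: "\<And>z. z \<in> sphere 0 1 \<times> sphere 0 1 \<Longrightarrow> norm (g z) \<le> B"
    using compact_imp_bounded[OF compact_continuous_image[OF assms(1) K]] unfolding bounded_iff by blast
  have sq: "square_integrable ?f"
    by (rule bounded_square_integrable[OF assms(2), of B]) (use B torus_embedding_range in auto)
  have "\<exists>y\<in>L2.span (range fourier_L2). dist y (to_L2 ?f) < e" if "e > 0" for e
  proof -
    define d where "d = e / (2 * pi * 2)"
    have "d > 0" using that by (simp add: d_def)
    obtain P where P: "real_polynomial_function P" "\<And>z. z \<in> sphere 0 1 \<times> sphere 0 1 \<Longrightarrow> \<bar>g z - P z\<bar> < d"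
      using Stone_Weierstrass_real_polynomial_function[OF K assms(1) \<open>d > 0\<close>] by metis
    let ?p = "\<lambda>p. complex_of_real (P (torus_embedding p))"
    have tp: "trig_poly ?p" by (rule trig_poly_polynomial_function[OF P(1)])
    have "norm (to_L2 (\<lambda>p. ?p p - ?f p)) \<le> 2 * pi * d"
    proof (rule norm_to_L2_le)
      show "(\<lambda>p. ?p p - ?f p) \<in> borel_measurable torus_measure"
        using assms(2) continuous_torus_measurable[OF trig_poly_continuous[OF tp]] by (intro borel_measurable_diff)
      fix p
      have "\<bar>g (torus_embedding p) - P (torus_embedding p)\<bar> < d" by (rule P(2)[OF torus_embedding_range])
      then show "norm (?p p - ?f p) \<le> d"
        by (simp only: of_real_diff[symmetric] norm_of_real abs_minus_commute less_imp_le)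
    qed (use \<open>d > 0\<close> in simp)
    also have "\<dots> = e / 2" by (simp add: d_def)
    also have "\<dots> < e" using that by simp
    finally have "dist (to_L2 ?p) (to_L2 ?f) < e"
      by (simp add: dist_norm to_L2_diff[OF trig_poly_square_integrable[OF tp] sq])
    then show ?thesis using trig_poly_in_span[OF tp] by blast
  qed
  then show ?thesis unfolding fourier_closure_def closure_approachable by blast
qed

lemma indicator_square_integrable:
  assumes "A \<in> sets torus_measure" shows "square_integrable (\<lambda>p. c * of_real (indicator A p) :: complex)"
proof (rule bounded_square_integrable[where B = "cmod c"])
  show "(\<lambda>p. c * of_real (indicator A p)) \<in> borel_measurable torus_measure" using assms by measurable
  show "norm (c * of_real (indicator A p)) \<le> cmod c" for p by (simp add: indicator_def)
qed

lemma square_integrable_const: "square_integrable (\<lambda>p. c :: 'a::euclidean_space)"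
  by (rule bounded_square_integrable[of _ "norm c"]) auto

abbreviation embedding_indicator :: "(complex \<times> complex) set \<Rightarrow> torus \<Rightarrow> complex"
  where "embedding_indicator B \<equiv> \<lambda>p. complex_of_real (indicator (torus_embedding -` B) p)"

text \<open>The indicator of an open set \<open>U\<close> is the limit of the continuous functions
  \<open>min 1 (n * infdist z (- U))\<close>.\<close>

lemma open_vimage_fourier_closure:
  assumes "open U"
  shows "to_L2 (embedding_indicator U) \<in> fourier_closure"
proof (cases "U = UNIV")
  case True
  have "to_L2 (\<lambda>p. complex_of_real ((\<lambda>z. 1) (torus_embedding p))) \<in> fourier_closure"
    by (rule continuous_embedding_fourier_closure) auto
  then show ?thesis using True by simp
next
  case False
  define g :: "nat \<Rightarrow> complex \<times> complex \<Rightarrow> real" where "g n z = min 1 (real n * infdist z (- U))" for n z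
  let ?g = "\<lambda>n p. complex_of_real (g n (torus_embedding p))"
  have g: "continuous_on UNIV (g n)" for n
    unfolding g_def by (intro continuous_intros)
  have gm [measurable]: "(?g n) \<in> borel_measurable torus_measure" for n
    using measurable_comp[OF torus_embedding_measurable borel_measurable_continuous_onI[OF g[of n]]]
    by (simp add: comp_def)
  have V: "to_L2 (?g n) \<in> fourier_closure" for n
    by (rule continuous_embedding_fourier_closure[OF continuous_on_subset[OF g] gm]) simp
  have "(\<lambda>n. to_L2 (?g n)) \<longlonglongrightarrow>
      to_L2 (embedding_indicator U)"
  proof (rule L2_dominated_convergence(2)[where g = "\<lambda>p. 1"])
    have "torus_embedding -` U \<in> sets torus_measure"
      using measurable_sets[OF torus_embedding_measurable, of U] assms by simp
    then show "(embedding_indicator U) \<in> borel_measurable torus_measure"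
      by measurable
    show "norm (?g n p) \<le> 1" for n p
      by (simp add: g_def infdist_nonneg)
    fix p
    show "(\<lambda>n. ?g n p) \<longlonglongrightarrow> embedding_indicator U p"
    proof (cases "torus_embedding p \<in> U")
      case True
      have "infdist (torus_embedding p) (- U) > 0"
        using True \<open>U \<noteq> UNIV\<close> assms
        by (intro infdist_pos_not_in_closed) auto
      then obtain N :: nat where N: "1 < real N * infdist (torus_embedding p) (- U)"
        using reals_Archimedean3 by blast
      have "g n (torus_embedding p) = 1" if "n \<ge> N" for n
        unfolding g_def using N mult_right_mono[of "real N" "real n" "infdist (torus_embedding p) (- U)"] that
        by (simp add: infdist_nonneg)
      then have "eventually (\<lambda>n. ?g n p = 1) sequentially"
        unfolding eventually_sequentially by (intro exI[of _ N]) auto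
      then show ?thesis using True by (simp add: tendsto_eventually)
    next
      case False
      then have "infdist (torus_embedding p) (- U) = 0" by (intro infdist_zero) simp
      then show ?thesis using False by (simp add: g_def)
    qed
  qed (use gm square_integrable_const in auto)
  then show ?thesis by (rule fourier_closure_limit[OF V])
qed

definition approximable :: "(complex \<times> complex) set \<Rightarrow> bool"
  where "approximable B \<longleftrightarrow> to_L2 (embedding_indicator B) \<in> fourier_closure"

lemma square_integrable_vimage:
  assumes "B \<in> sets borel" shows "square_integrable (embedding_indicator B)"
proof -
  have "torus_embedding -` B \<in> sets torus_measure"
    using measurable_sets[OF torus_embedding_measurable assms] by simp
  from indicator_square_integrable[OF this, of 1] show ?thesis by simp
qed

lemma approximable_Compl:
  assumes "B \<in> sets borel" "approximable B" shows "approximable (UNIV - B)"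
proof -
  have eq: "(embedding_indicator (UNIV - B)) =
     (\<lambda>p. embedding_indicator UNIV p + (- 1) * embedding_indicator B p)"
    by (rule ext) (simp add: indicator_def)
  have B: "square_integrable (\<lambda>p. (- 1) * embedding_indicator B p)"
    by (rule square_integrable_mult_left[OF square_integrable_vimage[OF assms(1)]])
  have U: "square_integrable (embedding_indicator UNIV)"
    by (rule square_integrable_vimage) simp
  show ?thesis
    unfolding approximable_def eq to_L2_add[OF U B, symmetric]
      to_L2_scaleC[OF square_integrable_vimage[OF assms(1)], symmetric]
    by (intro fourier_closure_add fourier_closure_scaleC open_vimage_fourier_closure open_UNIV
        assms(2)[unfolded approximable_def])
qed

lemma approximable_disjoint_Un:
  assumes "A \<in> sets borel" "B \<in> sets borel" "A \<inter> B = {}" "approximable A" "approximable B"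
  shows "approximable (A \<union> B)"
proof -
  have eq: "(embedding_indicator (A \<union> B)) =
     (\<lambda>p. embedding_indicator A p + embedding_indicator B p)"
  proof
    fix p
    show "embedding_indicator (A \<union> B) p =
        embedding_indicator A p + embedding_indicator B p"
      using assms(3) by (cases "torus_embedding p \<in> A"; cases "torus_embedding p \<in> B") (auto simp: indicator_def)
  qed
  show ?thesis
    unfolding approximable_def eq to_L2_add[OF square_integrable_vimage[OF assms(1)] square_integrable_vimage[OF assms(2)], symmetric]
    by (intro fourier_closure_add assms(4,5)[unfolded approximable_def])
qed

lemma approximable_disjoint_UNION:
  fixes F :: "nat \<Rightarrow> (complex \<times> complex) set"
  assumes "disjoint_family F" "\<And>i. F i \<in> sets borel" "\<And>i. approximable (F i)"
  shows "approximable (\<Union>i. F i)"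
proof -
  have Un: "(\<Union>i<n. F i) \<in> sets borel" for n
    by (intro sets.finite_UN finite_lessThan assms(2))
  have fin: "approximable (\<Union>i<n. F i)" for n
  proof (induction n)
    case 0
    have "approximable {}" unfolding approximable_def by (rule open_vimage_fourier_closure) simp
    then show ?case by simp
  next
    case (Suc n)
    have "F i \<inter> F n = {}" if "i < n" for i
      using assms(1) that unfolding disjoint_family_on_def by simp
    then have "(\<Union>i<n. F i) \<inter> F n = {}" by blast
    then have "approximable ((\<Union>i<n. F i) \<union> F n)"
      by (intro approximable_disjoint_Un Un assms(2,3) Suc)
    then show ?case by (simp add: lessThan_Suc Un_commute)
  qed
  have "(\<lambda>n. to_L2 (embedding_indicator (\<Union>i<n. F i))) \<longlonglongrightarrow>
    to_L2 (embedding_indicator (\<Union>i. F i))"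
  proof (rule L2_dominated_convergence(2)[where g = "\<lambda>p. 1"])
    have "(\<Union>i. F i) \<in> sets borel" by (rule sets.countable_nat_UN) (use assms(2) in blast)
    from square_integrable_vimage[OF this]
    show "(embedding_indicator (\<Union>i. F i)) \<in> borel_measurable torus_measure"
      unfolding square_integrable_def ..
    show "(embedding_indicator (\<Union>i<n. F i)) \<in> borel_measurable torus_measure" for n
      using square_integrable_vimage[OF Un[of n]] unfolding square_integrable_def ..
    show "norm (embedding_indicator (\<Union>i<n. F i) p) \<le> 1" for n p
      unfolding norm_of_real by (simp add: indicator_def del: UN_iff)
    fix p
    have "(\<lambda>n. indicator (\<Union>i<n. F i) (torus_embedding p) :: complex) \<longlonglongrightarrow> indicator (\<Union>i. F i) (torus_embedding p)"
      by (rule LIMSEQ_indicator_UN)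
    moreover have "embedding_indicator X p = indicator X (torus_embedding p)" for X
      by (simp add: indicator_def)
    ultimately show "(\<lambda>n. embedding_indicator (\<Union>i<n. F i) p) \<longlonglongrightarrow>
        embedding_indicator (\<Union>i. F i) p" by (simp only:)
  qed (rule square_integrable_const)
  then show ?thesis
    unfolding approximable_def by (rule fourier_closure_limit[OF fin[unfolded approximable_def]])
qed

text \<open>The open sets generate the Borel sets and are closed under intersection; complements and countable
  disjoint unions stay approximable, so Dynkin's theorem applies.\<close>

lemma measurable_set_fourier_closure:
  assumes "A \<in> sets torus_measure"
  shows "to_L2 (\<lambda>p. complex_of_real (indicator A p)) \<in> fourier_closure"
proof -
  obtain B where B: "B \<in> sets borel" "A = torus_embedding -` B"
    by (rule torus_set_eq_vimage[OF assms])
  have sets_eq: "sigma_sets UNIV {U :: (complex \<times> complex) set. open U} = sets borel"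
    by (simp add: borel_def)
  have Int: "Int_stable {U :: (complex \<times> complex) set. open U}" by (auto simp: Int_stable_def)
  have "approximable B"
  proof (rule sigma_sets_induct_disjoint[OF Int _ B(1)[folded sets_eq]])
    show "approximable U" if "U \<in> {U. open U}" for U
      using that unfolding approximable_def by (intro open_vimage_fourier_closure) simp
    show "approximable {}" unfolding approximable_def by (intro open_vimage_fourier_closure) simp
    show "approximable (UNIV - B)" if "B \<in> sigma_sets UNIV {U. open U}" "approximable B" for B
      using that unfolding sets_eq by (rule approximable_Compl)
    show "approximable (\<Union> (range F))"
      if "disjoint_family F" "range F \<subseteq> sigma_sets UNIV {U. open U}" "\<And>i. approximable (F i)" for F :: "nat \<Rightarrow> _"
      using that(2) unfolding sets_eq by (intro approximable_disjoint_UNION that(1,3)) blast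
  qed simp
  then show ?thesis unfolding approximable_def B(2) .
qed

text \<open>Every square-integrable function is a dominated limit of simple functions, that is, of combinations of
  indicators.\<close>

lemma fourier_closure_UNIV: "fourier_closure = UNIV"
proof (intro equalityI subsetI)
  fix u :: "complex torus_L2"
  obtain f where f: "square_integrable f" "u = to_L2 f" by (rule L2_cases)
  have fm: "f \<in> borel_measurable torus_measure" using f(1) by (simp add: square_integrable_def)
  obtain s where s: "\<And>i. simple_function torus_measure (s i)" "\<And>p. (\<lambda>i. s i p) \<longlonglongrightarrow> f p"
    "\<And>i p. dist (s i p) 0 \<le> 2 * dist (f p) 0"
    using borel_measurable_implies_sequence_metric[OF fm, of 0] by auto
  have V: "to_L2 (s i) \<in> fourier_closure" for i
  proof -
    let ?t = "\<lambda>y p. y * complex_of_real (indicator (s i -` {y}) p)"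
    have sets: "s i -` {y} \<in> sets torus_measure" for y
      using simple_functionD(2)[OF s(1)[of i], of "{y}"] by simp
    have fin: "finite (range (s i))" using simple_functionD(1)[OF s(1)[of i]] by simp
    have "finite Y \<Longrightarrow> square_integrable (\<lambda>p. \<Sum>y\<in>Y. ?t y p) \<and>
       to_L2 (\<lambda>p. \<Sum>y\<in>Y. ?t y p) \<in> fourier_closure" for Y
    proof (induction Y rule: finite_induct)
      case empty
      have "to_L2 (\<lambda>p. complex_of_real (indicator {} p)) \<in> fourier_closure"
        by (rule measurable_set_fourier_closure) simp
      then show ?case by (simp add: square_integrable_zero)
    next
      case (insert y Y)
      have 1: "square_integrable (?t y)"
        by (rule indicator_square_integrable[OF sets])
      have "to_L2 (?t y) =
          L2_scaleC y (to_L2 (\<lambda>p. complex_of_real (indicator (s i -` {y}) p)))"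
        using indicator_square_integrable[OF sets[of y], of 1] by (simp add: to_L2_scaleC)
      then have 2: "to_L2 (?t y) \<in> fourier_closure"
        using fourier_closure_scaleC[OF measurable_set_fourier_closure[OF sets[of y]], of y] by simp
      note IH = insert.IH[THEN conjunct1] insert.IH[THEN conjunct2]
      show ?case
        using insert.hyps square_integrable_add[OF 1 IH(1)] fourier_closure_add[OF 2 IH(2)]
        by (simp add: to_L2_add[OF 1 IH(1)])
    qed
    from this[OF fin] have "to_L2 (\<lambda>p. \<Sum>y\<in>range (s i). ?t y p) \<in> fourier_closure"
      by blast
    moreover have "(\<lambda>p. \<Sum>y\<in>range (s i). ?t y p) = s i"
    proof
      fix p
      have "(\<Sum>y\<in>range (s i). ?t y p) =
          (\<Sum>y\<in>range (s i). if y = s i p then y else 0)"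
        by (rule sum.cong) (auto simp: indicator_def)
      then show "(\<Sum>y\<in>range (s i). ?t y p) = s i p" using fin by simp
    qed
    ultimately show ?thesis by simp
  qed
  have sm: "s i \<in> borel_measurable torus_measure" for i by (rule borel_measurable_simple_function[OF s(1)])
  have g: "square_integrable (\<lambda>p. 2 * norm (f p))"
    using f(1) by (auto simp: square_integrable_def power_mult_distrib)
  have "(\<lambda>i. to_L2 (s i)) \<longlonglongrightarrow> to_L2 f"
    by (rule L2_dominated_convergence(2)[OF fm sm g]) (use s(2,3) in auto)
  then show "u \<in> fourier_closure" unfolding f(2) by (rule fourier_closure_limit[OF V])
qed simp

theorem fourier_orthonormal_basis: "L2_orthonormal_basis (range fourier_L2)"
  unfolding L2_orthonormal_basis_def
proof (intro conjI ballI)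
  fix u v assume "u \<in> range fourier_L2" "v \<in> range fourier_L2"
  then obtain k l where kl: "u = fourier_L2 k" "v = fourier_L2 l" by blast
  have "fourier_L2 k = fourier_L2 l \<longleftrightarrow> k = l" by (metis cinner_fourier_L2 zero_neq_one)
  then show "L2_cinner u v = (if u = v then 1 else 0)" unfolding kl cinner_fourier_L2 by simp
next
  show "closure (L2.span (range fourier_L2)) = UNIV"
    using fourier_closure_UNIV unfolding fourier_closure_def .
qed

lemma inj_fourier_L2: "inj fourier_L2"
proof (rule injI)
  fix k l assume "fourier_L2 k = fourier_L2 l"
  then show "k = l" by (metis cinner_fourier_L2 zero_neq_one)
qed

section \<open>The Sobolev space\<close>

text \<open>The Sobolev inner product of smooth functions is the ambient inner product of their images under
  this map.\<close>
definition H1_embed :: "(torus \<Rightarrow> real) \<Rightarrow> real torus_L2 \<times> real torus_L2 \<times> real torus_L2"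
  where "H1_embed f = (to_L2 f, to_L2 (torus_deriv (1, 0) f), to_L2 (torus_deriv (0, 1) f))"

lemma smooth_square_integrable: "torus_smooth f \<Longrightarrow> square_integrable f"
  by (rule continuous_square_integrable[OF torus_smooth_continuous])

lemma torus_laplacian_eq:
  "torus_laplacian f = (\<lambda>p. torus_deriv (1, 0) (torus_deriv (1, 0) f) p + torus_deriv (0, 1) (torus_deriv (0, 1) f) p)"
  by (rule ext) (simp add: torus_laplacian_def torus_div_def torus_grad_def)

lemma torus_smooth_laplacian: "torus_smooth f \<Longrightarrow> torus_smooth (torus_laplacian f)"
  using torus_smooth_linear[of "torus_deriv (1, 0) (torus_deriv (1, 0) f)" "torus_deriv (0, 1) (torus_deriv (0, 1) f)" 1 1]
  unfolding torus_laplacian_eq by (simp add: torus_smooth_deriv)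

lemma torus_deriv_diff:
  "torus_smooth f \<Longrightarrow> torus_smooth g \<Longrightarrow> torus_deriv v (\<lambda>p. f p - g p) = (\<lambda>p. torus_deriv v f p - torus_deriv v g p)"
  using torus_deriv_linear[of f g v 1 "- 1"] by (simp add: torus_smooth_differentiable)

lemma torus_laplacian_diff:
  "torus_smooth f \<Longrightarrow> torus_smooth g \<Longrightarrow>
    torus_laplacian (\<lambda>p. f p - g p) = (\<lambda>p. torus_laplacian f p - torus_laplacian g p)"
  unfolding torus_laplacian_eq by (rule ext) (simp add: torus_deriv_diff torus_smooth_deriv)

lemma H1_embed_diff:
  "torus_smooth f \<Longrightarrow> torus_smooth g \<Longrightarrow> H1_embed (\<lambda>p. f p - g p) = H1_embed f - H1_embed g"
  unfolding H1_embed_def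
  by (simp add: torus_deriv_diff to_L2_diff smooth_square_integrable torus_smooth_deriv)

lemma inner_to_L2_real:
  "torus_smooth f \<Longrightarrow> torus_smooth g \<Longrightarrow> to_L2 f \<bullet> to_L2 g = (\<integral>p. f p * g p \<partial>torus_measure)"
  by (simp add: inner_to_L2 smooth_square_integrable)

lemma integrable_smooth_mult:
  "torus_smooth f \<Longrightarrow> torus_smooth g \<Longrightarrow> integrable torus_measure (\<lambda>p. f p * g p)"
  using integrable_square_integrable_inner[of f g] by (simp add: smooth_square_integrable)

lemma smooth_H1_inner_eq:
  assumes "torus_smooth f" "torus_smooth g"
  shows "smooth_H1_inner f g = H1_embed f \<bullet> H1_embed g"
proof -
  note d = torus_smooth_deriv[OF assms(1)] torus_smooth_deriv[OF assms(2)]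
  have "(\<integral>p. torus_grad f p \<bullet> torus_grad g p \<partial>torus_measure) =
      (\<integral>p. torus_deriv (1, 0) f p * torus_deriv (1, 0) g p \<partial>torus_measure) +
      (\<integral>p. torus_deriv (0, 1) f p * torus_deriv (0, 1) g p \<partial>torus_measure)"
    unfolding torus_grad_def inner_Pair inner_real_def
    by (rule Bochner_Integration.integral_add) (intro integrable_smooth_mult d)+
  then show ?thesis
    unfolding smooth_H1_inner_def H1_embed_def
    by (simp add: inner_to_L2_real assms d)
qed

lemma smooth_B_eq:
  assumes "torus_smooth f" "torus_smooth g"
  shows "smooth_B f g = to_L2 (torus_laplacian f) \<bullet> to_L2 g"
  unfolding smooth_B_def by (simp add: inner_to_L2_real torus_smooth_laplacian assms)

lemma Green_identity:
  assumes "torus_smooth f" "torus_smooth g"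
  shows "smooth_B f g = to_L2 f \<bullet> to_L2 g - H1_embed f \<bullet> H1_embed g"
proof -
  note d = torus_smooth_deriv[OF assms(1)] torus_smooth_deriv[OF assms(2)]
  note dd = torus_smooth_deriv(1)[OF d(1)] torus_smooth_deriv(2)[OF d(2)]
  have "smooth_B f g = (\<integral>p. torus_deriv (1, 0) (torus_deriv (1, 0) f) p * g p \<partial>torus_measure) +
      (\<integral>p. torus_deriv (0, 1) (torus_deriv (0, 1) f) p * g p \<partial>torus_measure)"
    unfolding smooth_B_def torus_laplacian_eq distrib_right
    by (rule Bochner_Integration.integral_add) (intro integrable_smooth_mult dd assms)+
  also have "\<dots> = - (to_L2 (torus_deriv (1, 0) f) \<bullet> to_L2 (torus_deriv (1, 0) g)) -
      to_L2 (torus_deriv (0, 1) f) \<bullet> to_L2 (torus_deriv (0, 1) g)"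
    using integration_by_parts[OF d(1) assms(2)] integration_by_parts[OF d(2) assms(2)]
    by (simp add: inner_to_L2_real d)
  finally show ?thesis by (simp add: H1_embed_def)
qed

lemma smooth_B_commute: "torus_smooth f \<Longrightarrow> torus_smooth g \<Longrightarrow> smooth_B f g = smooth_B g f"
  by (simp add: Green_identity inner_commute)

lemma H1_represents_iff:
  "H1_represents F u \<longleftrightarrow>
    (\<forall>i. torus_smooth (F i)) \<and> Cauchy (\<lambda>i. H1_embed (F i)) \<and> (\<lambda>i. to_L2 (F i)) \<longlonglongrightarrow> u"
proof (cases "\<forall>i. torus_smooth (F i)")
  case True
  then have "sqrt (smooth_H1_inner (\<lambda>p. F i p - F j p) (\<lambda>p. F i p - F j p)) = dist (H1_embed (F i)) (H1_embed (F j))" for i j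
    by (simp add: smooth_H1_inner_eq torus_smooth_diff H1_embed_diff dist_norm norm_eq_sqrt_inner)
  then show ?thesis unfolding H1_represents_def Cauchy_def by simp
next
  case False
  then show ?thesis unfolding H1_represents_def by blast
qed

lemma Cauchy_norm_bounded:
  fixes X :: "nat \<Rightarrow> 'a::real_normed_vector"
  shows "Cauchy X \<Longrightarrow> \<exists>K>0. \<forall>i. norm (X i) \<le> K"
  using Cauchy_Bseq[of X] unfolding Bseq_def .

lemma Cauchy_dist_le:
  fixes X :: "nat \<Rightarrow> 'a::metric_space" and Y :: "nat \<Rightarrow> 'b::metric_space" and Z :: "nat \<Rightarrow> 'c::metric_space"
  assumes "Cauchy X" "Cauchy Y" "C > 0"
    and le: "\<And>i j. dist (Z i) (Z j) \<le> C * dist (X i) (X j) + C * dist (Y i) (Y j)"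
  shows "Cauchy Z"
proof (rule metric_CauchyI)
  fix e :: real assume "e > 0"
  then have "e / (2 * C) > 0" using assms(3) by simp
  obtain M where M: "\<And>i j. i \<ge> M \<Longrightarrow> j \<ge> M \<Longrightarrow> dist (X i) (X j) < e / (2 * C)"
    using assms(1) \<open>e / (2 * C) > 0\<close> unfolding Cauchy_def by blast
  obtain N where N: "\<And>i j. i \<ge> N \<Longrightarrow> j \<ge> N \<Longrightarrow> dist (Y i) (Y j) < e / (2 * C)"
    using assms(2) \<open>e / (2 * C) > 0\<close> unfolding Cauchy_def by blast
  have "dist (Z i) (Z j) < e" if "i \<ge> max M N" "j \<ge> max M N" for i j
  proof -
    have "C * dist (X i) (X j) + C * dist (Y i) (Y j) < C * (e / (2 * C)) + C * (e / (2 * C))"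
      using M[of i j] N[of i j] that assms(3) by (intro add_strict_mono mult_strict_left_mono) auto
    also have "\<dots> = e" using assms(3) by simp
    finally show ?thesis using le[of i j] by linarith
  qed
  then show "\<exists>M. \<forall>m\<ge>M. \<forall>n\<ge>M. dist (Z m) (Z n) < e" by (intro exI[of _ "max M N"]) blast
qed

lemma Cauchy_diff:
  fixes X Y :: "nat \<Rightarrow> 'a::real_normed_vector"
  assumes "Cauchy X" "Cauchy Y" shows "Cauchy (\<lambda>i. X i - Y i)"
proof (rule Cauchy_dist_le[OF assms, of 1])
  fix i j
  have "norm ((X i - X j) - (Y i - Y j)) \<le> norm (X i - X j) + norm (Y i - Y j)" by (rule norm_triangle_ineq4)
  then show "dist (X i - Y i) (X j - Y j) \<le> 1 * dist (X i) (X j) + 1 * dist (Y i) (Y j)"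
    by (simp add: dist_norm algebra_simps)
qed simp

text \<open>The gradient is closable: pairing \<open>F i\<close> with \<open>F j\<close> moves all derivatives to the fixed function
  \<open>F i\<close>, so the pairing tends to 0 with \<open>j\<close> if the \<open>F j\<close> do in the weaker norm.\<close>

lemma H1_embed_closable:
  assumes "\<And>i. torus_smooth (F i)" "Cauchy (\<lambda>i. H1_embed (F i))" "(\<lambda>i. to_L2 (F i)) \<longlonglongrightarrow> 0"
  shows "(\<lambda>i. H1_embed (F i)) \<longlonglongrightarrow> 0"
proof -
  let ?J = "\<lambda>i. H1_embed (F i)"
  obtain K where K: "K > 0" "\<And>i. norm (?J i) \<le> K" using Cauchy_norm_bounded[OF assms(2)] by blast
  have pair: "(\<lambda>j. ?J i \<bullet> ?J j) \<longlonglongrightarrow> 0" for i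
  proof -
    have "?J i \<bullet> ?J j = to_L2 (F i) \<bullet> to_L2 (F j) - to_L2 (torus_laplacian (F i)) \<bullet> to_L2 (F j)" for j
      using Green_identity[OF assms(1)[of i] assms(1)[of j]] smooth_B_eq[OF assms(1)[of i] assms(1)[of j]] by simp
    moreover have "(\<lambda>j. to_L2 (F i) \<bullet> to_L2 (F j) - to_L2 (torus_laplacian (F i)) \<bullet> to_L2 (F j)) \<longlonglongrightarrow>
        to_L2 (F i) \<bullet> 0 - to_L2 (torus_laplacian (F i)) \<bullet> 0"
      by (intro tendsto_diff tendsto_inner tendsto_const assms(3))
    ultimately show ?thesis by simp
  qed
  show ?thesis
  proof (rule LIMSEQ_I)
    fix r :: real assume "r > 0"
    \<comment> \<open>chosen so that \<open>K * d < r\<^sup>2\<close>\<close>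
    define d where "d = r\<^sup>2 / (2 * K)"
    have "d > 0" using \<open>r > 0\<close> K(1) by (simp add: d_def)
    then obtain N where N: "\<And>i j. i \<ge> N \<Longrightarrow> j \<ge> N \<Longrightarrow> norm (?J i - ?J j) < d"
      using assms(2) unfolding Cauchy_def dist_norm by blast
    have "norm (?J i) < r" if "i \<ge> N" for i
    proof -
      have "(norm (?J i))\<^sup>2 - K * d \<le> 0"
      proof (rule LIMSEQ_le_const[OF pair[of i]], intro exI allI impI)
        fix j assume "j \<ge> N"
        have "(norm (?J i))\<^sup>2 = ?J i \<bullet> (?J i - ?J j) + ?J i \<bullet> ?J j"
          by (simp add: inner_diff_right dot_square_norm)
        also have "?J i \<bullet> (?J i - ?J j) \<le> norm (?J i) * norm (?J i - ?J j)" by (rule norm_cauchy_schwarz)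
        also have "\<dots> \<le> K * d" using K N[OF that \<open>j \<ge> N\<close>] by (intro mult_mono) auto
        finally show "(norm (?J i))\<^sup>2 - K * d \<le> ?J i \<bullet> ?J j" by simp
      qed
      also have "K * d = r\<^sup>2 / 2" using K(1) by (simp add: d_def)
      finally have "(norm (?J i))\<^sup>2 < r\<^sup>2" using \<open>r > 0\<close> by (smt (verit) zero_less_power half_gt_zero_iff field_sum_of_halves)
      then show ?thesis using \<open>r > 0\<close> by (simp add: power2_less_imp_less)
    qed
    then show "\<exists>N. \<forall>i\<ge>N. norm (?J i - 0) < r" by (intro exI[of _ N]) simp
  qed
qed

lemma H1_represents_unique:
  assumes "H1_represents F u" "H1_represents F' u"
  shows "(\<lambda>i. H1_embed (F i) - H1_embed (F' i)) \<longlonglongrightarrow> 0"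
proof -
  have s: "torus_smooth (F i)" "torus_smooth (F' i)" for i using assms by (auto simp: H1_represents_iff)
  have "(\<lambda>i. H1_embed (\<lambda>p. F i p - F' i p)) \<longlonglongrightarrow> 0"
  proof (rule H1_embed_closable)
    have "Cauchy (\<lambda>i. H1_embed (F i) - H1_embed (F' i))"
      using assms by (intro Cauchy_diff) (auto simp: H1_represents_iff)
    then show "Cauchy (\<lambda>i. H1_embed (\<lambda>p. F i p - F' i p))" by (simp add: H1_embed_diff s)
    have "(\<lambda>i. to_L2 (F i) - to_L2 (F' i)) \<longlonglongrightarrow> u - u"
      using assms by (intro tendsto_diff) (auto simp: H1_represents_iff)
    then show "(\<lambda>i. to_L2 (\<lambda>p. F i p - F' i p)) \<longlonglongrightarrow> 0"
      by (simp add: to_L2_diff s smooth_square_integrable)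
  qed (intro torus_smooth_diff s)
  then show ?thesis by (simp add: H1_embed_diff s)
qed

lemma Cauchy_inner_convergent:
  fixes X Y :: "nat \<Rightarrow> 'a::real_inner"
  assumes "Cauchy X" "Cauchy Y" shows "convergent (\<lambda>i. X i \<bullet> Y i)"
proof -
  obtain K where K: "K > 0" "\<And>i. norm (X i) \<le> K" using Cauchy_norm_bounded[OF assms(1)] by blast
  obtain L where L: "L > 0" "\<And>i. norm (Y i) \<le> L" using Cauchy_norm_bounded[OF assms(2)] by blast
  have "Cauchy (\<lambda>i. X i \<bullet> Y i)"
  proof (rule Cauchy_dist_le[OF assms, of "max K L"])
    fix i j
    have "X i \<bullet> Y i - X j \<bullet> Y j = (X i - X j) \<bullet> Y i + X j \<bullet> (Y i - Y j)" by (simp add: inner_simps)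
    then have "\<bar>X i \<bullet> Y i - X j \<bullet> Y j\<bar> \<le> \<bar>(X i - X j) \<bullet> Y i\<bar> + \<bar>X j \<bullet> (Y i - Y j)\<bar>" by simp
    also have "\<dots> \<le> norm (X i - X j) * norm (Y i) + norm (X j) * norm (Y i - Y j)"
      by (intro add_mono Cauchy_Schwarz_ineq2)
    also have "\<dots> \<le> norm (X i - X j) * max K L + max K L * norm (Y i - Y j)"
      using K(2)[of j] L(2)[of i] by (intro add_mono mult_left_mono mult_right_mono) auto
    finally show "dist (X i \<bullet> Y i) (X j \<bullet> Y j) \<le> max K L * dist (X i) (X j) + max K L * dist (Y i) (Y j)"
      by (simp add: dist_real_def dist_norm mult.commute)
  qed (use K(1) in auto)
  then show ?thesis by (simp add: Cauchy_convergent_iff)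
qed

lemma tendsto_inner_bounded_null:
  fixes X Y :: "nat \<Rightarrow> 'a::real_inner"
  assumes "Cauchy X" "Y \<longlonglongrightarrow> 0" shows "(\<lambda>i. X i \<bullet> Y i) \<longlonglongrightarrow> 0" "(\<lambda>i. Y i \<bullet> X i) \<longlonglongrightarrow> 0"
proof -
  obtain K where K: "K > 0" "\<And>i. norm (X i) \<le> K" using Cauchy_norm_bounded[OF assms(1)] by blast
  show "(\<lambda>i. X i \<bullet> Y i) \<longlonglongrightarrow> 0"
  proof (rule Lim_null_comparison)
    show "\<forall>\<^sub>F i in sequentially. norm (X i \<bullet> Y i) \<le> K * norm (Y i)"
    proof (intro always_eventually allI)
      fix i
      have "norm (X i \<bullet> Y i) \<le> norm (X i) * norm (Y i)" using Cauchy_Schwarz_ineq2 by simp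
      also have "\<dots> \<le> K * norm (Y i)" by (intro mult_right_mono K) simp
      finally show "norm (X i \<bullet> Y i) \<le> K * norm (Y i)" .
    qed
    show "(\<lambda>i. K * norm (Y i)) \<longlonglongrightarrow> 0"
      using tendsto_mult_left[OF tendsto_norm_zero[OF assms(2)], of K] by simp
  qed
  then show "(\<lambda>i. Y i \<bullet> X i) \<longlonglongrightarrow> 0" by (simp add: inner_commute)
qed

text \<open>Two sequences that represent the same element have images under the embedding that differ by a null
  sequence, so the limit does not depend on the choice of the sequences.\<close>

lemma H1_inner_limit:
  assumes "H1_represents F u" "H1_represents G v"
  shows "(\<lambda>i. smooth_H1_inner (F i) (G i)) \<longlonglongrightarrow> H1_inner u v"
proof -
  let ?J = "\<lambda>F i. H1_embed (F i)"
  have eq: "smooth_H1_inner (F i) (G i) = ?J F i \<bullet> ?J G i" if "H1_represents F u" "H1_represents G v" for F G i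
    using that by (intro smooth_H1_inner_eq) (auto simp: H1_represents_iff)
  have cau: "Cauchy (?J F)" if "H1_represents F u" for F u using that by (simp add: H1_represents_iff)
  obtain c where c: "(\<lambda>i. ?J F i \<bullet> ?J G i) \<longlonglongrightarrow> c"
    using Cauchy_inner_convergent[OF cau[OF assms(1)] cau[OF assms(2)]] unfolding convergent_def by blast
  have all: "(\<lambda>i. smooth_H1_inner (F' i) (G' i)) \<longlonglongrightarrow> c" if r: "H1_represents F' u" "H1_represents G' v" for F' G'
  proof -
    have "(\<lambda>i. ?J F i \<bullet> ?J G i + (?J F' i - ?J F i) \<bullet> ?J G i + ?J F' i \<bullet> (?J G' i - ?J G i)) \<longlonglongrightarrow> c + 0 + 0"
      by (intro tendsto_add c tendsto_inner_bounded_null cau[OF assms(2)] cau[OF r(1)]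
          H1_represents_unique[OF r(1) assms(1)] H1_represents_unique[OF r(2) assms(2)])
    moreover have "?J F i \<bullet> ?J G i + (?J F' i - ?J F i) \<bullet> ?J G i + ?J F' i \<bullet> (?J G' i - ?J G i) = smooth_H1_inner (F' i) (G' i)" for i
      unfolding eq[OF r] by (simp add: inner_simps)
    ultimately show ?thesis by simp
  qed
  have "H1_inner u v = c"
    unfolding H1_inner_def
  proof (rule the_equality)
    fix d assume "\<forall>F G. H1_represents F u \<longrightarrow> H1_represents G v \<longrightarrow> (\<lambda>i. smooth_H1_inner (F i) (G i)) \<longlonglongrightarrow> d"
    then show "d = c" using all[OF assms] assms LIMSEQ_unique by blast
  qed (use all in blast)
  then show ?thesis using all[OF assms] by simp
qed

lemma H1_B_limit:
  assumes "H1_represents F u" "H1_represents G v"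
  shows "(\<lambda>i. smooth_B (F i) (G i)) \<longlonglongrightarrow> H1_B u v"
proof -
  have all: "(\<lambda>i. smooth_B (F i) (G i)) \<longlonglongrightarrow> u \<bullet> v - H1_inner u v"
    if r: "H1_represents F u" "H1_represents G v" for F G
  proof -
    have s: "torus_smooth (F i)" "torus_smooth (G i)" for i using r by (auto simp: H1_represents_iff)
    have "(\<lambda>i. to_L2 (F i) \<bullet> to_L2 (G i) - smooth_H1_inner (F i) (G i)) \<longlonglongrightarrow> u \<bullet> v - H1_inner u v"
      using r by (intro tendsto_diff tendsto_inner H1_inner_limit) (auto simp: H1_represents_iff)
    then show ?thesis by (simp add: Green_identity[OF s] smooth_H1_inner_eq[OF s])
  qed
  have "H1_B u v = u \<bullet> v - H1_inner u v"
    unfolding H1_B_def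
  proof (rule the_equality)
    fix d assume "\<forall>F G. H1_represents F u \<longrightarrow> H1_represents G v \<longrightarrow> (\<lambda>i. smooth_B (F i) (G i)) \<longlonglongrightarrow> d"
    then show "d = u \<bullet> v - H1_inner u v" using all[OF assms] assms LIMSEQ_unique by blast
  qed (use all in blast)
  then show ?thesis using all[OF assms] by simp
qed

lemma H1_represents_smooth: "torus_smooth f \<Longrightarrow> H1_represents (\<lambda>i. f) (to_L2 f)"
  by (simp add: H1_represents_iff Cauchy_def)

text \<open>A smooth function is represented by a constant sequence; integration by parts then moves all
  derivatives to it.\<close>

lemma H1_pairing_smooth:
  assumes "u \<in> H1" "torus_smooth g"
  shows "H1_B u (to_L2 g) = u \<bullet> to_L2 (torus_laplacian g)" "H1_B (to_L2 g) u = to_L2 (torus_laplacian g) \<bullet> u"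
    and "H1_inner u (to_L2 g) = u \<bullet> to_L2 g - u \<bullet> to_L2 (torus_laplacian g)"
proof -
  obtain F where F: "H1_represents F u" using assms(1) by (auto simp: H1_def)
  have s: "torus_smooth (F i)" for i using F by (auto simp: H1_represents_iff)
  have lim: "(\<lambda>i. to_L2 (F i)) \<longlonglongrightarrow> u" using F by (auto simp: H1_represents_iff)
  have B: "smooth_B (F i) g = to_L2 (F i) \<bullet> to_L2 (torus_laplacian g)" for i
    using smooth_B_commute[OF s assms(2)] smooth_B_eq[OF assms(2) s] by (simp add: inner_commute)
  have 1: "(\<lambda>i. smooth_B (F i) g) \<longlonglongrightarrow> u \<bullet> to_L2 (torus_laplacian g)"
    unfolding B by (intro tendsto_inner lim tendsto_const)
  then show "H1_B u (to_L2 g) = u \<bullet> to_L2 (torus_laplacian g)"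
    using H1_B_limit[OF F H1_represents_smooth[OF assms(2)]] LIMSEQ_unique by blast
  have "(\<lambda>i. smooth_B g (F i)) \<longlonglongrightarrow> u \<bullet> to_L2 (torus_laplacian g)"
    using 1 by (simp add: smooth_B_commute[OF s assms(2)])
  then show "H1_B (to_L2 g) u = to_L2 (torus_laplacian g) \<bullet> u"
    using H1_B_limit[OF H1_represents_smooth[OF assms(2)] F] LIMSEQ_unique by (metis inner_commute)
  have "(\<lambda>i. to_L2 (F i) \<bullet> to_L2 g - smooth_B (F i) g) \<longlonglongrightarrow> u \<bullet> to_L2 g - u \<bullet> to_L2 (torus_laplacian g)"
    by (intro tendsto_diff 1 tendsto_inner lim tendsto_const)
  then have "(\<lambda>i. smooth_H1_inner (F i) g) \<longlonglongrightarrow> u \<bullet> to_L2 g - u \<bullet> to_L2 (torus_laplacian g)"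
    by (simp add: Green_identity[OF s assms(2)] smooth_H1_inner_eq[OF s assms(2)])
  then show "H1_inner u (to_L2 g) = u \<bullet> to_L2 g - u \<bullet> to_L2 (torus_laplacian g)"
    using H1_inner_limit[OF F H1_represents_smooth[OF assms(2)]] LIMSEQ_unique by blast
qed

text \<open>By Green's identity the Sobolev norm of a smooth function is at most the sum of the norms of the
  function and of its Laplacian.\<close>

lemma H1I_laplacian_convergent:
  assumes "\<And>i. torus_smooth (F i)" "(\<lambda>i. to_L2 (F i)) \<longlonglongrightarrow> u" "(\<lambda>i. to_L2 (torus_laplacian (F i))) \<longlonglongrightarrow> h"
  shows "H1_represents F u"
proof -
  have le: "norm (H1_embed f) \<le> norm (to_L2 f) + norm (to_L2 (torus_laplacian f))" if f: "torus_smooth f" for f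
  proof (rule power2_le_imp_le)
    have "(norm (H1_embed f))\<^sup>2 = (norm (to_L2 f))\<^sup>2 - to_L2 (torus_laplacian f) \<bullet> to_L2 f"
      using Green_identity[OF f f] smooth_B_eq[OF f f] by (simp add: dot_square_norm)
    also have "\<dots> \<le> (norm (to_L2 f))\<^sup>2 + norm (to_L2 (torus_laplacian f)) * norm (to_L2 f)"
      using Cauchy_Schwarz_ineq2[of "to_L2 (torus_laplacian f)" "to_L2 f"] by linarith
    also have "\<dots> \<le> (norm (to_L2 f) + norm (to_L2 (torus_laplacian f)))\<^sup>2"
      by (simp add: power2_sum mult.commute)
    finally show "(norm (H1_embed f))\<^sup>2 \<le> (norm (to_L2 f) + norm (to_L2 (torus_laplacian f)))\<^sup>2" .
  qed simp
  have sl: "torus_smooth (torus_laplacian (F i))" for i by (rule torus_smooth_laplacian[OF assms(1)])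
  have "Cauchy (\<lambda>i. H1_embed (F i))"
  proof (rule Cauchy_dist_le[OF LIMSEQ_imp_Cauchy[OF assms(2)] LIMSEQ_imp_Cauchy[OF assms(3)], of 1])
    fix i j
    have "dist (H1_embed (F i)) (H1_embed (F j)) = norm (H1_embed (\<lambda>p. F i p - F j p))"
      by (simp add: dist_norm H1_embed_diff assms(1))
    also have "\<dots> \<le> norm (to_L2 (F i) - to_L2 (F j)) + norm (to_L2 (torus_laplacian (F i)) - to_L2 (torus_laplacian (F j)))"
      using le[OF torus_smooth_diff[OF assms(1)[of i] assms(1)[of j]]]
      by (simp add: torus_laplacian_diff to_L2_diff assms(1) sl smooth_square_integrable)
    finally show "dist (H1_embed (F i)) (H1_embed (F j)) \<le>
        1 * dist (to_L2 (F i)) (to_L2 (F j)) + 1 * dist (to_L2 (torus_laplacian (F i))) (to_L2 (torus_laplacian (F j)))"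
      by (simp add: dist_norm)
  qed simp
  then show ?thesis using assms by (simp add: H1_represents_iff)
qed

section \<open>The inverse Laplace operator in Fourier coordinates\<close>

definition norm_sq :: "int \<times> int \<Rightarrow> real"
  where "norm_sq k = of_int ((fst k)\<^sup>2 + (snd k)\<^sup>2)"

definition cos_L2 :: "int \<times> int \<Rightarrow> real torus_L2"
  where "cos_L2 k = to_L2 (real_wave 1 0 k)"

definition sin_L2 :: "int \<times> int \<Rightarrow> real torus_L2"
  where "sin_L2 k = to_L2 (real_wave 0 1 k)"

lemma norm_sq_pos: "k \<noteq> 0 \<Longrightarrow> norm_sq k > 0"
  by (cases k) (simp add: norm_sq_def sum_power2_gt_zero_iff zero_prod_def del: of_int_add of_int_power)

lemma norm_sq_zero [simp]: "norm_sq 0 = 0"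
  by (simp add: norm_sq_def)

lemma torus_laplacian_real_wave: "torus_laplacian (real_wave A B k) = (\<lambda>p. - norm_sq k * real_wave A B k p)"
  unfolding torus_laplacian_eq torus_deriv_real_wave
  by (rule ext) (simp add: real_wave_def angle_def norm_sq_def power2_eq_square algebra_simps)

lemma square_integrable_real_wave: "square_integrable (real_wave A B k)"
  by (rule smooth_square_integrable[OF torus_smooth_real_wave])

lemma to_L2_real_wave: "to_L2 (real_wave A B k) = A *\<^sub>R cos_L2 k + B *\<^sub>R sin_L2 k"
proof -
  have "square_integrable (\<lambda>p. A *\<^sub>R real_wave 1 0 k p)" "square_integrable (\<lambda>p. B *\<^sub>R real_wave 0 1 k p)"
    by (intro square_integrable_bounded_linear[OF square_integrable_real_wave bounded_linear_scaleR_right])+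
  then show ?thesis
    by (simp add: cos_L2_def sin_L2_def to_L2_scaleR square_integrable_real_wave to_L2_add)
       (simp add: real_wave_def[abs_def])
qed

lemma to_L2_laplacian_real_wave: "to_L2 (torus_laplacian (real_wave A B k)) = - norm_sq k *\<^sub>R to_L2 (real_wave A B k)"
  unfolding torus_laplacian_real_wave using to_L2_scaleR[OF square_integrable_real_wave, of "- norm_sq k" A B k] by simp

lemma cinner_fourier:
  "L2_cinner (fourier_L2 k) f =
    Complex (L2_Re f \<bullet> cos_L2 k + L2_Im f \<bullet> sin_L2 k) (L2_Im f \<bullet> cos_L2 k - L2_Re f \<bullet> sin_L2 k) / (2 * pi)"
proof -
  obtain g where g: "square_integrable g" "f = to_L2 g" by (rule L2_cases)
  have Re: "square_integrable (\<lambda>p. Re (g p))" and Im: "square_integrable (\<lambda>p. Im (g p))"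
    using g(1) by (auto intro: square_integrable_bounded_linear bounded_linear_Re bounded_linear_Im)
  let ?c = "real_wave 1 0 k" and ?s = "real_wave 0 1 k"
  let ?X = "\<lambda>p. Re (g p) * ?c p + Im (g p) * ?s p" and ?Y = "\<lambda>p. Im (g p) * ?c p - Re (g p) * ?s p"
  let ?A = "(\<integral>p. Re (g p) * ?c p \<partial>torus_measure) + (\<integral>p. Im (g p) * ?s p \<partial>torus_measure)"
  let ?B = "(\<integral>p. Im (g p) * ?c p \<partial>torus_measure) - (\<integral>p. Re (g p) * ?s p \<partial>torus_measure)"
  have int: "integrable torus_measure (\<lambda>p. Re (g p) * ?c p)" "integrable torus_measure (\<lambda>p. Im (g p) * ?s p)"
    "integrable torus_measure (\<lambda>p. Im (g p) * ?c p)" "integrable torus_measure (\<lambda>p. Re (g p) * ?s p)"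
    using integrable_square_integrable_inner[OF Re square_integrable_real_wave]
      integrable_square_integrable_inner[OF Im square_integrable_real_wave] by simp_all
  have "cnj (fourier k p) * g p = (complex_of_real (?X p) + \<i> * complex_of_real (?Y p)) / (2 * pi)" for p
    unfolding fourier_eq by (simp add: complex_eq_iff)
  then have "L2_cinner (fourier_L2 k) f = (\<integral>p. (complex_of_real (?X p) + \<i> * complex_of_real (?Y p)) / (2 * pi) \<partial>torus_measure)"
    by (simp add: fourier_L2_def g(2) cinner_to_L2[OF square_integrable_fourier g(1)])
  also have "\<dots> = (complex_of_real ?A + \<i> * complex_of_real ?B) / (2 * pi)"
  proof -
    have 1: "(\<integral>p. complex_of_real (?X p) \<partial>torus_measure) = complex_of_real ?A"
      unfolding integral_complex_of_real using int by simp
    have 2: "(\<integral>p. complex_of_real (?Y p) \<partial>torus_measure) = complex_of_real ?B"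
      unfolding integral_complex_of_real using int by simp
    have i: "integrable torus_measure (\<lambda>p. complex_of_real (?X p))"
      by (intro integrable_of_real Bochner_Integration.integrable_add int)
    have i': "integrable torus_measure (\<lambda>p. \<i> * complex_of_real (?Y p))"
      by (intro integrable_mult_right integrable_of_real Bochner_Integration.integrable_diff int)
    show ?thesis
      unfolding integral_divide_zero Bochner_Integration.integral_add[OF i i'] integral_mult_right_zero 1 2 ..
  qed
  finally show ?thesis
    unfolding g(2) L2_Re_to_L2[OF g(1)] L2_Im_to_L2[OF g(1)] cos_L2_def sin_L2_def
    by (simp add: inner_to_L2 Re Im square_integrable_real_wave Complex_eq)
qed

lemma L2_Re_Complex [simp]: "L2_Re (L2_Complex u v) = u"
  and L2_Im_Complex [simp]: "L2_Im (L2_Complex u v) = v"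
proof -
  obtain f g where fg: "square_integrable f" "u = to_L2 f" "square_integrable g" "v = to_L2 g" by (metis L2_cases)
  have eq: "L2_Complex u v = to_L2 (\<lambda>p. Complex (f p) (g p))" using fg by (simp add: L2_Complex.abs_eq)
  have "(\<lambda>p. Complex (f p) (g p)) = (\<lambda>p. complex_of_real (f p) + \<i> * complex_of_real (g p))"
    by (simp add: Complex_eq)
  moreover have "square_integrable (\<lambda>p. complex_of_real (f p))"
    by (rule square_integrable_bounded_linear[OF fg(1) bounded_linear_of_real])
  moreover have "square_integrable (\<lambda>p. \<i> * complex_of_real (g p))"
    by (rule square_integrable_mult_left[OF square_integrable_bounded_linear[OF fg(3) bounded_linear_of_real]])
  ultimately have "square_integrable (\<lambda>p. Complex (f p) (g p))"
    by (simp only: square_integrable_add)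
  then show "L2_Re (L2_Complex u v) = u" "L2_Im (L2_Complex u v) = v"
    unfolding eq by (simp_all add: L2_Re_to_L2 L2_Im_to_L2 fg)
qed

lemma L2_Re_add: "L2_Re (u + v) = L2_Re u + L2_Re v"
proof -
  obtain f g where fg: "square_integrable f" "u = to_L2 f" "square_integrable g" "v = to_L2 g" by (metis L2_cases)
  have "square_integrable (\<lambda>p. Re (f p))" "square_integrable (\<lambda>p. Re (g p))"
    using fg by (auto intro: square_integrable_bounded_linear bounded_linear_Re)
  then show ?thesis
    unfolding fg by (simp add: to_L2_add fg L2_Re_to_L2 square_integrable_add)
qed

lemma bounded_linear_L2_Re: "bounded_linear L2_Re"
proof (rule bounded_linear_intro[where K = 1])
  show "L2_Re (r *\<^sub>R u) = r *\<^sub>R L2_Re u" for r u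
  proof -
    obtain f where f: "square_integrable f" "u = to_L2 f" by (rule L2_cases)
    have "square_integrable (\<lambda>p. Re (f p))" "square_integrable (\<lambda>p. r *\<^sub>R f p)"
      using f by (auto intro: square_integrable_bounded_linear bounded_linear_Re bounded_linear_scaleR_right)
    then show ?thesis unfolding f(2) by (simp add: to_L2_scaleR f L2_Re_to_L2)
  qed
  show "norm (L2_Re u) \<le> norm u * 1" for u
  proof -
    obtain f where f: "square_integrable f" "u = to_L2 f" by (rule L2_cases)
    have r: "square_integrable (\<lambda>p. Re (f p))" using f by (auto intro: square_integrable_bounded_linear bounded_linear_Re)
    have "(norm (L2_Re u))\<^sup>2 \<le> (norm u)\<^sup>2"
      unfolding f(2) L2_Re_to_L2[OF f(1)] norm_to_L2[OF f(1)] norm_to_L2[OF r]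
    proof (rule integral_mono)
      show "(norm (Re (f p)))\<^sup>2 \<le> (norm (f p))\<^sup>2" for p
        using power_mono[OF abs_Re_le_cmod abs_ge_zero, of "f p" 2] by simp
      show "integrable torus_measure (\<lambda>p. (norm (Re (f p)))\<^sup>2)" "integrable torus_measure (\<lambda>p. (norm (f p))\<^sup>2)"
        using f r unfolding square_integrable_def by blast+
    qed
    then have "norm (L2_Re u) \<le> norm u" by (rule power2_le_imp_le) simp
    then show ?thesis by simp
  qed
qed (rule L2_Re_add)

lemma L2_eqI_fourier: "(\<And>k. L2_cinner (fourier_L2 k) u = L2_cinner (fourier_L2 k) v) \<Longrightarrow> u = v"
  using orthonormal_basis_eqI[OF fourier_orthonormal_basis] by blast

lemma L2_Complex_inject: "L2_Complex u v = L2_Complex u' v' \<longleftrightarrow> u = u' \<and> v = v'"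
  by (metis L2_Re_Complex L2_Im_Complex)

lemma real_L2_eqI:
  assumes "\<And>k. u \<bullet> cos_L2 k = v \<bullet> cos_L2 k" "\<And>k. u \<bullet> sin_L2 k = v \<bullet> sin_L2 k"
  shows "u = v"
proof -
  have "L2_Complex u 0 = L2_Complex v 0"
    by (rule L2_eqI_fourier) (simp add: cinner_fourier assms)
  then show ?thesis by (simp add: L2_Complex_inject)
qed

lemma sin_L2_zero: "sin_L2 0 = 0"
proof -
  have "sin_L2 0 = to_L2 (\<lambda>p. 0)" by (simp add: sin_L2_def real_wave_def[abs_def] angle_def)
  then show ?thesis by (simp add: zero_torus_L2_def)
qed

lemma cos_L2_zero: "cos_L2 0 = to_L2 (\<lambda>p. 1)"
  by (simp add: cos_L2_def real_wave_def[abs_def] angle_def)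

lemma cos_L2_zero_inner: "cos_L2 0 \<bullet> to_L2 (real_wave A B k) = (if k = 0 then (2 * pi)\<^sup>2 * A else 0)"
proof (cases "k = 0")
  case True
  then have "real_wave A B k = (\<lambda>p. A)" by (auto simp: real_wave_def angle_def)
  then show ?thesis using True
    by (simp add: cos_L2_zero inner_to_L2 square_integrable_const measure_torus)
next
  case False
  then show ?thesis
    by (simp add: cos_L2_zero inner_to_L2 square_integrable_const square_integrable_real_wave integral_real_wave)
qed

text \<open>The real part of the Fourier expansion of \<open>h\<close>.\<close>

lemma real_L2_expansion:
  "((\<lambda>k. to_L2 (real_wave (h \<bullet> cos_L2 k / (2 * pi)\<^sup>2) (h \<bullet> sin_L2 k / (2 * pi)\<^sup>2) k)) has_sum h) UNIV"
proof -
  let ?F = "\<lambda>k. L2_scaleC (L2_cinner (fourier_L2 k) (L2_Complex h 0)) (fourier_L2 k)"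
  have "((\<lambda>u. L2_scaleC (L2_cinner u (L2_Complex h 0)) u) has_sum L2_Complex h 0) (range fourier_L2)"
    by (rule orthonormal_basis_expansion[OF fourier_orthonormal_basis])
  then have "((\<lambda>k. ?F k) has_sum L2_Complex h 0) UNIV"
    by (subst (asm) has_sum_reindex[OF inj_fourier_L2]) (simp add: comp_def)
  from has_sum_bounded_linear[OF bounded_linear_L2_Re this]
  have "((\<lambda>k. L2_Re (?F k)) has_sum h) UNIV"
    by (simp add: comp_def)
  moreover have "L2_Re (?F k) =
      to_L2 (real_wave (h \<bullet> cos_L2 k / (2 * pi)\<^sup>2) (h \<bullet> sin_L2 k / (2 * pi)\<^sup>2) k)" for k
  proof -
    define a b where "a = h \<bullet> cos_L2 k" and "b = h \<bullet> sin_L2 k"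
    have "L2_cinner (fourier_L2 k) (L2_Complex h 0) = Complex a (- b) / (2 * pi)"
      by (simp add: cinner_fourier a_def b_def)
    then have "L2_Re (?F k) =
        L2_Re (L2_scaleC (Complex a (- b) / (2 * pi)) (to_L2 (fourier k)))"
      by (simp only: fourier_L2_def)
    also have "\<dots> = to_L2 (\<lambda>p. Re (Complex a (- b) / (2 * pi) * fourier k p))"
      unfolding to_L2_scaleC[OF square_integrable_fourier]
      by (rule L2_Re_to_L2[OF square_integrable_mult_left[OF square_integrable_fourier]])
    also have "(\<lambda>p. Re (Complex a (- b) / (2 * pi) * fourier k p)) = real_wave (a / (2 * pi)\<^sup>2) (b / (2 * pi)\<^sup>2) k"
    proof
      fix p
      have "Complex a (- b) / (2 * pi) * (cis t / (2 * pi)) = Complex a (- b) * cis t / complex_of_real ((2 * pi)\<^sup>2)" for t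
        by (simp add: power2_eq_square)
      then show "Re (Complex a (- b) / (2 * pi) * fourier k p) = real_wave (a / (2 * pi)\<^sup>2) (b / (2 * pi)\<^sup>2) k p"
        unfolding fourier_def real_wave_def by (simp only: Re_divide_of_real) (simp add: add_divide_distrib)
    qed
    finally show ?thesis unfolding a_def b_def .
  qed
  ultimately show ?thesis by (simp only:)
qed

lemma sq_sum_cos_sin_summable:
  "(\<lambda>k. (h \<bullet> cos_L2 k)\<^sup>2 + (h \<bullet> sin_L2 k)\<^sup>2) summable_on UNIV"
proof -
  let ?q = "\<lambda>k. (cmod (L2_cinner (fourier_L2 k) (L2_Complex h 0)))\<^sup>2"
  have "((\<lambda>u. (cmod (L2_cinner u (L2_Complex h 0)))\<^sup>2) has_sum (norm (L2_Complex h 0))\<^sup>2) (range fourier_L2)"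
    by (rule Parseval_norm[OF fourier_orthonormal_basis])
  then have "((\<lambda>k. ?q k) has_sum (norm (L2_Complex h 0))\<^sup>2) UNIV"
    by (subst (asm) has_sum_reindex[OF inj_fourier_L2]) (simp add: comp_def)
  then have "((\<lambda>k. (2 * pi)\<^sup>2 * ?q k) has_sum (2 * pi)\<^sup>2 * (norm (L2_Complex h 0))\<^sup>2) UNIV"
    by (rule has_sum_cmult_right)
  moreover have "(2 * pi)\<^sup>2 * ?q k = (h \<bullet> cos_L2 k)\<^sup>2 + (h \<bullet> sin_L2 k)\<^sup>2" for k
    by (simp add: cinner_fourier norm_divide power_divide cmod_power2)
  ultimately show ?thesis by (simp add: has_sum_imp_summable)
qed

lemma norm_sq_summable:
  assumes "n \<ge> 2"
  shows "((\<lambda>k. 1 / norm_sq k ^ n) has_sum 4 * zeta_nat n * beta_nat n) (- {0})"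
  using square_lattice_zeta[OF assms] by (simp add: norm_sq_def split_beta' zero_prod_def)

text \<open>Both factors, the coefficients of \<open>h\<close> and \<open>1 / norm_sq k\<close>, are square-summable: the former by
  Parseval, the latter by the lattice sum.\<close>

lemma inverse_laplace_majorant_summable:
  "(\<lambda>k. (\<bar>h \<bullet> cos_L2 k\<bar> + \<bar>h \<bullet> sin_L2 k\<bar>) / norm_sq k) summable_on (- {0})"
proof -
  have "(\<lambda>k. 1 / norm_sq k ^ 2 + ((h \<bullet> cos_L2 k)\<^sup>2 + (h \<bullet> sin_L2 k)\<^sup>2)) summable_on (- {0})"
    by (intro summable_on_add has_sum_imp_summable[OF norm_sq_summable[of 2]]
        summable_on_subset_banach[OF sq_sum_cos_sin_summable]) auto
  then show ?thesis
  proof (rule summable_on_comparison_test)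
    fix k :: "int \<times> int" assume "k \<in> - {0}"
    then have pos: "norm_sq k > 0" by (simp add: norm_sq_pos)
    then show "(\<bar>h \<bullet> cos_L2 k\<bar> + \<bar>h \<bullet> sin_L2 k\<bar>) / norm_sq k \<ge> 0" by simp
    have am: "a * (b + c) \<le> a\<^sup>2 + (b\<^sup>2 + c\<^sup>2)" for a b c :: real
    proof -
      have "a\<^sup>2 + (b\<^sup>2 + c\<^sup>2) - a * (b + c) = (a / 2 - b)\<^sup>2 + (a / 2 - c)\<^sup>2 + a\<^sup>2 / 2"
        by (simp add: power2_eq_square field_simps)
      also have "\<dots> \<ge> 0" by (intro add_nonneg_nonneg) simp_all
      finally show ?thesis by simp
    qed
    have "(\<bar>h \<bullet> cos_L2 k\<bar> + \<bar>h \<bullet> sin_L2 k\<bar>) / norm_sq k = (1 / norm_sq k) * (\<bar>h \<bullet> cos_L2 k\<bar> + \<bar>h \<bullet> sin_L2 k\<bar>)" by simp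
    also have "\<dots> \<le> (1 / norm_sq k)\<^sup>2 + (\<bar>h \<bullet> cos_L2 k\<bar>\<^sup>2 + \<bar>h \<bullet> sin_L2 k\<bar>\<^sup>2)" by (rule am)
    finally show "(\<bar>h \<bullet> cos_L2 k\<bar> + \<bar>h \<bullet> sin_L2 k\<bar>) / norm_sq k \<le>
        1 / norm_sq k ^ 2 + ((h \<bullet> cos_L2 k)\<^sup>2 + (h \<bullet> sin_L2 k)\<^sup>2)"
      by (simp add: power_divide)
  qed
qed

lemma torus_deriv_sum:
  assumes "finite A" "\<And>i. i \<in> A \<Longrightarrow> torus_smooth (f i)"
  shows "torus_deriv v (\<lambda>p. \<Sum>i\<in>A. f i p) = (\<lambda>p. \<Sum>i\<in>A. torus_deriv v (f i) p)"
  using assms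
proof (induction A rule: finite_induct)
  case empty
  then show ?case by (simp add: torus_deriv_const)
next
  case (insert x A)
  have "torus_deriv v (\<lambda>p. 1 * f x p + 1 * (\<Sum>i\<in>A. f i p)) =
      (\<lambda>p. 1 * torus_deriv v (f x) p + 1 * torus_deriv v (\<lambda>p. \<Sum>i\<in>A. f i p) p)"
    using insert by (intro torus_deriv_linear torus_smooth_differentiable torus_smooth_sum) auto
  then show ?case using insert by simp
qed

lemma torus_laplacian_sum:
  assumes "finite A" "\<And>i. i \<in> A \<Longrightarrow> torus_smooth (f i)"
  shows "torus_laplacian (\<lambda>p. \<Sum>i\<in>A. f i p) = (\<lambda>p. \<Sum>i\<in>A. torus_laplacian (f i) p)"
  unfolding torus_laplacian_eq
  by (rule ext) (simp add: torus_deriv_sum assms torus_smooth_deriv sum.distrib)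

lemma to_L2_sum:
  fixes f :: "'i \<Rightarrow> torus \<Rightarrow> 'a::euclidean_space"
  assumes "finite A" "\<And>i. i \<in> A \<Longrightarrow> square_integrable (f i)"
  shows "square_integrable (\<lambda>p. \<Sum>i\<in>A. f i p) \<and> to_L2 (\<lambda>p. \<Sum>i\<in>A. f i p) = (\<Sum>i\<in>A. to_L2 (f i))"
  using assms
proof (induction A rule: finite_induct)
  case empty
  then show ?case by (simp add: square_integrable_zero zero_torus_L2_def)
next
  case (insert x A)
  then have "square_integrable (f x)" "square_integrable (\<lambda>p. \<Sum>i\<in>A. f i p)"
    "to_L2 (\<lambda>p. \<Sum>i\<in>A. f i p) = (\<Sum>i\<in>A. to_L2 (f i))" by auto
  then show ?case
    using insert.hyps square_integrable_add[of "f x" "\<lambda>p. \<Sum>i\<in>A. f i p"] to_L2_add[of "f x" "\<lambda>p. \<Sum>i\<in>A. f i p"]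
    by simp
qed

lemma real_wave_in_H1: "to_L2 (real_wave A B k) \<in> H1"
  using H1_represents_smooth[OF torus_smooth_real_wave] unfolding H1_def by blast

lemma H1_B_real_wave:
  assumes "u \<in> H1"
  shows "H1_B u (to_L2 (real_wave A B k)) = - norm_sq k * (u \<bullet> to_L2 (real_wave A B k))"
  by (simp add: H1_pairing_smooth(1)[OF assms torus_smooth_real_wave] to_L2_laplacian_real_wave)

text \<open>Pairing an element of the kernel with the waves shows that all its coefficients at nonzero
  frequencies vanish, so the kernel consists of the constants.\<close>

lemma H1_kernel_eq: "H1_kernel = range (\<lambda>r. to_L2 (real_wave r 0 0))"
proof (intro equalityI subsetI)
  fix u assume "u \<in> H1_kernel"
  then have u: "u \<in> H1" "\<And>v. v \<in> H1 \<Longrightarrow> H1_B u v = 0" by (auto simp: H1_kernel_def)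
  have zero: "u \<bullet> to_L2 (real_wave A B k) = 0" if "k \<noteq> 0" for A B k
    using u(2)[OF real_wave_in_H1[of A B k]] norm_sq_pos[OF that] by (simp add: H1_B_real_wave[OF u(1)])
  define r where "r = u \<bullet> cos_L2 0 / (2 * pi)\<^sup>2"
  have c: "to_L2 (real_wave r 0 0) = r *\<^sub>R cos_L2 0" by (simp add: to_L2_real_wave)
  have "u = to_L2 (real_wave r 0 0)"
  proof (rule real_L2_eqI)
    fix k
    show "u \<bullet> cos_L2 k = to_L2 (real_wave r 0 0) \<bullet> cos_L2 k"
      unfolding c using zero[of k 1 0] cos_L2_zero_inner[of 1 0 k] by (cases "k = 0") (simp_all add: r_def cos_L2_def)
    show "u \<bullet> sin_L2 k = to_L2 (real_wave r 0 0) \<bullet> sin_L2 k"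
      unfolding c using zero[of k 0 1] cos_L2_zero_inner[of 0 1 k] by (cases "k = 0") (simp_all add: sin_L2_def sin_L2_zero[unfolded sin_L2_def])
  qed
  then show "u \<in> range (\<lambda>r. to_L2 (real_wave r 0 0))" by blast
next
  fix u assume "u \<in> range (\<lambda>r. to_L2 (real_wave r 0 0))"
  then obtain r where u: "u = to_L2 (real_wave r 0 0)" by blast
  have "H1_B u v = 0" if "v \<in> H1" for v
    unfolding u H1_pairing_smooth(2)[OF that torus_smooth_real_wave] to_L2_laplacian_real_wave by simp
  then show "u \<in> H1_kernel" unfolding H1_kernel_def u using real_wave_in_H1 by blast
qed

lemma H1_kernel_perp_iff: "u \<in> H1_kernel_perp \<longleftrightarrow> u \<in> H1 \<and> u \<bullet> cos_L2 0 = 0"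
proof -
  have "H1_inner u (to_L2 (real_wave r 0 0)) = r * (u \<bullet> cos_L2 0)" if "u \<in> H1" for r
    unfolding H1_pairing_smooth(3)[OF that torus_smooth_real_wave] to_L2_laplacian_real_wave
    by (simp add: to_L2_real_wave)
  then show ?thesis unfolding H1_kernel_perp_def H1_kernel_eq by (auto simp: mult_eq_0_iff)
qed

lemma real_wave_in_perp: "k \<noteq> 0 \<Longrightarrow> to_L2 (real_wave A B k) \<in> H1_kernel_perp"
  by (simp add: H1_kernel_perp_iff real_wave_in_H1 inner_commute[of _ "cos_L2 0"] cos_L2_zero_inner)

text \<open>A cofinal sequence of finite sets of nonzero frequencies; it turns unconditional sums into limits of
  sequences, by which the Sobolev space is defined.\<close>
definition index_box :: "nat \<Rightarrow> (int \<times> int) set"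
  where "index_box N = {- int N..int N} \<times> {- int N..int N} - {0}"

lemma finite_index_box: "finite (index_box N)"
  by (simp add: index_box_def)

lemma filterlim_index_box: "filterlim index_box (finite_subsets_at_top (- {0})) sequentially"
  unfolding filterlim_finite_subsets_at_top
proof (intro allI impI)
  fix X :: "(int \<times> int) set" assume X: "finite X \<and> X \<subseteq> - {0}"
  define M where "M = (\<Sum>k\<in>X. nat \<bar>fst k\<bar> + nat \<bar>snd k\<bar>)"
  have "X \<subseteq> index_box N" if "N \<ge> M" for N
  proof
    fix k assume k: "k \<in> X"
    have "nat \<bar>fst k\<bar> + nat \<bar>snd k\<bar> \<le> M"
      unfolding M_def using X k by (intro member_le_sum) auto
    then have "\<bar>fst k\<bar> \<le> int N" "\<bar>snd k\<bar> \<le> int N" using that by linarith+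
    then show "k \<in> index_box N" using X k by (cases k) (auto simp: index_box_def)
  qed
  moreover have "index_box N \<subseteq> - {0}" for N by (auto simp: index_box_def)
  ultimately show "\<forall>\<^sub>F N in sequentially. finite (index_box N) \<and> X \<subseteq> index_box N \<and> index_box N \<subseteq> - {0}"
    unfolding eventually_sequentially by (intro exI[of _ M] allI impI conjI finite_index_box)
qed

lemma abs_real_wave_le: "\<bar>real_wave A B k p\<bar> \<le> \<bar>A\<bar> + \<bar>B\<bar>"
proof -
  have "\<bar>real_wave A B k p\<bar> \<le> \<bar>A * cos (angle k (torus_coord p))\<bar> + \<bar>B * sin (angle k (torus_coord p))\<bar>"
    unfolding real_wave_def by (rule abs_triangle_ineq)
  also have "\<dots> \<le> \<bar>A\<bar> * 1 + \<bar>B\<bar> * 1"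
    unfolding abs_mult by (intro add_mono mult_left_mono abs_cos_le_one abs_sin_le_one abs_ge_zero)
  finally show ?thesis by simp
qed

text \<open>The solution is the Fourier series of \<open>h\<close> with the coefficients at \<open>k \<noteq> 0\<close> divided by
  \<open>- norm_sq k\<close>.  It converges absolutely and uniformly, hence to a function \<open>T\<close>.  The Laplacians of
  its partial sums are the partial sums of \<open>h\<close> without its mean, and converge as well; hence the
  partial sums represent \<open>T\<close> in the Sobolev space, and pairing them with \<open>v\<close> gives \<open>h \<bullet> v\<close> in the
  limit, because \<open>v\<close> has mean zero.\<close>

lemma inverse_laplace_real_exists:
  "\<exists>w\<in>H1_kernel_perp. \<forall>v\<in>H1_kernel_perp. H1_B w v = h \<bullet> v"
proof -
  define a b where "a k = h \<bullet> cos_L2 k / (2 * pi)\<^sup>2" and "b k = h \<bullet> sin_L2 k / (2 * pi)\<^sup>2" for k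
  define g where "g k = real_wave (a k) (b k) k" for k
  define t where "t k = real_wave (- a k / norm_sq k) (- b k / norm_sq k) k" for k
  define s where "s N p = (\<Sum>k\<in>index_box N. t k p)" for N p
  let ?M = "\<lambda>k. (\<bar>a k\<bar> + \<bar>b k\<bar>) / norm_sq k"
  define C where "C = (\<Sum>\<^sub>\<infinity>k\<in>- {0}. ?M k)"
  have box: "k \<noteq> 0" if "k \<in> index_box N" for k N using that by (simp add: index_box_def)
  have smooth_t: "torus_smooth (t k)" for k unfolding t_def by (rule torus_smooth_real_wave)
  have smooth_s: "torus_smooth (s N)" for N
    unfolding s_def using torus_smooth_sum[OF finite_index_box smooth_t] .
  have "torus_laplacian (t k) = g k" if "k \<noteq> 0" for k
    unfolding t_def g_def torus_laplacian_real_wave using norm_sq_pos[OF that]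
    by (auto simp: real_wave_def field_simps)
  then have lap: "torus_laplacian (s N) = (\<lambda>p. \<Sum>k\<in>index_box N. g k p)" for N
    unfolding s_def torus_laplacian_sum[OF finite_index_box smooth_t] using box by (auto intro!: sum.cong)
  have lap_lim: "(\<lambda>N. to_L2 (torus_laplacian (s N))) \<longlonglongrightarrow> h - to_L2 (g 0)"
  proof -
    have "((\<lambda>k. to_L2 (g k)) has_sum h) UNIV"
      using real_L2_expansion[of h] by (simp add: g_def a_def b_def)
    moreover have "((\<lambda>k. to_L2 (g k)) has_sum to_L2 (g 0)) {0}" by (rule has_sum_finiteI) auto
    ultimately have "((\<lambda>k. to_L2 (g k)) has_sum (h - to_L2 (g 0))) (UNIV - {0})"
      by (rule has_sum_Diff) simp
    then have "((\<lambda>X. \<Sum>k\<in>X. to_L2 (g k)) \<longlongrightarrow> h - to_L2 (g 0)) (finite_subsets_at_top (- {0}))"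
      unfolding has_sum_def Compl_eq_Diff_UNIV .
    from filterlim_compose[OF this filterlim_index_box]
    have "(\<lambda>N. \<Sum>k\<in>index_box N. to_L2 (g k)) \<longlonglongrightarrow> h - to_L2 (g 0)" .
    moreover have "to_L2 (torus_laplacian (s N)) = (\<Sum>k\<in>index_box N. to_L2 (g k))" for N
      unfolding lap using to_L2_sum[OF finite_index_box, of N g] by (simp add: g_def square_integrable_real_wave)
    ultimately show ?thesis by simp
  qed
  have maj: "?M summable_on (- {0})"
  proof -
    have "(\<lambda>k. (1 / (2 * pi)\<^sup>2) * ((\<bar>h \<bullet> cos_L2 k\<bar> + \<bar>h \<bullet> sin_L2 k\<bar>) / norm_sq k)) summable_on (- {0})"
      by (intro summable_on_cmult_right inverse_laplace_majorant_summable)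
    moreover have "(1 / (2 * pi)\<^sup>2) * ((\<bar>h \<bullet> cos_L2 k\<bar> + \<bar>h \<bullet> sin_L2 k\<bar>) / norm_sq k) = ?M k" for k
      by (simp add: a_def b_def abs_divide add_divide_distrib mult.commute)
    ultimately show ?thesis by (simp only:)
  qed
  have t_le: "\<bar>t k p\<bar> \<le> ?M k" if "k \<noteq> 0" for k p
    using abs_real_wave_le[of "- a k / norm_sq k" "- b k / norm_sq k" k p] norm_sq_pos[OF that]
    unfolding t_def by (simp add: abs_divide add_divide_distrib)
  have maj_nonneg: "?M k \<ge> 0" if "k \<noteq> 0" for k
    using norm_sq_pos[OF that] by simp
  have s_le: "norm (s N p) \<le> C" for N p
  proof -
    have "norm (s N p) \<le> (\<Sum>k\<in>index_box N. ?M k)"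
      unfolding s_def by (rule sum_norm_le) (use t_le box in auto)
    also have "\<dots> \<le> C"
      unfolding C_def using maj_nonneg
      by (intro finite_sum_le_infsum maj finite_index_box) (auto simp: index_box_def)
    finally show ?thesis .
  qed
  have "\<exists>T. (\<lambda>N. s N p) \<longlonglongrightarrow> T" for p
  proof -
    have "(\<lambda>k. norm (t k p)) summable_on (- {0})"
      by (rule summable_on_comparison_test[OF maj]) (use t_le in auto)
    then have "(\<lambda>k. t k p) summable_on (- {0})" by (rule abs_summable_summable)
    then obtain T where "((\<lambda>k. t k p) has_sum T) (- {0})" unfolding summable_on_def by blast
    then have "((\<lambda>X. \<Sum>k\<in>X. t k p) \<longlongrightarrow> T) (finite_subsets_at_top (- {0}))" unfolding has_sum_def .
    from filterlim_compose[OF this filterlim_index_box] show ?thesis unfolding s_def by blast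
  qed
  then obtain T where T: "\<And>p. (\<lambda>N. s N p) \<longlonglongrightarrow> T p" by metis
  have meas: "s N \<in> borel_measurable torus_measure" for N
    by (rule continuous_torus_measurable[OF torus_smooth_continuous[OF smooth_s]])
  have "T \<in> borel_measurable torus_measure"
    by (rule borel_measurable_LIMSEQ_metric[OF meas T])
  from L2_dominated_convergence(2)[OF this meas square_integrable_const s_le T]
  have s_lim: "(\<lambda>N. to_L2 (s N)) \<longlonglongrightarrow> to_L2 T" .
  have rep: "H1_represents s (to_L2 T)"
    by (rule H1I_laplacian_convergent[OF smooth_s s_lim lap_lim])
  have "to_L2 (s N) \<bullet> cos_L2 0 = 0" for N
  proof -
    have "to_L2 (s N) = (\<Sum>k\<in>index_box N. to_L2 (t k))"
      unfolding s_def using to_L2_sum[OF finite_index_box, of N t] by (simp add: t_def square_integrable_real_wave)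
    moreover have "to_L2 (t k) \<bullet> cos_L2 0 = 0" if "k \<in> index_box N" for k
      using box[OF that] by (simp add: t_def inner_commute[of _ "cos_L2 0"] cos_L2_zero_inner)
    ultimately show ?thesis by (simp add: inner_sum_left)
  qed
  then have "to_L2 T \<bullet> cos_L2 0 = 0"
    using tendsto_inner[OF s_lim tendsto_const, of "cos_L2 0"] by (simp add: LIMSEQ_const_iff)
  then have perp: "to_L2 T \<in> H1_kernel_perp"
    using rep unfolding H1_kernel_perp_iff H1_def by blast
  have "H1_B (to_L2 T) v = h \<bullet> v" if "v \<in> H1_kernel_perp" for v
  proof -
    have v: "v \<in> H1" "v \<bullet> cos_L2 0 = 0" using that by (simp_all add: H1_kernel_perp_iff)
    then obtain G where G: "H1_represents G v" by (auto simp: H1_def)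
    have sG: "torus_smooth (G i)" and G_lim: "(\<lambda>i. to_L2 (G i)) \<longlonglongrightarrow> v" for i
      using G by (auto simp: H1_represents_iff)
    have "(\<lambda>i. smooth_B (s i) (G i)) \<longlonglongrightarrow> (h - to_L2 (g 0)) \<bullet> v"
      unfolding smooth_B_eq[OF smooth_s sG] by (rule tendsto_inner[OF lap_lim G_lim])
    then have "H1_B (to_L2 T) v = (h - to_L2 (g 0)) \<bullet> v"
      using H1_B_limit[OF rep G] LIMSEQ_unique by blast
    moreover have "to_L2 (g 0) \<bullet> v = 0"
      using v(2) by (simp add: g_def to_L2_real_wave sin_L2_zero inner_commute)
    ultimately show ?thesis by (simp add: inner_diff_left)
  qed
  then show ?thesis using perp by blast
qed

text \<open>The inverse Laplace operator annihilates the constants, which have frequency 0.\<close>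
definition eigenvalue :: "int \<times> int \<Rightarrow> real"
  where "eigenvalue k = (if k = 0 then 0 else - 1 / norm_sq k)"

text \<open>Pair with the waves of frequency \<open>k\<close>, which are eigenvectors of the Laplacian.\<close>

lemma perp_solution_coefficients:
  assumes "w \<in> H1_kernel_perp" "\<And>v. v \<in> H1_kernel_perp \<Longrightarrow> H1_B w v = h \<bullet> v"
  shows "w \<bullet> cos_L2 k = eigenvalue k * (h \<bullet> cos_L2 k)" "w \<bullet> sin_L2 k = eigenvalue k * (h \<bullet> sin_L2 k)"
proof -
  have w: "w \<in> H1" "w \<bullet> cos_L2 0 = 0" using assms(1) by (simp_all add: H1_kernel_perp_iff)
  have eq: "w \<bullet> to_L2 (real_wave A B k) = eigenvalue k * (h \<bullet> to_L2 (real_wave A B k))" if "k \<noteq> 0" for A B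
    using assms(2)[OF real_wave_in_perp[OF that, of A B]] H1_B_real_wave[OF w(1), of A B k] norm_sq_pos[OF that] that
    by (simp add: eigenvalue_def field_simps)
  show "w \<bullet> cos_L2 k = eigenvalue k * (h \<bullet> cos_L2 k)"
    using eq[of 1 0] w(2) by (cases "k = 0") (simp_all add: cos_L2_def eigenvalue_def)
  show "w \<bullet> sin_L2 k = eigenvalue k * (h \<bullet> sin_L2 k)"
    using eq[of 0 1] sin_L2_zero by (cases "k = 0") (simp_all add: sin_L2_def eigenvalue_def)
qed

lemma inverse_laplace_real_coefficients:
  shows "inverse_laplace_real h \<bullet> cos_L2 k = eigenvalue k * (h \<bullet> cos_L2 k)"
    and "inverse_laplace_real h \<bullet> sin_L2 k = eigenvalue k * (h \<bullet> sin_L2 k)"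
proof -
  obtain w where w: "w \<in> H1_kernel_perp" "\<And>v. v \<in> H1_kernel_perp \<Longrightarrow> H1_B w v = h \<bullet> v"
    using inverse_laplace_real_exists by blast
  have "inverse_laplace_real h = w"
    unfolding inverse_laplace_real_def
  proof (rule the_equality)
    fix w' assume "w' \<in> H1_kernel_perp \<and> (\<forall>v\<in>H1_kernel_perp. H1_B w' v = h \<bullet> v)"
    then have w': "w' \<in> H1_kernel_perp" "\<And>v. v \<in> H1_kernel_perp \<Longrightarrow> H1_B w' v = h \<bullet> v" by blast+
    show "w' = w"
      by (rule real_L2_eqI) (simp_all add: perp_solution_coefficients[OF w] perp_solution_coefficients[OF w'])
  qed (use w in blast)
  then show "inverse_laplace_real h \<bullet> cos_L2 k = eigenvalue k * (h \<bullet> cos_L2 k)"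
    "inverse_laplace_real h \<bullet> sin_L2 k = eigenvalue k * (h \<bullet> sin_L2 k)"
    by (simp_all only: perp_solution_coefficients[OF w])
qed

theorem cinner_fourier_inverse_laplace:
  "L2_cinner (fourier_L2 k) (inverse_laplace f) = complex_of_real (eigenvalue k) * L2_cinner (fourier_L2 k) f"
  unfolding cinner_fourier inverse_laplace_def L2_Re_Complex L2_Im_Complex inverse_laplace_real_coefficients
  by (simp add: complex_eq_iff algebra_simps)

section \<open>Trace class operators diagonal in the Fourier basis\<close>

text \<open>Diagonal operators, described through the Fourier coefficients of their values, which determine the
  operator by completeness.  The bound makes them contractions and is stable under composition.\<close>
definition fourier_multiplier :: "(int \<times> int \<Rightarrow> real) \<Rightarrow> (complex torus_L2 \<Rightarrow> complex torus_L2) \<Rightarrow> bool"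
  where "fourier_multiplier m A \<longleftrightarrow>
    (\<forall>k. \<bar>m k\<bar> \<le> 1) \<and> (\<forall>k u. L2_cinner (fourier_L2 k) (A u) = complex_of_real (m k) * L2_cinner (fourier_L2 k) u)"

lemma
  assumes "fourier_multiplier m A"
  shows fourier_multiplier_le: "\<bar>m k\<bar> \<le> 1"
    and fourier_multiplier_cinner: "L2_cinner (fourier_L2 k) (A u) = complex_of_real (m k) * L2_cinner (fourier_L2 k) u"
  using assms unfolding fourier_multiplier_def by blast+

lemma Parseval_fourier:
  "((\<lambda>k. cnj (L2_cinner (fourier_L2 k) x) * L2_cinner (fourier_L2 k) y) has_sum L2_cinner x y) UNIV"
  using Parseval_identity[OF fourier_orthonormal_basis, of x y]
  by (subst (asm) has_sum_reindex[OF inj_fourier_L2]) (simp add: comp_def)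

lemma Parseval_norm_fourier: "((\<lambda>k. (cmod (L2_cinner (fourier_L2 k) x))\<^sup>2) has_sum (norm x)\<^sup>2) UNIV"
  using Parseval_norm[OF fourier_orthonormal_basis, of x]
  by (subst (asm) has_sum_reindex[OF inj_fourier_L2]) (simp add: comp_def)

lemma fourier_multiplier_bounded:
  assumes "fourier_multiplier m A" shows "L2_bounded_operator A"
proof -
  have le: "\<bar>m k\<bar> \<le> 1" and A: "L2_cinner (fourier_L2 k) (A u) = complex_of_real (m k) * L2_cinner (fourier_L2 k) u" for k u
    using fourier_multiplier_le[OF assms] fourier_multiplier_cinner[OF assms] by blast+
  have add: "A (u + v) = A u + A v" for u v
    by (rule L2_eqI_fourier) (simp add: A L2_cinner_add_right distrib_left)
  have scale: "A (L2_scaleC c u) = L2_scaleC c (A u)" for c u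
    by (rule L2_eqI_fourier) (simp add: A L2_cinner_scaleC_right)
  have real: "r *\<^sub>R u = L2_scaleC (complex_of_real r) u" for r u by (subst L2_scaleC_eq) simp
  have bound: "norm (A u) \<le> norm u * 1" for u
  proof -
    have "(norm (A u))\<^sup>2 \<le> (norm u)\<^sup>2"
    proof (rule has_sum_mono[OF Parseval_norm_fourier[of "A u"] Parseval_norm_fourier[of u]])
      fix k
      have "cmod (L2_cinner (fourier_L2 k) (A u)) \<le> cmod (L2_cinner (fourier_L2 k) u)"
        using mult_right_mono[OF le[of k] norm_ge_zero[of "L2_cinner (fourier_L2 k) u"]] by (simp add: A norm_mult)
      then show "(cmod (L2_cinner (fourier_L2 k) (A u)))\<^sup>2 \<le> (cmod (L2_cinner (fourier_L2 k) u))\<^sup>2"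
        by (intro power_mono) auto
    qed
    then have "norm (A u) \<le> norm u" by (rule power2_le_imp_le) simp
    then show ?thesis by simp
  qed
  have "bounded_linear A"
    by (rule bounded_linear_intro[OF add _ bound]) (simp only: real scale)
  then show ?thesis unfolding L2_bounded_operator_def using scale by blast
qed

lemma fourier_multiplier_unique:
  assumes "fourier_multiplier m A" "fourier_multiplier m B" shows "A = B"
proof
  fix u show "A u = B u"
    by (rule L2_eqI_fourier) (simp only: assms[THEN fourier_multiplier_cinner])
qed

lemma fourier_multiplier_comp:
  assumes "fourier_multiplier m A" "fourier_multiplier m' B" shows "fourier_multiplier (\<lambda>k. m k * m' k) (A \<circ> B)"
  unfolding fourier_multiplier_def
proof (intro conjI allI)
  fix k u
  show "\<bar>m k * m' k\<bar> \<le> 1"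
    unfolding abs_mult using assms[THEN fourier_multiplier_le, of k] by (intro mult_le_one) auto
  show "L2_cinner (fourier_L2 k) ((A \<circ> B) u) = complex_of_real (m k * m' k) * L2_cinner (fourier_L2 k) u"
    by (simp add: assms[THEN fourier_multiplier_cinner] mult.assoc)
qed

lemma fourier_multiplier_power:
  assumes "fourier_multiplier m A" shows "fourier_multiplier (\<lambda>k. m k ^ n) (A ^^ n)"
proof (induction n)
  case (Suc n)
  from fourier_multiplier_comp[OF assms Suc] show ?case by (simp only: power_Suc funpow.simps)
qed (simp add: fourier_multiplier_def)

lemma fourier_multiplier_self_adjoint:
  assumes "fourier_multiplier m A" shows "L2_cinner (A u) v = L2_cinner u (A v)"
proof (rule has_sum_unique[OF Parseval_fourier])
  show "((\<lambda>k. cnj (L2_cinner (fourier_L2 k) (A u)) * L2_cinner (fourier_L2 k) v) has_sum L2_cinner u (A v)) UNIV"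
    using Parseval_fourier[of u "A v"] by (simp add: fourier_multiplier_cinner[OF assms] mult_ac)
qed

lemma fourier_multiplier_fourier:
  assumes "fourier_multiplier m A" shows "A (fourier_L2 k) = L2_scaleC (complex_of_real (m k)) (fourier_L2 k)"
  by (rule L2_eqI_fourier) (simp add: fourier_multiplier_cinner[OF assms] L2_cinner_scaleC_right cinner_fourier_L2)

lemma fourier_multiplier_quadratic_form:
  assumes "fourier_multiplier m A"
  shows "((\<lambda>k. m k * (cmod (L2_cinner (fourier_L2 k) u))\<^sup>2) has_sum Re (L2_cinner u (A u))) UNIV"
    and "L2_cinner u (A u) = complex_of_real (Re (L2_cinner u (A u)))"
proof -
  have "cnj (L2_cinner (fourier_L2 k) u) * L2_cinner (fourier_L2 k) (A u) =
      complex_of_real (m k * (cmod (L2_cinner (fourier_L2 k) u))\<^sup>2)" for k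
    by (simp only: fourier_multiplier_cinner[OF assms] of_real_mult complex_norm_square mult_ac)
  with Parseval_fourier[of u "A u"]
  have "((\<lambda>k. complex_of_real (m k * (cmod (L2_cinner (fourier_L2 k) u))\<^sup>2)) has_sum L2_cinner u (A u)) UNIV"
    by (simp only:)
  from has_sum_bounded_linear[OF bounded_linear_Re this]
  show "((\<lambda>k. m k * (cmod (L2_cinner (fourier_L2 k) u))\<^sup>2) has_sum Re (L2_cinner u (A u))) UNIV"
    by (simp add: comp_def)
  have "cnj (L2_cinner u (A u)) = L2_cinner u (A u)"
    using fourier_multiplier_self_adjoint[OF assms, of u u] L2_cinner_commute[of "A u" u] by simp
  then show "L2_cinner u (A u) = complex_of_real (Re (L2_cinner u (A u)))"
    by (simp add: complex_eq_iff)
qed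

lemma fourier_multiplier_positive:
  assumes "fourier_multiplier m A" "\<And>k. m k \<ge> 0" shows "L2_positive_operator A"
proof -
  have "Re (L2_cinner u (A u)) \<ge> 0" for u
    by (rule has_sum_nonneg[OF fourier_multiplier_quadratic_form(1)[OF assms(1)]]) (use assms(2) in simp)
  then have "L2_cinner u (A u) \<in> \<real>\<^sub>\<ge>\<^sub>0" for u
    by (subst fourier_multiplier_quadratic_form(2)[OF assms(1)]) (simp only: nonneg_Reals_of_real_iff)
  then show ?thesis unfolding L2_positive_operator_def using fourier_multiplier_bounded[OF assms(1)] by blast
qed

lemma fourier_multiplier_adjoint:
  assumes "fourier_multiplier m A" shows "L2_adjoint A = A"
  unfolding L2_adjoint_def
proof (rule the_equality)
  fix B assume B: "L2_bounded_operator B \<and> (\<forall>u v. L2_cinner (B u) v = L2_cinner u (A v))"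
  show "B = A"
  proof
    fix u
    have "L2_cinner (B u) v = L2_cinner (A u) v" for v
      using B fourier_multiplier_self_adjoint[OF assms] by simp
    then have "L2_cinner (B u - A u) (B u - A u) = 0" by (simp add: L2_cinner_diff_left)
    then show "B u = A u" by (simp add: L2_cinner_self)
  qed
qed (use fourier_multiplier_bounded[OF assms] fourier_multiplier_self_adjoint[OF assms] in blast)

text \<open>A positive operator is symmetric, since its quadratic form is real.\<close>

lemma positive_operator_symmetric:
  assumes "L2_positive_operator Q" shows "L2_cinner (Q u) v = L2_cinner u (Q v)"
proof -
  have lin: "Q (u + v) = Q u + Q v" "Q (L2_scaleC c u) = L2_scaleC c (Q u)" for u v c
    using assms linear_simps(1) unfolding L2_positive_operator_def L2_bounded_operator_def by blast+
  have real: "Im (L2_cinner u (Q u)) = 0" for u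
    using assms unfolding L2_positive_operator_def by (auto simp: complex_nonneg_Reals_iff)
  have 1: "Im (L2_cinner u (Q v)) + Im (L2_cinner v (Q u)) = 0" for u v
    using real[of "u + v"] real[of u] real[of v] by (simp add: lin L2_cinner_add_left L2_cinner_add_right)
  have 2: "Re (L2_cinner u (Q v)) = Re (L2_cinner v (Q u))"
    using 1[of u "L2_scaleC \<i> v"] by (simp add: lin L2_cinner_scaleC_left L2_cinner_scaleC_right)
  have "L2_cinner u (Q v) = cnj (L2_cinner v (Q u))"
    using 1[of u v] 2 by (simp add: complex_eq_iff)
  then show ?thesis using L2_cinner_commute[of "Q u" v] by simp
qed

text \<open>If \<open>Q\<close> is positive and \<open>Q (Q e) = l\<^sup>2 e\<close> with \<open>l > 0\<close>, then \<open>(Q + l) (Q - l) e = 0\<close>, and \<open>Q + l\<close> is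
  injective. For \<open>l = 0\<close>, symmetry gives \<open>\<parallel>Q e\<parallel>\<^sup>2 = \<langle>e, Q (Q e)\<rangle> = 0\<close>.\<close>

lemma positive_sqrt_eigenvector:
  assumes "L2_positive_operator Q" "l \<ge> 0" "Q (Q e) = L2_scaleC (complex_of_real (l\<^sup>2)) e"
  shows "Q e = L2_scaleC (complex_of_real l) e"
proof -
  have lin: "Q (u + v) = Q u + Q v" "Q (L2_scaleC c u) = L2_scaleC c (Q u)" "Q (u - v) = Q u - Q v" for u v c
    using assms(1) linear_simps(1,2) unfolding L2_positive_operator_def L2_bounded_operator_def by blast+
  show ?thesis
  proof (cases "l = 0")
    case True
    have "L2_cinner (Q e) (Q e) = L2_cinner e (Q (Q e))" by (rule positive_operator_symmetric[OF assms(1)])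
    then have "L2_cinner (Q e) (Q e) = 0" using True assms(3) by simp
    then show ?thesis using True by (simp add: L2_cinner_self)
  next
    case False
    define f where "f = Q e - L2_scaleC (complex_of_real l) e"
    have "Q f = L2_scaleC (complex_of_real (- l)) f"
      unfolding f_def lin assms(3) by (simp add: L2.scale_right_diff_distrib power2_eq_square)
    then have "L2_cinner f (Q f) = complex_of_real (- l * (norm f)\<^sup>2)"
      by (simp only: L2_cinner_scaleC_right L2_cinner_self of_real_mult)
    moreover have "L2_cinner f (Q f) \<in> \<real>\<^sub>\<ge>\<^sub>0" using assms(1) unfolding L2_positive_operator_def by blast
    ultimately have "- l * (norm f)\<^sup>2 \<ge> 0" by (simp only: nonneg_Reals_of_real_iff)
    then have "f = 0" using False assms(2) by (simp add: mult_le_0_iff)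
    then show ?thesis by (simp add: f_def)
  qed
qed

text \<open>Any positive square root of \<open>P \<circ> P\<close> has the same eigenvalues on the Fourier basis as \<open>P\<close>, by
  \<open>positive_sqrt_eigenvector\<close>.\<close>

lemma fourier_multiplier_sqrt:
  assumes "fourier_multiplier m P" "\<And>k. m k \<ge> 0" shows "L2_sqrt (P \<circ> P) = P"
  unfolding L2_sqrt_def
proof (rule the_equality)
  fix Q assume Q: "L2_positive_operator Q \<and> Q \<circ> Q = P \<circ> P"
  then have pos: "L2_positive_operator Q" ..
  have QP: "Q (Q u) = P (P u)" for u using Q by (metis comp_apply)
  have lin: "P (L2_scaleC c u) = L2_scaleC c (P u)" for c u
    using fourier_multiplier_bounded[OF assms(1)] unfolding L2_bounded_operator_def by blast
  have "Q (Q (fourier_L2 k)) = L2_scaleC (complex_of_real ((m k)\<^sup>2)) (fourier_L2 k)" for k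
    by (simp add: QP fourier_multiplier_fourier[OF assms(1)] lin power2_eq_square)
  then have e: "Q (fourier_L2 k) = L2_scaleC (complex_of_real (m k)) (fourier_L2 k)" for k
    by (rule positive_sqrt_eigenvector[OF pos assms(2)])
  have "L2_cinner (fourier_L2 k) (Q u) = complex_of_real (m k) * L2_cinner (fourier_L2 k) u" for k u
    using positive_operator_symmetric[OF pos, of "fourier_L2 k" u] by (simp add: e L2_cinner_scaleC_left)
  then have "fourier_multiplier m Q"
    unfolding fourier_multiplier_def using fourier_multiplier_le[OF assms(1)] by blast
  then show "Q = P" using fourier_multiplier_unique[OF _ assms(1)] by blast
qed (use fourier_multiplier_positive[OF assms] in blast)

text \<open>For a nonnegative multiplier, the double series of \<open>m k * \<bar>\<langle>e k, u\<rangle>\<bar>\<^sup>2\<close> over the frequencies \<open>k\<close> and the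
  members \<open>u\<close> of an orthonormal basis may be summed in either order; summing over \<open>u\<close> first gives
  \<open>m k\<close>, by Parseval.\<close>

lemma fourier_multiplier_trace_sum:
  assumes "fourier_multiplier m A" "\<And>k. m k \<ge> 0" "(m has_sum t) UNIV" "L2_orthonormal_basis S"
  shows "((\<lambda>u. L2_cinner u (A u)) has_sum complex_of_real t) S"
proof -
  let ?F = "\<lambda>(k, u). m k * (cmod (L2_cinner (fourier_L2 k) u))\<^sup>2"
  have sym: "cmod (L2_cinner u v) = cmod (L2_cinner v u)" for u v
    by (subst L2_cinner_commute) simp
  have norm1: "norm (fourier_L2 k) = 1" for k
  proof -
    have "complex_of_real ((norm (fourier_L2 k))\<^sup>2) = complex_of_real 1"
      unfolding L2_cinner_self[symmetric] by (simp add: cinner_fourier_L2)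
    then have "(norm (fourier_L2 k))\<^sup>2 = 1" using of_real_eq_iff by blast
    then show ?thesis by (metis norm_ge_zero power2_eq_iff_nonneg power_one zero_le_one)
  qed
  have inner: "((\<lambda>u. ?F (k, u)) has_sum m k) S" for k
    using has_sum_cmult_right[OF Parseval_norm[OF assms(4), of "fourier_L2 k"], of "m k"]
    by (simp add: sym[of _ "fourier_L2 k"] norm1)
  have "?F summable_on (UNIV \<times> S)"
    by (rule summable_on_SigmaI[OF inner has_sum_imp_summable[OF assms(3)]]) (use assms(2) in auto)
  then have "(?F has_sum t) (UNIV \<times> S)" by (rule has_sum_SigmaI[OF inner assms(3)])
  then have "((\<lambda>(u, k). ?F (k, u)) has_sum t) (S \<times> UNIV)"
    by (rule has_sum_swap[THEN iffD1])
  then have "((\<lambda>u. Re (L2_cinner u (A u))) has_sum t) S"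
    by (rule has_sum_SigmaD) (use fourier_multiplier_quadratic_form(1)[OF assms(1)] in simp)
  then have "((\<lambda>u. complex_of_real (Re (L2_cinner u (A u)))) has_sum complex_of_real t) S"
    by (rule has_sum_of_real)
  then show ?thesis by (simp only: fourier_multiplier_quadratic_form(2)[OF assms(1), symmetric])
qed

lemma fourier_multiplier_cmult:
  assumes "fourier_multiplier m A" "\<bar>c\<bar> = 1"
  shows "fourier_multiplier (\<lambda>k. c * m k) (\<lambda>u. L2_scaleC (complex_of_real c) (A u))"
  unfolding fourier_multiplier_def L2_cinner_scaleC_right fourier_multiplier_cinner[OF assms(1)] abs_mult assms(2)
  using fourier_multiplier_le[OF assms(1)] by (simp only: of_real_mult mult.assoc mult_1_left simp_thms)

lemma fourier_multiplier_inverse_laplace: "fourier_multiplier eigenvalue inverse_laplace"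
proof -
  have "\<bar>eigenvalue k\<bar> \<le> 1" for k
  proof (cases "k = 0")
    case False
    then have "0 < (fst k)\<^sup>2 + (snd k)\<^sup>2" using norm_sq_pos[OF False] unfolding norm_sq_def by (simp only: of_int_0_less_iff)
    then have "1 \<le> norm_sq k" unfolding norm_sq_def by linarith
    then show ?thesis using False by (simp add: eigenvalue_def abs_divide)
  qed (simp add: eigenvalue_def)
  then show ?thesis unfolding fourier_multiplier_def using cinner_fourier_inverse_laplace by blast
qed

theorem corollary4p3:
  fixes n :: nat
  assumes "n \<ge> 2"
  shows "L2_trace_class (inverse_laplace ^^ n) \<and>
    L2_trace (inverse_laplace ^^ n) = complex_of_real (4 * (- 1) ^ n * zeta_nat n * beta_nat n)"
proof -
  let ?A = "inverse_laplace ^^ n" and ?t = "4 * zeta_nat n * beta_nat n"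
  \<comment> \<open>The multiple \<open>P\<close> with nonnegative eigenvalues is the absolute value of \<open>D\<^sup>-\<^sup>n\<close>.\<close>
  define c :: real where "c = (- 1) ^ n"
  define P where "P u = L2_scaleC (complex_of_real c) (?A u)" for u
  define m where "m k = c * eigenvalue k ^ n" for k
  have c: "\<bar>c\<bar> = 1" "c * c = 1" by (simp_all add: c_def power_abs power_mult_distrib[symmetric])
  have A: "fourier_multiplier (\<lambda>k. eigenvalue k ^ n) ?A"
    by (rule fourier_multiplier_power[OF fourier_multiplier_inverse_laplace])
  have P: "fourier_multiplier m P"
    using fourier_multiplier_cmult[OF A c(1)] by (simp add: P_def[abs_def] m_def[abs_def])
  have m: "m k = (if k = 0 then 0 else 1 / norm_sq k ^ n)" for k
    using assms by (simp add: m_def c_def eigenvalue_def power_mult_distrib[symmetric] power_divide)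
  have m_nonneg: "m k \<ge> 0" for k unfolding m by (cases "k = 0") (simp_all add: norm_sq_pos less_imp_le)
  have "?A \<circ> ?A = P \<circ> P"
  proof (rule fourier_multiplier_unique[OF fourier_multiplier_comp[OF A A]])
    have "m k * m k = eigenvalue k ^ n * eigenvalue k ^ n" for k
      using c(2) by (simp add: m_def mult_ac)
    then show "fourier_multiplier (\<lambda>k. eigenvalue k ^ n * eigenvalue k ^ n) (P \<circ> P)"
      using fourier_multiplier_comp[OF P P] by simp
  qed
  then have abs: "L2_abs ?A = P"
    unfolding L2_abs_def fourier_multiplier_adjoint[OF A] using fourier_multiplier_sqrt[OF P m_nonneg] by simp
  have "(m has_sum ?t) UNIV"
    using norm_sq_summable[OF assms] by (subst has_sum_cong_neutral[where T = "- {0}" and g = "\<lambda>k. 1 / norm_sq k ^ n"]) (auto simp: m)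
  from fourier_multiplier_trace_sum[OF P m_nonneg this]
  have P_sum: "((\<lambda>u. L2_cinner u (P u)) has_sum complex_of_real ?t) S" if "L2_orthonormal_basis S" for S
    using that .
  have A_sum: "((\<lambda>u. L2_cinner u (?A u)) has_sum complex_of_real (c * ?t)) S" if "L2_orthonormal_basis S" for S
  proof -
    have "complex_of_real c * L2_cinner u (P u) = complex_of_real (c * c) * L2_cinner u (?A u)" for u
      by (simp add: P_def L2_cinner_scaleC_right)
    then show ?thesis
      using has_sum_cmult_right[OF P_sum[OF that], of "complex_of_real c"] c(2) by simp
  qed
  have "L2_trace_class ?A"
    unfolding L2_trace_class_def abs
    using fourier_multiplier_bounded[OF A] fourier_orthonormal_basis has_sum_imp_summable[OF P_sum] by blast
  moreover have "L2_trace ?A = complex_of_real (c * ?t)"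
    unfolding L2_trace_def
  proof (rule the_equality)
    fix s assume "\<forall>S. L2_orthonormal_basis S \<longrightarrow> ((\<lambda>u. L2_cinner u (?A u)) has_sum s) S"
    then show "s = complex_of_real (c * ?t)"
      using has_sum_unique A_sum fourier_orthonormal_basis by blast
  qed (use A_sum in blast)
  ultimately show ?thesis by (simp add: c_def mult_ac)
qed

end
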